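(* Let $R$ be a prime (respectively, semiprime) left Goldie ring, let $\mathbb S=R[X;\boldsymbol\alpha,\boldsymbol\delta]$ be a skew polynomial ring of bijective type over a well-ordered set of variables, and let $A$ be an essentially special subextension of $\mathbb S$. Then $A$ is left Goldie and $\operatorname{udim}(A)=\operatorname{udim}(R)$. If moreover $A$ is a strongly essentially special subextension of $\mathbb S$, then $A$ is prime (respectively, semiprime).
   Context: Setting (M): $R$ a ring, $\Omega$ an ordinal, $X=\{x_s:s<\Omega\}$; $T_\kappa$ the standard terms $x_{s_1}\cdots x_{s_n}$ ($s_1\le\cdots\le s_n<\kappa$); $\mathbb S$ has subrings $\mathbb S_\kappa$ ($\kappa\le\Omega$) with $\mathbb S_0=R$, $\mathbb S_\Omega=\mathbb S$, $\mathbb S_\kappa$ free as left $R$-module on $T_\kappa$, $\mathbb S_{\kappa+1}=\mathbb S_\kappa[x_\kappa;\alpha_\kappa,\delta_\kappa]$ an Ore extension with $\alpha_\kappa$ an automorphism and $\delta_\kappa$ an $\alpha_\kappa$-derivation, and $\mathbb S_\kappa=\bigcup_{\eta<\kappa}\mathbb S_\eta$ for limit $\kappa$. Univariate notions (for a ring $S\supseteq R$ free as left $R$-module and an Ore extension $S[x;\alpha,\delta]$): $\operatorname{Deg}_x(A)=\{\deg_xf:0\ne f\in A\}$, $d_A=\gcd(\operatorname{Deg}_x(A)\setminus\{0\})$ if $A\not\subseteq S$, else $0$. A subring $A\supseteq R$ is a special subextension if $A=\sum_m(A\cap Sx^m)$, $\operatorname{Deg}_x(A)=d_A\mathbb N$,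 and for each $0\ne m\in\operatorname{Deg}_x(A)$ there exist $\lambda_m=\upsilon_mx^m\in A$ with $\upsilon_m$ regular in $S$, a subring $B_m$ with $R\subseteq B_m\subseteq A\cap S$ and an automorphism $\alpha_{(m)}$ of $B_m$ with $\deg_x(\lambda_mp-\alpha_{(m)}(p)\lambda_m)<m$ for $p\in B_m$, and for every $q\in S$ with $qx^m\in A$ some $u\in B_m$ regular in $S$ with $uqx^m\in B_m\lambda_m$; for $m=0$: $\lambda_0=1$, $B_0=A\cap S$. A subring $A$ of a ring $B$ is nicely essential if for every finite set $E\subseteq B$ of non-zero elements there is $a\in A$ with $0\ne ax\in A$ for all $x\in E$; strongly nicely essential if moreover for every $x\in B$ there is $c\in A$ with $\{a\in A:ac=0\}=0$ and $cx\in A$. (Strongly) essentially special subextension of $\mathbb S$, by induction on $\Omega$: if $\Omega=0$, a (strongly) nicely essential subring of $R$; if $\Omega$ is a limit ordinal, an increasing union $A=\bigcup_{\kappa\in\Lambda}A_\kappa$, $\Lambda\subseteq\Omega$, with each $A_\kappa$ a (strongly) essentially special subextension of $\mathbb S_\kappa$; if $\Omega=\kappa+1$, a (strongly) nicely essential subring of some special subextension $\widetilde A$ of $\mathbb S_\kappa[x_\kappa;\alpha_\kappa,\delta_\kappa]$ such that every attached ring $B_m$ ($m\in\operatorname{Deg}_{x_\kappa}(\widetilde A)$) is a (strongly) essentially special subextension of $\mathbb S_\kappa$. Left Goldie: finite left uniform dimension and ACC on left annihilators. *)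

theory Defs
  imports Main "HOL-Library.Extended_Nat"
begin

definition is_subring :: "'a::ring_1 set \<Rightarrow> bool" where
  "is_subring S \<longleftrightarrow> 0 \<in> S \<and> 1 \<in> S \<and>
     (\<forall>p\<in>S. \<forall>q\<in>S. p + q \<in> S \<and> p - q \<in> S \<and> p * q \<in> S)"

definition ring_aut :: "'a::ring_1 set \<Rightarrow> ('a \<Rightarrow> 'a) \<Rightarrow> bool" where
  "ring_aut S a \<longleftrightarrow> bij_betw a S S \<and> a 1 = 1 \<and>
     (\<forall>p\<in>S. \<forall>q\<in>S. a (p + q) = a p + a q \<and> a (p * q) = a p * a q)"

definition regular_in :: "'a::ring_1 set \<Rightarrow> 'a \<Rightarrow> bool" where
  "regular_in S u \<longleftrightarrow> u \<in> S \<and> (\<forall>s\<in>S. s * u = 0 \<longrightarrow> s = 0) \<and> (\<forall>s\<in>S. u * s = 0 \<longrightarrow> s = 0)"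

definition ore_ext :: "'a::ring_1 set \<Rightarrow> 'a set \<Rightarrow> 'a \<Rightarrow> ('a \<Rightarrow> 'a) \<Rightarrow> ('a \<Rightarrow> 'a) \<Rightarrow> bool" where
  "ore_ext S T y a d \<longleftrightarrow> is_subring S \<and> is_subring T \<and> S \<subseteq> T \<and> y \<in> T \<and> ring_aut S a \<and>
     (\<forall>p\<in>S. d p \<in> S) \<and>
     (\<forall>p\<in>S. \<forall>q\<in>S. d (p + q) = d p + d q \<and> d (p * q) = a p * d q + d p * q) \<and>
     (\<forall>p\<in>S. y * p = a p * y + d p) \<and>
     (\<forall>t\<in>T. \<exists>n c. (\<forall>i\<le>n. c i \<in> S) \<and> t = (\<Sum>i\<le>n. c i * y ^ i)) \<and>
     (\<forall>n c. (\<forall>i\<le>n. c i \<in> S) \<and> (\<Sum>i\<le>n. c i * y ^ i) = 0 \<longrightarrow> (\<forall>i\<le>n. c i = 0))"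

text \<open>The ordinal \<Omega> is represented by the well-ordered index set I; an ordinal \<kappa> \<le> \<Omega>
  is represented by the initial segment (cut) J = {s. s < \<kappa>} of I.\<close>
definition is_cut :: "'i::wellorder set \<Rightarrow> 'i set \<Rightarrow> bool" where
  "is_cut I J \<longleftrightarrow> J \<subseteq> I \<and> (\<forall>s\<in>J. \<forall>t\<in>I. t \<le> s \<longrightarrow> t \<in> J)"

definition seg :: "'i::wellorder set \<Rightarrow> 'i \<Rightarrow> 'i set" where
  "seg I k = {s \<in> I. s < k}"

definition mon :: "('i \<Rightarrow> 'a::ring_1) \<Rightarrow> 'i list \<Rightarrow> 'a" where
  "mon x l = prod_list (map x l)"

definition std_term :: "'i::wellorder set \<Rightarrow> 'i list \<Rightarrow> bool" where
  "std_term J l \<longleftrightarrow> sorted l \<and> set l \<subseteq> J"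

definition free_std :: "'a::ring_1 set \<Rightarrow> ('i::wellorder \<Rightarrow> 'a) \<Rightarrow> 'i set \<Rightarrow> 'a set \<Rightarrow> bool" where
  "free_std R x J S \<longleftrightarrow>
     (\<forall>l. std_term J l \<longrightarrow> mon x l \<in> S) \<and>
     (\<forall>f\<in>S. \<exists>L c. finite L \<and> (\<forall>l\<in>L. std_term J l \<and> c l \<in> R) \<and> f = (\<Sum>l\<in>L. c l * mon x l)) \<and>
     (\<forall>L c. finite L \<and> (\<forall>l\<in>L. std_term J l \<and> c l \<in> R) \<and> (\<Sum>l\<in>L. c l * mon x l) = 0
        \<longrightarrow> (\<forall>l\<in>L. c l = 0))"

definition skew_setting :: "'a::ring_1 set \<Rightarrow> 'i::wellorder set \<Rightarrow> ('i \<Rightarrow> 'a) \<Rightarrow> ('i set \<Rightarrow> 'a set)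
    \<Rightarrow> ('i \<Rightarrow> 'a \<Rightarrow> 'a) \<Rightarrow> ('i \<Rightarrow> 'a \<Rightarrow> 'a) \<Rightarrow> bool" where
  "skew_setting R I x Sk \<alpha> \<delta> \<longleftrightarrow>
     Sk {} = R \<and>
     (\<forall>J. is_cut I J \<longrightarrow> is_subring (Sk J) \<and> free_std R x J (Sk J)) \<and>
     (\<forall>k\<in>I. ore_ext (Sk (seg I k)) (Sk (insert k (seg I k))) (x k) (\<alpha> k) (\<delta> k)) \<and>
     (\<forall>J. is_cut I J \<and> J \<noteq> {} \<and> (\<forall>j\<in>J. \<exists>j'\<in>J. j < j') \<longrightarrow> Sk J = (\<Union>k\<in>J. Sk (seg I k)))"

definition ore_deg :: "'a::ring_1 set \<Rightarrow> 'a \<Rightarrow> 'a \<Rightarrow> nat" where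
  "ore_deg S y f = (LEAST n. \<exists>c. (\<forall>i\<le>n. c i \<in> S) \<and> f = (\<Sum>i\<le>n. c i * y ^ i))"

definition Deg :: "'a::ring_1 set \<Rightarrow> 'a \<Rightarrow> 'a set \<Rightarrow> nat set" where
  "Deg S y A = {ore_deg S y f | f. f \<in> A \<and> f \<noteq> 0}"

definition dA :: "'a::ring_1 set \<Rightarrow> 'a \<Rightarrow> 'a set \<Rightarrow> nat" where
  "dA S y A = (if A \<subseteq> S then 0 else Gcd (Deg S y A - {0}))"

definition special :: "'a::ring_1 set \<Rightarrow> 'a set \<Rightarrow> 'a \<Rightarrow> 'a set \<Rightarrow> 'a set \<Rightarrow> (nat \<Rightarrow> 'a set) \<Rightarrow> bool" where
  "special R S y T A B \<longleftrightarrow>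
     is_subring A \<and> R \<subseteq> A \<and> A \<subseteq> T \<and>
     (\<forall>f\<in>A. \<exists>n c. (\<forall>i\<le>n. c i \<in> S \<and> c i * y ^ i \<in> A) \<and> f = (\<Sum>i\<le>n. c i * y ^ i)) \<and>
     Deg S y A = {dA S y A * k | k. True} \<and>
     B 0 = A \<inter> S \<and>
     (\<forall>m\<in>Deg S y A. m \<noteq> 0 \<longrightarrow>
        (\<exists>\<upsilon> am. regular_in S \<upsilon> \<and> \<upsilon> * y ^ m \<in> A \<and>
           is_subring (B m) \<and> R \<subseteq> B m \<and> B m \<subseteq> A \<inter> S \<and> ring_aut (B m) am \<and>
           (\<forall>p\<in>B m. ore_deg S y (\<upsilon> * y ^ m * p - am p * (\<upsilon> * y ^ m)) < m) \<and>
           (\<forall>q\<in>S. q * y ^ m \<in> A \<longrightarrow>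
              (\<exists>u\<in>B m. regular_in S u \<and> (\<exists>b\<in>B m. u * q * y ^ m = b * (\<upsilon> * y ^ m))))))"

text \<open>(Strongly, if st) nicely essential subring A of B.\<close>
definition nicely_ess :: "bool \<Rightarrow> 'a::ring_1 set \<Rightarrow> 'a set \<Rightarrow> bool" where
  "nicely_ess st A B \<longleftrightarrow> is_subring A \<and> A \<subseteq> B \<and>
     (\<forall>E. finite E \<and> E \<subseteq> B - {0} \<longrightarrow> (\<exists>a\<in>A. \<forall>e\<in>E. a * e \<in> A \<and> a * e \<noteq> 0)) \<and>
     (st \<longrightarrow> (\<forall>e\<in>B. \<exists>c\<in>A. (\<forall>a\<in>A. a * c = 0 \<longrightarrow> a = 0) \<and> c * e \<in> A))"

text \<open>(Strongly, if st) essentially special subextension of Sk J, by induction on the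
  ordinal represented by the cut J.\<close>
inductive ess :: "bool \<Rightarrow> 'a::ring_1 set \<Rightarrow> 'i::wellorder set \<Rightarrow> ('i \<Rightarrow> 'a) \<Rightarrow> ('i set \<Rightarrow> 'a set)
    \<Rightarrow> 'i set \<Rightarrow> 'a set \<Rightarrow> bool"
  for st R I x Sk where
  base: "nicely_ess st A R \<Longrightarrow> ess st R I x Sk {} A"
| limit: "\<lbrakk> is_cut I J; J \<noteq> {}; \<forall>j\<in>J. \<exists>j'\<in>J. j < j';
           \<Lambda> \<subseteq> J; \<Lambda> \<noteq> {};
           \<forall>k. k \<in> \<Lambda> \<longrightarrow> ess st R I x Sk (seg I k) (Af k);
           \<forall>k k'. k \<in> \<Lambda> \<and> k' \<in> \<Lambda> \<and> k \<le> k' \<longrightarrow> Af k \<subseteq> Af k';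
           A = (\<Union>k\<in>\<Lambda>. Af k) \<rbrakk> \<Longrightarrow> ess st R I x Sk J A"
| succ: "\<lbrakk> k \<in> I;
          special R (Sk (seg I k)) (x k) (Sk (insert k (seg I k))) At B;
          \<forall>m. m \<in> Deg (Sk (seg I k)) (x k) At \<longrightarrow> ess st R I x Sk (seg I k) (B m);
          nicely_ess st A At \<rbrakk> \<Longrightarrow> ess st R I x Sk (insert k (seg I k)) A"

definition left_ideal :: "'a::ring_1 set \<Rightarrow> 'a set \<Rightarrow> bool" where
  "left_ideal A L \<longleftrightarrow> L \<subseteq> A \<and> 0 \<in> L \<and> (\<forall>a\<in>L. \<forall>b\<in>L. a + b \<in> L) \<and> (\<forall>r\<in>A. \<forall>a\<in>L. r * a \<in> L)"

definition two_sided_ideal :: "'a::ring_1 set \<Rightarrow> 'a set \<Rightarrow> bool" where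
  "two_sided_ideal A L \<longleftrightarrow> left_ideal A L \<and> (\<forall>r\<in>A. \<forall>a\<in>L. a * r \<in> L)"

definition indep_fam :: "(nat \<Rightarrow> 'a::ring_1 set) \<Rightarrow> nat \<Rightarrow> bool" where
  "indep_fam L n \<longleftrightarrow> (\<forall>l. (\<forall>i<n. l i \<in> L i) \<and> (\<Sum>i<n. l i) = 0 \<longrightarrow> (\<forall>i<n. l i = 0))"

definition finite_udim :: "'a::ring_1 set \<Rightarrow> bool" where
  "finite_udim A \<longleftrightarrow> \<not> (\<exists>L. (\<forall>i. left_ideal A (L i) \<and> L i \<noteq> {0}) \<and> (\<forall>n. indep_fam L n))"

definition udim :: "'a::ring_1 set \<Rightarrow> enat" where
  "udim A = Sup {enat n | n. \<exists>L. (\<forall>i<n. left_ideal A (L i) \<and> L i \<noteq> {0}) \<and> indep_fam L n}"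

definition lann :: "'a::ring_1 set \<Rightarrow> 'a set \<Rightarrow> 'a set" where
  "lann A X = {a \<in> A. \<forall>y\<in>X. a * y = 0}"

definition acc_lann :: "'a::ring_1 set \<Rightarrow> bool" where
  "acc_lann A \<longleftrightarrow> (\<forall>f :: nat \<Rightarrow> 'a set. (\<forall>n. \<exists>X\<subseteq>A. f n = lann A X) \<and> (\<forall>n. f n \<subseteq> f (Suc n))
      \<longrightarrow> (\<exists>N. \<forall>n\<ge>N. f n = f N))"

definition left_goldie :: "'a::ring_1 set \<Rightarrow> bool" where
  "left_goldie A \<longleftrightarrow> finite_udim A \<and> acc_lann A"

definition prime_ring :: "'a::ring_1 set \<Rightarrow> bool" where
  "prime_ring A \<longleftrightarrow> (\<exists>a\<in>A. a \<noteq> 0) \<and>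
     (\<forall>P Q. two_sided_ideal A P \<and> two_sided_ideal A Q \<and> (\<forall>p\<in>P. \<forall>q\<in>Q. p * q = 0)
        \<longrightarrow> P = {0} \<or> Q = {0})"

definition semiprime_ring :: "'a::ring_1 set \<Rightarrow> bool" where
  "semiprime_ring A \<longleftrightarrow>
     (\<forall>P. two_sided_ideal A P \<and> (\<forall>p\<in>P. \<forall>q\<in>P. p * q = 0) \<longrightarrow> P = {0})"

end

theory Submission
  imports Defs
begin

text \<open>
  A semiprime left Goldie ring is left nonsingular, and nonsingularity together with a bound on the
  uniform dimension passes from \<open>S\<close> to \<open>S[x; \<alpha>, \<delta>]\<close>: nonsingularity by comparing leading coefficients,
  the bound because \<open>n + 1\<close> independent left ideals of \<open>S[x; \<alpha>, \<delta>]\<close> would contain too many independent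
  left \<open>S\<close>-modules inside the polynomials of bounded degree. In a nonsingular ring of finite uniform
  dimension chains of left annihilators are bounded, and this bound is inherited by every subring.

  The uniform dimension of a subextension is controlled by a transfer property of finite linear
  systems: \<open>A \<subseteq> B\<close> is called linearly closed if a system \<open>t \<Lambda> = 0, t v \<noteq> 0\<close> with coefficients in \<open>A\<close> that
  is solvable in \<open>B\<close> is solvable in \<open>A\<close>. Then \<open>A\<close>-independent families remain \<open>B\<close>-independent. The property
  is transitive, compatible with unions, holds for nicely essential subrings and for
  \<open>S \<subseteq> S[x; \<alpha>, \<delta>]\<close>, and it lifts from \<open>A \<inter> S \<subseteq> S\<close> to \<open>A \<subseteq> S[x; \<alpha>, \<delta>]\<close> for a special subextension \<open>A\<close> by
  clearing denominators.

  In the strong case, \<open>a A b = 0\<close> implies \<open>a B b = 0\<close> for \<open>A\<close> strongly nicely essential in \<open>B\<close>; and for a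
  special subextension one compares leading coefficients of \<open>a\<close> and \<open>b\<close> in one common degree \<open>m\<close>, where
  they may be taken in the attached ring \<open>B\<^sub>m\<close>.
\<close>

section \<open>Independent families and uniform dimension\<close>

text \<open>The two bounds in \<open>udim A = udim R\<close> travel differently. The upper bound
  climbs from \<open>R\<close> to \<open>Sk J\<close> and only there descends to \<open>A\<close>.
  The lower bound is carried by \<open>n\<close> explicit elements: from the attached ring
  \<open>B 0\<close>, the constants of a special subextension, they pass into that subextension, and
  one left multiplier moves them on into \<open>A\<close>. Nonsingularity does not descend to
  subrings by itself; it is recovered where the lower bound for the subring meets the upper bound
  for the big ring. Preservation of independence alone is too weak for the induction: a single
  relation between polynomials breaks up, coefficient by coefficient, into simultaneous equations,
  so whole systems have to be carried. Their solutions involve denominators from \<open>S\<close>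
  outside \<open>A\<close>. These are cleared on the left as long as one prescribed value stays
  non-zero, which is the role of the inequation. In the semiprime case leading coefficients only
  show that \<open>p\<close> times \<open>B m\<close> times a twisted copy of \<open>p\<close>
  vanishes; undoing the twist again costs finiteness of the uniform dimension.\<close>

definition indep :: "'a::ring_1 set \<Rightarrow> 'a set \<Rightarrow> 'b set \<Rightarrow> ('b \<Rightarrow> 'a) \<Rightarrow> bool" where
  "indep A K X f \<longleftrightarrow> (\<forall>c. (\<forall>i\<in>X. c i \<in> A) \<and> (\<Sum>i\<in>X. c i * f i) \<in> K \<longrightarrow> (\<forall>i\<in>X. c i * f i \<in> K))"

text \<open>Independence means that the cyclic submodules generated by the \<open>f i\<close> form a
  direct sum modulo \<open>K\<close>: a relation forces the terms \<open>c i * f i\<close> into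
  \<open>K\<close>, not the coefficients to vanish. Working modulo \<open>K\<close> replaces the
  quotient module \<open>M / K\<close>.\<close>

definition indep_family :: "'a::ring_1 set \<Rightarrow> 'a set \<Rightarrow> 'a set \<Rightarrow> 'b set \<Rightarrow> ('b \<Rightarrow> 'a) \<Rightarrow> bool" where
  "indep_family A K M X f \<longleftrightarrow> finite X \<and> (\<forall>i\<in>X. f i \<in> M \<and> f i \<notin> K) \<and> indep A K X f"

text \<open>Index sets of naturals keep the definition free of an extra type variable;
  \<open>udim_leD\<close> passes to arbitrary index types. Cyclic submodules suffice as tests, since
  every non-zero submodule contains one.\<close>

definition udim_le :: "'a::ring_1 set \<Rightarrow> 'a set \<Rightarrow> 'a set \<Rightarrow> nat \<Rightarrow> bool" where
  "udim_le A K M n \<longleftrightarrow> (\<forall>(X::nat set) f. indep_family A K M X f \<longrightarrow> card X \<le> n)"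

definition udim_ge :: "'a::ring_1 set \<Rightarrow> nat \<Rightarrow> bool" where
  "udim_ge A n \<longleftrightarrow> (\<exists>f :: nat \<Rightarrow> 'a. indep_family A {0} A {..<n} f)"

definition submod :: "'a::ring_1 set \<Rightarrow> 'a set \<Rightarrow> bool" where
  "submod A K \<longleftrightarrow> 0 \<in> K \<and> (\<forall>a\<in>K. \<forall>b\<in>K. a + b \<in> K) \<and> (\<forall>r\<in>A. \<forall>a\<in>K. r * a \<in> K)"

lemma subringD:
  assumes "is_subring S"
  shows "0 \<in> S" "1 \<in> S" "p \<in> S \<Longrightarrow> q \<in> S \<Longrightarrow> p + q \<in> S" "p \<in> S \<Longrightarrow> q \<in> S \<Longrightarrow> p - q \<in> S"
    "p \<in> S \<Longrightarrow> q \<in> S \<Longrightarrow> p * q \<in> S" "p \<in> S \<Longrightarrow> - p \<in> S"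
proof -
  show zero: "0 \<in> S" and "1 \<in> S" using assms unfolding is_subring_def by simp_all
  show "p + q \<in> S" "p - q \<in> S" "p * q \<in> S" if "p \<in> S" "q \<in> S"
    using assms that unfolding is_subring_def by simp_all
  have "0 - p \<in> S" if "p \<in> S" using assms that zero unfolding is_subring_def by blast
  then show "- p \<in> S" if "p \<in> S" using that by simp
qed

lemma subring_sum:
  assumes "is_subring S" "\<And>i. i \<in> X \<Longrightarrow> f i \<in> S"
  shows "sum f X \<in> S"
  using assms(2)
  by (induction X rule: infinite_finite_induct) (auto simp: subringD[OF assms(1)])

lemma subring_pow:
  assumes "is_subring S" "p \<in> S"
  shows "p ^ i \<in> S"
  by (induction i) (auto simp: subringD[OF assms(1)] assms(2))

lemma submodD:
  assumes "submod A K"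
  shows "0 \<in> K" "a \<in> K \<Longrightarrow> b \<in> K \<Longrightarrow> a + b \<in> K" "r \<in> A \<Longrightarrow> a \<in> K \<Longrightarrow> r * a \<in> K"
  using assms unfolding submod_def by auto

lemma submod_sum:
  assumes "submod A K" "\<And>i. i \<in> X \<Longrightarrow> f i \<in> K"
  shows "sum f X \<in> K"
  using assms(2)
  by (induction X rule: infinite_finite_induct) (auto simp: submodD[OF assms(1)])

lemma submod_diff:
  assumes "is_subring A" "submod A K" "a \<in> K" "b \<in> K"
  shows "a - b \<in> K"
proof -
  have "-1 \<in> A" by (simp add: subringD[OF assms(1)])
  then have "- b \<in> K" using submodD(3)[OF assms(2) _ assms(4), of "-1"] by simp
  then show ?thesis using submodD(2)[OF assms(2,3)] by force
qed

lemma submod_self: "is_subring A \<Longrightarrow> submod A A"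
  unfolding submod_def by (auto simp: subringD)

lemma submod_zero: "submod A {0}"
  unfolding submod_def by auto

lemma submod_principal:
  assumes "is_subring A"
  shows "submod A ((\<lambda>s. s * a) ` A)"
  unfolding submod_def
proof (intro conjI ballI)
  show "0 \<in> (\<lambda>s. s * a) ` A" using subringD(1)[OF assms] by force
next
  fix x y assume "x \<in> (\<lambda>s. s * a) ` A" "y \<in> (\<lambda>s. s * a) ` A"
  then obtain s t where "s \<in> A" "t \<in> A" "x = s * a" "y = t * a" by auto
  then show "x + y \<in> (\<lambda>s. s * a) ` A"
    using subringD(3)[OF assms] by (metis distrib_right image_eqI)
next
  fix r x assume r: "r \<in> A" "x \<in> (\<lambda>s. s * a) ` A"
  then obtain s where "s \<in> A" "x = s * a" by auto
  then show "r * x \<in> (\<lambda>s. s * a) ` A"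
    using subringD(5)[OF assms r(1)] by (auto simp: mult.assoc[symmetric])
qed

lemma indepD: "indep A K X f \<Longrightarrow> (\<And>i. i \<in> X \<Longrightarrow> c i \<in> A) \<Longrightarrow> (\<Sum>i\<in>X. c i * f i) \<in> K \<Longrightarrow> i \<in> X \<Longrightarrow> c i * f i \<in> K"
  unfolding indep_def by blast

lemma indepI: "(\<And>c i. (\<And>i. i \<in> X \<Longrightarrow> c i \<in> A) \<Longrightarrow> (\<Sum>i\<in>X. c i * f i) \<in> K \<Longrightarrow> i \<in> X \<Longrightarrow> c i * f i \<in> K)
   \<Longrightarrow> indep A K X f"
  unfolding indep_def by (intro allI impI ballI) (elim conjE, simp)

lemma indep_reindex:
  assumes "indep A K Y f" "bij_betw h X Y"
  shows "indep A K X (f \<circ> h)"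
proof (rule indepI)
  fix c i assume c: "\<And>i. i \<in> X \<Longrightarrow> c i \<in> A" and s: "(\<Sum>i\<in>X. c i * (f \<circ> h) i) \<in> K" and i: "i \<in> X"
  define g where "g = inv_into X h"
  have gh: "g (h j) = j" if "j \<in> X" for j
    using that assms(2) unfolding g_def by (meson bij_betw_inv_into_left)
  have gX: "g j \<in> X" if "j \<in> Y" for j
    using that assms(2) unfolding g_def by (metis bij_betw_def inv_into_into)
  have "(\<Sum>i\<in>X. c i * (f \<circ> h) i) = (\<Sum>i\<in>X. (\<lambda>j. c (g j) * f j) (h i))"
    by (rule sum.cong) (auto simp: gh)
  also have "\<dots> = (\<Sum>j\<in>Y. c (g j) * f j)"
    by (rule sum.reindex_bij_betw[OF assms(2)])
  finally have "(\<Sum>j\<in>Y. (c \<circ> g) j * f j) \<in> K" using s by (simp add: o_def)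
  then have "(c \<circ> g) (h i) * f (h i) \<in> K"
    using indepD[OF assms(1), of "c \<circ> g" "h i"] c gX i assms(2) by (auto simp: bij_betw_def)
  then show "c i * (f \<circ> h) i \<in> K" using gh[OF i] by simp
qed

lemma indep_left_mult:
  assumes "indep B K X g" "\<And>c i. c \<in> A \<Longrightarrow> i \<in> X \<Longrightarrow> c * s i \<in> B"
  shows "indep A K X (\<lambda>i. s i * g i)"
proof (rule indepI)
  fix c i assume c: "\<And>i. i \<in> X \<Longrightarrow> c i \<in> A" and z: "(\<Sum>i\<in>X. c i * (s i * g i)) \<in> K" and i: "i \<in> X"
  have "(\<Sum>i\<in>X. (c i * s i) * g i) \<in> K" using z by (simp add: mult.assoc)
  moreover have "c j * s j \<in> B" if "j \<in> X" for j using assms(2) c that by blast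
  ultimately have "(c i * s i) * g i \<in> K" using indepD[OF assms(1), of "\<lambda>i. c i * s i" i] i by blast
  then show "c i * (s i * g i) \<in> K" by (simp add: mult.assoc)
qed

lemma indep_family_reindex:
  assumes "indep_family A K M Y f" "bij_betw h X Y"
  shows "indep_family A K M X (f \<circ> h)"
proof -
  have "h i \<in> Y" if "i \<in> X" for i using that assms(2) by (auto simp: bij_betw_def)
  then show ?thesis
    using assms(1) indep_reindex[OF _ assms(2), of A K f] bij_betw_finite[OF assms(2)]
    unfolding indep_family_def by simp
qed

lemma udim_leD:
  fixes X :: "'b set"
  assumes "udim_le A K M n" "indep_family A K M X f"
  shows "card X \<le> n"
proof -
  have "finite X" using assms(2) unfolding indep_family_def by auto
  then obtain h :: "nat \<Rightarrow> 'b" where h: "bij_betw h {0..<card X} X"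
    using ex_bij_betw_nat_finite by blast
  have "card {0..<card X} \<le> n"
    using indep_family_reindex[OF assms(2) h] assms(1) unfolding udim_le_def by blast
  then show ?thesis by simp
qed

lemma indep_mono:
  assumes "indep A K X f" "Y \<subseteq> X" "finite X" "0 \<in> A" "A' \<subseteq> A"
  shows "indep A' K Y f"
proof (rule indepI)
  fix c i assume c: "\<And>i. i \<in> Y \<Longrightarrow> c i \<in> A'" and s: "(\<Sum>i\<in>Y. c i * f i) \<in> K" and i: "i \<in> Y"
  define c' where "c' i = (if i \<in> Y then c i else 0)" for i
  have "(\<Sum>i\<in>X. c' i * f i) = (\<Sum>i\<in>Y. c' i * f i)"
    by (rule sum.mono_neutral_right) (use assms in \<open>auto simp: c'_def\<close>)
  also have "\<dots> = (\<Sum>i\<in>Y. c i * f i)"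
    by (rule sum.cong) (auto simp: c'_def)
  finally have "(\<Sum>i\<in>X. c' i * f i) \<in> K" using s by simp
  moreover have "c' j \<in> A" for j using c assms by (auto simp: c'_def)
  ultimately have "c' i * f i \<in> K"
    using indepD[OF assms(1), of c' i] i assms(2) by blast
  then show "c i * f i \<in> K" using i by (simp add: c'_def)
qed

lemma udim_geI:
  assumes "indep_family A {0} A X f"
  shows "udim_ge A (card X)"
proof -
  have "finite X" using assms(1) unfolding indep_family_def by auto
  then obtain h where h: "bij_betw h {..<card X} X"
    using ex_bij_betw_nat_finite lessThan_atLeast0 by metis
  show ?thesis using indep_family_reindex[OF assms(1) h] unfolding udim_ge_def by blast
qed

text \<open>An exchange argument: a relation modulo \<open>K\<close> of minimal support yields an element of \<open>K\<close> that can
  replace one member of the family without destroying independence.\<close>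
lemma udim_steinitz:
  assumes A: "is_subring A" and K: "submod A K" and KM: "K \<subseteq> M"
    and bK: "udim_le A {0} K q" and bM: "udim_le A K M p"
  shows "udim_le A {0} M (p + q)"
  unfolding udim_le_def
proof (intro allI impI)
  fix X :: "nat set" and f :: "nat \<Rightarrow> 'a"
  assume "indep_family A {0} M X f"
  then show "card X \<le> p + q"
  proof (induction "card {i\<in>X. f i \<notin> K}" arbitrary: f rule: less_induct)
    case less
    note fam = less.prems
    have fX: "finite X" and fM: "\<And>i. i \<in> X \<Longrightarrow> f i \<in> M" and f0: "\<And>i. i \<in> X \<Longrightarrow> f i \<noteq> 0"
      and ind: "indep A {0} X f"
      using fam unfolding indep_family_def by auto
    define Y where "Y = {i\<in>X. f i \<notin> K}"
    have "indep_family A {0} K (X - Y) f"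
      using fX fM f0 indep_mono[OF ind, of "X - Y" A] subringD(1)[OF A]
      unfolding indep_family_def Y_def by auto
    then have cK: "card (X - Y) \<le> q" using udim_leD[OF bK] by blast
    have YX: "Y \<subseteq> X" "finite Y" using fX by (auto simp: Y_def)
    have cXY: "card X = card Y + card (X - Y)"
      using card_Diff_subset[OF YX(2,1)] card_mono[OF fX YX(1)] by simp
    show ?case
    proof (cases "indep A K Y f")
      case True
      then have "indep_family A K M Y f"
        using fX fM unfolding indep_family_def Y_def by auto
      then have "card Y \<le> p" using udim_leD[OF bM] by blast
      then show ?thesis using cK cXY by simp
    next
      case False
      define good where "good c \<longleftrightarrow> (\<forall>i. c i \<in> A) \<and> (\<forall>i. i \<notin> Y \<longrightarrow> c i = 0) \<and>
          (\<Sum>i\<in>Y. c i * f i) \<in> K \<and> (\<Sum>i\<in>Y. c i * f i) \<noteq> 0" for c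
      define supp where "supp c = card {i\<in>Y. c i * f i \<noteq> 0}" for c
      obtain c i where c: "\<And>i. i \<in> Y \<Longrightarrow> c i \<in> A" "(\<Sum>i\<in>Y. c i * f i) \<in> K" "i \<in> Y" "c i * f i \<notin> K"
        using False unfolding indep_def by blast
      have "good (\<lambda>i. if i \<in> Y then c i else 0)"
      proof -
        have "(\<Sum>i\<in>Y. c i * f i) \<noteq> 0"
          using indepD[OF indep_mono[OF ind YX(1) fX subringD(1)[OF A] order_refl], of c i] c submodD(1)[OF K]
          by (metis singletonD singletonI)
        moreover have "(\<Sum>i\<in>Y. (if i \<in> Y then c i else 0) * f i) = (\<Sum>i\<in>Y. c i * f i)"
          by (rule sum.cong) auto
        ultimately show ?thesis using c subringD(1)[OF A] unfolding good_def by auto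
      qed
      then obtain c where gc: "good c" and minc: "\<And>c'. good c' \<Longrightarrow> supp c \<le> supp c'"
        using ex_has_least_nat[of good _ supp] by blast
      define y where "y = (\<Sum>i\<in>Y. c i * f i)"
      have yK: "y \<in> K" "y \<noteq> 0" and cA: "\<And>i. c i \<in> A" and cY: "\<And>i. i \<notin> Y \<Longrightarrow> c i = 0"
        using gc unfolding good_def y_def by auto
      obtain i0 where i0: "i0 \<in> Y" "c i0 * f i0 \<noteq> 0"
        using yK(2) unfolding y_def by (meson sum.not_neutral_contains_not_neutral)
      define f' where "f' = f(i0 := y)"
      have yX: "(\<Sum>i\<in>X. c i * f i) = y"
        unfolding y_def by (rule sum.mono_neutral_right) (use fX YX cY in auto)
      have ind': "indep A {0} X f'"
      proof (rule indepI)
        fix z i assume z: "\<And>i. i \<in> X \<Longrightarrow> z i \<in> A" and s: "(\<Sum>i\<in>X. z i * f' i) \<in> {0}" and i: "i \<in> X"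
        have i0X: "i0 \<in> X" using i0 YX by auto
        have zi0: "z i0 \<in> A" using z i0X by auto
        define z' where "z' i = (if i = i0 then 0 else z i)" for i
        have z'A: "z' i \<in> A" if "i \<in> X" for i using z that subringD(1)[OF A] by (auto simp: z'_def)
        have e1: "(\<Sum>i\<in>X. z i * f' i) = z i0 * y + (\<Sum>i\<in>X. z' i * f i)"
        proof -
          have "(\<Sum>i\<in>X. z i * f' i) = z i0 * f' i0 + (\<Sum>i\<in>X - {i0}. z i * f' i)"
            by (rule sum.remove) (use fX i0X in auto)
          also have "(\<Sum>i\<in>X - {i0}. z i * f' i) = (\<Sum>i\<in>X - {i0}. z' i * f i)"
            by (rule sum.cong) (auto simp: f'_def z'_def)
          also have "\<dots> = (\<Sum>i\<in>X. z' i * f i)"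
            by (rule sum.mono_neutral_left) (use fX in \<open>auto simp: z'_def\<close>)
          finally show ?thesis by (simp add: f'_def)
        qed
        have zy: "z i0 * y = (\<Sum>i\<in>X. (z i0 * c i) * f i)"
          unfolding yX[symmetric] by (simp add: sum_distrib_left mult.assoc)
        have "(\<Sum>i\<in>X. (z i0 * c i + z' i) * f i) \<in> {0}"
          using s unfolding e1 zy by (simp add: distrib_right sum.distrib)
        then have "(z i0 * c i0 + z' i0) * f i0 \<in> {0}"
          using indepD[OF ind, of "\<lambda>i. z i0 * c i + z' i" i0] zi0 cA z'A i0X subringD[OF A] by auto
        then have k0: "z i0 * c i0 * f i0 = 0" by (simp add: z'_def)
        \<comment> \<open>Otherwise multiplying the relation by \<open>z i0\<close> gives another
          non-zero value in \<open>K\<close>, and by \<open>k0\<close> the support has lost the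
          index \<open>i0\<close>, against minimality.\<close>
        have "z i0 * y = 0"
        proof (rule ccontr)
          assume n: "z i0 * y \<noteq> 0"
          have e2: "(\<Sum>i\<in>Y. (z i0 * c i) * f i) = z i0 * y"
            unfolding y_def by (simp add: sum_distrib_left mult.assoc)
          have "good (\<lambda>i. z i0 * c i)"
            unfolding good_def e2 using n submodD(3)[OF K zi0 yK(1)] zi0 cA cY subringD[OF A] by auto
          then have "supp c \<le> supp (\<lambda>i. z i0 * c i)" by (rule minc)
          moreover have "supp (\<lambda>i. z i0 * c i) < supp c"
            unfolding supp_def
          proof (rule psubset_card_mono)
            show "{i \<in> Y. z i0 * c i * f i \<noteq> 0} \<subset> {i \<in> Y. c i * f i \<noteq> 0}"
              using i0 k0 by (auto simp: mult.assoc)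
          qed (use YX in auto)
          ultimately show False by simp
        qed
        moreover have "(\<Sum>i\<in>X. z' i * f i) \<in> {0}" using s e1 \<open>z i0 * y = 0\<close> by simp
        then have "z' i * f i = 0" using indepD[OF ind, of z' i] z'A i by auto
        ultimately show "z i * f' i \<in> {0}" by (auto simp: f'_def z'_def split: if_splits)
      qed
      have "indep_family A {0} M X f'"
        using ind' fX fM f0 yK KM unfolding indep_family_def f'_def by auto
      moreover have "card {i\<in>X. f' i \<notin> K} < card {i\<in>X. f i \<notin> K}"
        by (rule psubset_card_mono) (use fX i0 yK in \<open>auto simp: f'_def Y_def\<close>)
      ultimately show ?thesis using less.hyps by blast
    qed
  qed
qed

section \<open>Nonsingularity and chain conditions\<close>

text \<open>It is enough to see that the last term of every vanishing initial sum is zero: this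
  removes the terms of a relation one by one from the top.\<close>

lemma indep_triangular:
  fixes w :: "nat \<Rightarrow> 'a::ring_1"
  assumes "\<And>c i. i < k \<Longrightarrow> (\<And>j. j \<le> i \<Longrightarrow> c j \<in> S) \<Longrightarrow> (\<Sum>j<Suc i. c j * w j) = 0 \<Longrightarrow> c i * w i = 0"
  shows "indep S {0} {..<k} w"
  using assms
proof (induction k)
  case 0
  then show ?case by (simp add: indep_def)
next
  case (Suc k)
  show ?case
  proof (rule indepI)
    fix c i assume c: "\<And>i. i \<in> {..<Suc k} \<Longrightarrow> c i \<in> S" and s: "(\<Sum>i<Suc k. c i * w i) \<in> {0}"
      and i: "i \<in> {..<Suc k}"
    have k: "c k * w k = 0" using Suc.prems[of k c] c s by auto
    have "(\<Sum>i<k. c i * w i) \<in> {0}" using s k by simp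
    moreover have "indep S {0} {..<k} w"
      by (rule Suc.IH, rule Suc.prems) (erule less_SucI)
    ultimately have "c i * w i \<in> {0}" if "i < k"
      using that c by (intro indepD[of S "{0}" "{..<k}" w c i]) auto
    then show "c i * w i \<in> {0}" using i k by (cases "i = k") simp_all
  qed
qed

definition elt_prime :: "'a::ring_1 set \<Rightarrow> bool" where
  "elt_prime A \<longleftrightarrow> (\<forall>a\<in>A. \<forall>b\<in>A. (\<forall>z\<in>A. a * z * b = 0) \<longrightarrow> a = 0 \<or> b = 0)"

definition elt_semiprime :: "'a::ring_1 set \<Rightarrow> bool" where
  "elt_semiprime A \<longleftrightarrow> (\<forall>a\<in>A. (\<forall>z\<in>A. a * z * a = 0) \<longrightarrow> a = 0)"

text \<open>The vanishing of the left singular ideal: the premise on \<open>f\<close> says that its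
  left annihilator meets every non-zero cyclic left ideal, that is, that it is essential.\<close>

definition nonsing :: "'a::ring_1 set \<Rightarrow> bool" where
  "nonsing A \<longleftrightarrow> (\<forall>f\<in>A. (\<forall>r\<in>A. r \<noteq> 0 \<longrightarrow> (\<exists>s\<in>A. s * r \<noteq> 0 \<and> s * r * f = 0)) \<longrightarrow> f = 0)"

definition ess_in :: "'a::ring_1 set \<Rightarrow> 'a set \<Rightarrow> bool" where
  "ess_in S E \<longleftrightarrow> (\<forall>r\<in>S. r \<noteq> 0 \<longrightarrow> (\<exists>s\<in>S. s * r \<noteq> 0 \<and> s * r \<in> E))"

text \<open>Source of the multipliers used later: they lie in a prescribed essential set and still
  do not kill a prescribed element.\<close>

lemma nonsing_ess_in:
  assumes "is_subring S" "nonsing S" "ess_in S E" "w \<in> S" "w \<noteq> 0"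
  obtains z where "z \<in> S" "z \<in> E" "z * w \<noteq> 0"
proof -
  obtain r where r: "r \<in> S" "r \<noteq> 0" "\<And>s. s \<in> S \<Longrightarrow> s * r \<noteq> 0 \<Longrightarrow> s * r * w \<noteq> 0"
    using assms(2,4,5) unfolding nonsing_def by blast
  obtain s where s: "s \<in> S" "s * r \<noteq> 0" "s * r \<in> E"
    using assms(3) r(1,2) unfolding ess_in_def by blast
  have "s * r \<in> S" using subringD(5)[OF assms(1) s(1) r(1)] .
  then show ?thesis using that r(3)[OF s(1,2)] s by blast
qed

lemma ess_in_vimage:
  assumes "is_subring S" "ess_in S E" "0 \<in> E" "x \<in> S"
  shows "ess_in S {z \<in> S. z * x \<in> E}"
  unfolding ess_in_def
proof (intro ballI impI)
  fix r assume r: "r \<in> S" "r \<noteq> 0"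
  show "\<exists>s\<in>S. s * r \<noteq> 0 \<and> s * r \<in> {z \<in> S. z * x \<in> E}"
  proof (cases "r * x = 0")
    case True
    then show ?thesis using r assms(3) subringD(2)[OF assms(1)] by (intro bexI[of _ 1]) auto
  next
    case False
    have "r * x \<in> S" using subringD(5)[OF assms(1) r(1) assms(4)] .
    then obtain s where "s \<in> S" "s * (r * x) \<noteq> 0" "s * (r * x) \<in> E"
      using assms(2) False unfolding ess_in_def by blast
    moreover from this have "s * r \<noteq> 0" by (metis mult.assoc mult_zero_left)
    ultimately show ?thesis using subringD(5)[OF assms(1) _ r(1)]
      by (intro bexI[of _ s]) (auto simp: mult.assoc)
  qed
qed

text \<open>If no non-zero multiple of \<open>x\<close> lay in \<open>X c\<close>, the elements
  \<open>x * c ^ i\<close> would be independent, and there are more than \<open>n\<close> of them. A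
  submodule \<open>X\<close> stable under right multiplication by \<open>c\<close> covers both
  \<open>X = S\<close> and the annihilators needed for primeness.\<close>

lemma ess_in_right_mult:
  assumes S: "is_subring S" and X: "submod S X" "X \<subseteq> S" and c: "c \<in> S" "\<And>s. s \<in> S \<Longrightarrow> s * c = 0 \<Longrightarrow> s = 0"
    and Xc: "\<And>z. z \<in> X \<Longrightarrow> z * c \<in> X" and bd: "udim_le S {0} S n" and x: "x \<in> X" "x \<noteq> 0"
  obtains s z where "s \<in> S" "z \<in> X" "s * x \<noteq> 0" "s * x = z * c"
proof (rule ccontr)
  assume "\<not> thesis"
  then have no: "\<And>s z. s \<in> S \<Longrightarrow> z \<in> X \<Longrightarrow> s * x = z * c \<Longrightarrow> s * x = 0" using that by blast
  define w where "w i = x * c ^ i" for i :: nat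
  have wX: "w i \<in> X \<and> w i \<noteq> 0" for i
  proof (induction i)
    case 0 then show ?case using x by (simp add: w_def)
  next
    case (Suc i)
    have "w (Suc i) = w i * c" by (simp add: w_def power_Suc2 mult.assoc del: power_Suc)
    then show ?case using Suc Xc c(2) X(2) by auto
  qed
  have ind: "\<forall>i<k. s i * w i = 0" if "\<And>i. i < k \<Longrightarrow> s i \<in> S" "(\<Sum>i<k. s i * w i) = 0" for k s
    using that
  proof (induction k arbitrary: s)
    case 0 then show ?case by simp
  next
    case (Suc k)
    let ?z = "\<Sum>i<k. s (Suc i) * w i"
    have z: "?z \<in> X" by (rule submod_sum[OF X(1)]) (use Suc.prems wX submodD(3)[OF X(1)] in auto)
    \<comment> \<open>All terms but the first end in \<open>c\<close>. So the first one lies in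
      \<open>X c\<close>, hence vanishes, and cancelling \<open>c\<close> from the rest leaves a
      shorter relation.\<close>
    have "(\<Sum>i<Suc k. s i * w i) = s 0 * x + ?z * c"
      unfolding sum.lessThan_Suc_shift
      by (simp add: w_def power_Suc2 mult.assoc sum_distrib_right del: power_Suc)
    then have e: "s 0 * x = - ?z * c" using Suc.prems(2) by (simp add: add_eq_0_iff2)
    have "- ?z \<in> X" using submod_diff[OF S X(1) submodD(1)[OF X(1)] z] by simp
    then have s0: "s 0 * x = 0" using no[of "s 0" "- ?z"] e Suc.prems(1) by simp
    then have "?z = 0" using e c(2)[of ?z] z X(2) by auto
    then have "\<forall>i<k. s (Suc i) * w i = 0" using Suc.IH[of "\<lambda>i. s (Suc i)"] Suc.prems(1) by simp
    then have "s (Suc i) * w (Suc i) = 0" if "i < k" for i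
      using that by (simp add: w_def power_Suc2 mult.assoc[symmetric] del: power_Suc)
    then show ?case using s0 by (simp add: All_less_Suc2 w_def)
  qed
  have "indep S {0} {..<Suc n} w"
  proof (rule indepI)
    fix b i assume b: "\<And>i. i \<in> {..<Suc n} \<Longrightarrow> b i \<in> S" "(\<Sum>i<Suc n. b i * w i) \<in> {0}" "i \<in> {..<Suc n}"
    have "\<forall>i<Suc n. b i * w i = 0"
      by (rule ind) (use b(1,2) in blast)+
    then show "b i * w i \<in> {0}" using b(3) by blast
  qed
  then have "indep_family S {0} S {..<Suc n} w"
    unfolding indep_family_def using wX X(2) by blast
  then have "card {..<Suc n} \<le> n" by (rule udim_leD[OF bd])
  then show False by simp
qed

text \<open>Among the non-zero singular elements one with maximal left annihilator satisfies
  \<open>a A a = 0\<close>, which semiprimeness forbids.\<close>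

lemma nonsing_if_semiprime:
  assumes A: "is_subring A" and acc: "acc_lann A" and sp: "elt_semiprime A"
  shows "nonsing A"
proof (rule ccontr)
  define sing where "sing f \<longleftrightarrow> (\<forall>r\<in>A. r \<noteq> 0 \<longrightarrow> (\<exists>s\<in>A. s * r \<noteq> 0 \<and> s * r * f = 0))" for f
  define Z where "Z = {f \<in> A. f \<noteq> 0 \<and> sing f}"
  \<comment> \<open>The left annihilator of \<open>c * f\<close> is the preimage of that of
    \<open>f\<close> under right multiplication by \<open>c\<close>, and such preimages stay
    essential.\<close>
  have mult: "sing (c * f)" if cf: "c \<in> A" "f \<in> A" "sing f" for c f
    unfolding sing_def
  proof (intro ballI impI)
    fix w assume w: "w \<in> A" "w \<noteq> 0"
    show "\<exists>s\<in>A. s * w \<noteq> 0 \<and> s * w * (c * f) = 0"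
    proof (cases "w * c = 0")
      case True
      then have "w * (c * f) = 0" by (simp add: mult.assoc[symmetric])
      then show ?thesis using w subringD(2)[OF A] by (intro bexI[of _ 1]) auto
    next
      case False
      have "w * c \<in> A" using subringD(5)[OF A w(1) cf(1)] .
      then obtain s where "s \<in> A" "s * (w * c) \<noteq> 0" "s * (w * c) * f = 0"
        using cf(3) False unfolding sing_def by blast
      moreover from this have "s * w \<noteq> 0" by (metis mult.assoc mult_zero_left)
      ultimately show ?thesis by (intro bexI[of _ s]) (auto simp: mult.assoc)
    qed
  qed
  assume "\<not> nonsing A"
  then have Zne: "\<exists>f. f \<in> Z" unfolding nonsing_def Z_def sing_def by blast
  have "\<exists>a\<in>Z. \<forall>b\<in>Z. \<not> lann A {a} \<subset> lann A {b}"
  proof (rule ccontr)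
    assume "\<not> ?thesis"
    then have "\<And>a n. a \<in> Z \<Longrightarrow> \<exists>b. b \<in> Z \<and> lann A {a} \<subset> lann A {b}" by blast
    then obtain f :: "nat \<Rightarrow> 'a" where f: "\<And>n. f n \<in> Z" "\<And>n. lann A {f n} \<subset> lann A {f (Suc n)}"
      using dependent_nat_choice[of "\<lambda>_ a. a \<in> Z" "\<lambda>_ a b. lann A {a} \<subset> lann A {b}"] Zne by metis
    have "\<exists>N. \<forall>n\<ge>N. lann A {f n} = lann A {f N}"
      using acc f unfolding acc_lann_def Z_def
      by (elim allE[of _ "\<lambda>n. lann A {f n}"]) blast
    then obtain N where "lann A {f (Suc N)} = lann A {f N}" using le_SucI by blast
    then show False using f(2)[of N] by blast
  qed
  then obtain a where a: "a \<in> A" "a \<noteq> 0" "sing a" and mx: "\<And>b. b \<in> Z \<Longrightarrow> \<not> lann A {a} \<subset> lann A {b}"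
    unfolding Z_def by blast
  have "a * r * a = 0" if r: "r \<in> A" for r
  proof (rule ccontr)
    assume n: "a * r * a \<noteq> 0"
    have ar: "a * r \<in> A" "a * r * a \<in> A" using subringD(5)[OF A] a(1) r by auto
    have "a * r * a \<in> Z" using n mult[OF ar(1) a(1,3)] ar unfolding Z_def by blast
    \<comment> \<open>\<open>r * a\<close> is singular, so its annihilator meets the left ideal
      generated by \<open>a\<close>: this \<open>s\<close> kills \<open>a * r * a\<close> but not
      \<open>a\<close>, contrary to the maximal choice.\<close>
    moreover obtain s where s: "s \<in> A" "s * a \<noteq> 0" "s * a * (r * a) = 0"
      using mult[OF r a(1,3)] a(1,2) unfolding sing_def by blast
    have "lann A {a} \<subset> lann A {a * r * a}"
    proof
      have "t * (a * r * a) = 0" if "t * a = 0" for t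
        using that by (metis mult.assoc mult_zero_left)
      then show "lann A {a} \<subseteq> lann A {a * r * a}" unfolding lann_def by auto
      have "s \<in> lann A {a * r * a}" "s \<notin> lann A {a}"
        using s unfolding lann_def by (auto simp: mult.assoc)
      then show "lann A {a} \<noteq> lann A {a * r * a}" by blast
    qed
    ultimately show False using mx by blast
  qed
  then show False using sp a(1,2) unfolding elt_semiprime_def by blast
qed

text \<open>A strictly ascending chain yields \<open>a i\<close>, \<open>x i\<close> with
  \<open>a i * x i\<close> non-zero and \<open>a i * x j = 0\<close> for \<open>j > i\<close>. This
  triangular pattern makes suitable multiples \<open>r i * a i\<close> independent, more of them
  than \<open>n\<close>.\<close>

lemma acc_lann_if_nonsing:
  assumes S: "is_subring S" and ns: "nonsing S" and bd: "udim_le S {0} S n" and AS: "A \<subseteq> S"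
  shows "acc_lann A"
  unfolding acc_lann_def
proof (intro allI impI, rule ccontr)
  fix f :: "nat \<Rightarrow> 'a set"
  assume "(\<forall>n. \<exists>X\<subseteq>A. f n = lann A X) \<and> (\<forall>n. f n \<subseteq> f (Suc n))"
  then have fX: "\<And>n. \<exists>X\<subseteq>A. f n = lann A X" and "\<And>n. f n \<subseteq> f (Suc n)" by auto
  then have mono: "f m \<subseteq> f k" if "m \<le> k" for m k using that lift_Suc_mono_le[of f] by blast
  obtain X where X: "\<And>n. X n \<subseteq> A" "\<And>n. f n = lann A (X n)" using fX by metis
  assume "\<nexists>N. \<forall>n\<ge>N. f n = f N"
  then have ex: "\<And>N. \<exists>n\<ge>N. f n \<noteq> f N" by blast
  obtain g :: "nat \<Rightarrow> nat" where g: "\<And>i. g i \<le> g (Suc i) \<and> f (g (Suc i)) \<noteq> f (g i)"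
    using dependent_nat_choice[of "\<lambda>_ _. True" "\<lambda>_ a b. a \<le> b \<and> f b \<noteq> f a"] ex by auto
  have gm: "g i \<le> g j" if "i \<le> j" for i j using that g lift_Suc_mono_le[of g] by blast
  have "\<exists>a x. a \<in> f (g (Suc i)) \<and> x \<in> X (g i) \<and> a * x \<noteq> 0" for i
  proof -
    have "f (g i) \<subset> f (g (Suc i))" using g[of i] mono[of "g i" "g (Suc i)"] by blast
    then obtain a where a: "a \<in> f (g (Suc i))" "a \<notin> f (g i)" by blast
    have "a \<in> A" using a(1) X(2) unfolding lann_def by auto
    then show ?thesis using a X(2)[of "g i"] unfolding lann_def by blast
  qed
  then obtain a x where ax: "\<And>i. a i \<in> f (g (Suc i))" "\<And>i. x i \<in> X (g i)" "\<And>i. a i * x i \<noteq> 0" by metis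
  have aA: "a i \<in> S" "x i \<in> S" for i
    using ax X AS unfolding lann_def by fastforce+
  have ax0: "a i * x j = 0" if "i < j" for i j
  proof -
    have "a i \<in> f (g j)" using ax(1)[of i] mono[OF gm[of "Suc i" j]] that by auto
    then show ?thesis using ax(2)[of j] X(2) unfolding lann_def by auto
  qed
  \<comment> \<open>Left multiples of \<open>r i\<close> are detected by \<open>a i * x i\<close>.
    Without this factor a relation would only give \<open>c i * a i * x i = 0\<close>, not
    \<open>c i * a i = 0\<close>.\<close>
  have "\<exists>r\<in>S. r \<noteq> 0 \<and> (\<forall>s\<in>S. s * r * (a i * x i) = 0 \<longrightarrow> s * r = 0)" for i
    using ns ax(3)[of i] subringD(5)[OF S aA[of i]] unfolding nonsing_def by blast
  then obtain r where r: "\<And>i. r i \<in> S" "\<And>i. r i \<noteq> 0"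
    "\<And>i s. s \<in> S \<Longrightarrow> s * r i * (a i * x i) = 0 \<Longrightarrow> s * r i = 0" by metis
  have "indep S {0} {..<Suc n} (\<lambda>i. r i * a i)"
  proof (rule indep_triangular)
    fix c i assume c: "\<And>j. j \<le> i \<Longrightarrow> c j \<in> S" and s: "(\<Sum>j<Suc i. c j * (r j * a j)) = 0"
    have "0 = (\<Sum>j<Suc i. c j * (r j * a j)) * x i" using s by simp
    also have "\<dots> = (\<Sum>j<Suc i. c j * r j * (a j * x i))" by (simp only: sum_distrib_right mult.assoc)
    also have "\<dots> = c i * r i * (a i * x i)" using ax0 by simp
    finally have "c i * r i = 0" using r(3)[of "c i" i] c by simp
    then show "c i * (r i * a i) = 0" by (simp add: mult.assoc[symmetric])
  qed
  moreover have "r i * a i \<in> S" "r i * a i \<noteq> 0" for i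
    using subringD[OF S] r aA r(3)[of 1 i] by (auto simp: mult.assoc[symmetric])
  ultimately have "indep_family S {0} S {..<Suc n} (\<lambda>i. r i * a i)"
    unfolding indep_family_def by auto
  from udim_leD[OF bd this] show False by simp
qed

text \<open>The hypothesis merely excludes an infinite direct sum, and a uniform bound has to be
  extracted from it. If there is none, every unbounded submodule splits off a non-zero cyclic piece
  that meets another unbounded submodule trivially, and iterating this builds an infinite direct
  sum.\<close>

lemma udim_le_if_finite_udim:
  assumes A: "is_subring A" and fin: "finite_udim A"
  obtains n where "udim_le A {0} A n"
proof (rule ccontr)
  assume no: "\<not> thesis"
  define pr where "pr a = (\<lambda>s. s * a) ` A" for a
  have pr: "submod A (pr a)" for a unfolding pr_def by (rule submod_principal[OF A])
  define unb where "unb L \<longleftrightarrow> submod A L \<and> L \<subseteq> A \<and> (\<forall>n. \<not> udim_le A {0} L n)" for L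
  have step: "\<exists>a L'. a \<in> L \<and> a \<noteq> 0 \<and> unb L' \<and> L' \<subseteq> L \<and> L' \<inter> pr a \<subseteq> {0}" if L: "unb L" for L
  proof -
    have LS: "submod A L" "L \<subseteq> A" using L unfolding unb_def by auto
    have prL: "pr a \<subseteq> L" if "a \<in> L" for a using that submodD(3)[OF LS(1)] unfolding pr_def by auto
    obtain X :: "nat set" and f where X: "indep_family A {0} L X f" "\<not> card X \<le> 1"
      using L unfolding unb_def udim_le_def by blast
    then obtain i j where ij: "i \<in> X" "j \<in> X" "i \<noteq> j"
      unfolding indep_family_def using card_le_Suc0_iff_eq by (metis One_nat_def)
    have ind: "indep A {0} {i,j} f"
      using X(1) indep_mono[of A "{0}" X f "{i,j}" A] ij subringD(1)[OF A]
      unfolding indep_family_def by blast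
    have f: "f i \<in> L" "f j \<in> L" "f i \<noteq> 0" "f j \<noteq> 0" using X(1) ij unfolding indep_family_def by auto
    have int: "pr (f i) \<inter> pr (f j) \<subseteq> {0}"
    proof
      fix x assume "x \<in> pr (f i) \<inter> pr (f j)"
      then obtain s t where st: "s \<in> A" "t \<in> A" "x = s * f i" "x = t * f j" unfolding pr_def by auto
      define c where "c k = (if k = i then s else - t)" for k
      have "(\<Sum>k\<in>{i,j}. c k * f k) \<in> {0}" using st ij(3) by (simp add: c_def)
      then have "c i * f i \<in> {0}" using indepD[OF ind, of c i] st subringD[OF A] by (simp add: c_def)
      then show "x \<in> {0}" using st by (simp add: c_def)
    qed
    show ?thesis
    \<comment> \<open>If \<open>pr (f i)\<close> is itself unbounded, \<open>f j\<close> is split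
      off and \<open>pr (f i)\<close> is kept; otherwise \<open>f i\<close> is split off and a
      maximal complement of \<open>pr (f i)\<close> in \<open>L\<close> is kept.\<close>
    proof (cases "unb (pr (f i))")
      case True
      then show ?thesis using f prL int by blast
    next
      case False
      then obtain q where q: "udim_le A {0} (pr (f i)) q"
        using pr prL[OF f(1)] LS(2) unfolding unb_def by blast
      define CC where "CC = {C. submod A C \<and> C \<subseteq> L \<and> C \<inter> pr (f i) \<subseteq> {0}}"
      have "{0} \<in> CC" unfolding CC_def using submod_zero submodD(1)[OF LS(1)] by auto
      moreover have "\<Union>\<C> \<in> CC" if ch: "\<C> \<noteq> {}" "subset.chain CC \<C>" for \<C>
      proof -
        have C: "\<And>C. C \<in> \<C> \<Longrightarrow> C \<in> CC" "\<And>C D. C \<in> \<C> \<Longrightarrow> D \<in> \<C> \<Longrightarrow> C \<subseteq> D \<or> D \<subseteq> C"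
          using ch(2) unfolding subset_chain_def by auto
        have "submod A (\<Union>\<C>)"
          unfolding submod_def
        proof (intro conjI ballI)
          show "0 \<in> \<Union>\<C>" using ch(1) C(1) submodD(1) unfolding CC_def by blast
        next
          fix a b assume "a \<in> \<Union>\<C>" "b \<in> \<Union>\<C>"
          then obtain D where "D \<in> \<C>" "a \<in> D" "b \<in> D" using C(2) by blast
          then show "a + b \<in> \<Union>\<C>" using C(1) submodD(2) unfolding CC_def by blast
        next
          fix r a assume "r \<in> A" "a \<in> \<Union>\<C>"
          then show "r * a \<in> \<Union>\<C>" using C(1) submodD(3) unfolding CC_def by blast
        qed
        then show ?thesis using C(1) unfolding CC_def by blast
      qed
      ultimately obtain C where C: "C \<in> CC" and mx: "\<And>D. D \<in> CC \<Longrightarrow> C \<subseteq> D \<Longrightarrow> D = C"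
        using subset_Zorn_nonempty[of CC] by blast
      have CS: "submod A C" "C \<subseteq> L" "C \<inter> pr (f i) \<subseteq> {0}" using C unfolding CC_def by auto
      \<comment> \<open>By maximality of \<open>C\<close> every non-zero cyclic submodule of
        \<open>L / C\<close> meets the image of \<open>pr (f i)\<close>, so the bound for
        \<open>pr (f i)\<close> carries over to the quotient.\<close>
      have "udim_le A C L q"
        unfolding udim_le_def
      proof (intro allI impI)
        fix Y :: "nat set" and w
        assume fam: "indep_family A C L Y w"
        have "\<exists>s r. s \<in> A \<and> r \<in> A \<and> s * w k - r * f i \<in> C \<and> r * f i \<noteq> 0" if k: "k \<in> Y" for k
        proof -
          define D where "D = {c + s * w k | c s. c \<in> C \<and> s \<in> A}"
          have wk: "w k \<in> L" "w k \<notin> C" using fam k unfolding indep_family_def by auto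
          have "submod A D"
            unfolding submod_def
          proof (intro conjI ballI)
            have "0 = 0 + 0 * w k" by simp
            then show "0 \<in> D" unfolding D_def using submodD(1)[OF CS(1)] subringD(1)[OF A] by blast
          next
            fix a b assume "a \<in> D" "b \<in> D"
            then obtain c s c' s' where "a = c + s * w k" "b = c' + s' * w k" "c \<in> C" "c' \<in> C" "s \<in> A" "s' \<in> A"
              unfolding D_def by blast
            moreover from this have "a + b = (c + c') + (s + s') * w k" by (simp add: algebra_simps)
            ultimately show "a + b \<in> D" unfolding D_def
              using submodD(2)[OF CS(1)] subringD(3)[OF A] by blast
          next
            fix r a assume r: "r \<in> A" "a \<in> D"
            then obtain c s where "a = c + s * w k" "c \<in> C" "s \<in> A" unfolding D_def by blast
            moreover from this have "r * a = r * c + (r * s) * w k" by (simp add: algebra_simps)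
            ultimately show "r * a \<in> D" unfolding D_def
              using submodD(3)[OF CS(1) r(1)] subringD(5)[OF A r(1)] by blast
          qed
          moreover have "D \<subseteq> L"
            unfolding D_def using CS(2) wk(1) submodD[OF LS(1)] by auto
          moreover have "C \<subseteq> D"
          proof
            fix c assume "c \<in> C"
            moreover have "c = c + 0 * w k" by simp
            ultimately show "c \<in> D" unfolding D_def using subringD(1)[OF A] by blast
          qed
          moreover have "w k \<in> D"
          proof -
            have "w k = 0 + 1 * w k" by simp
            then show ?thesis unfolding D_def using submodD(1)[OF CS(1)] subringD(2)[OF A] by blast
          qed
          ultimately have "\<not> D \<inter> pr (f i) \<subseteq> {0}" using mx[of D] wk(2) unfolding CC_def by blast
          then obtain x where x: "x \<in> D" "x \<in> pr (f i)" "x \<noteq> 0" by blast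
          then obtain c s where cs: "x = c + s * w k" "c \<in> C" "s \<in> A" unfolding D_def by blast
          obtain r where r: "r \<in> A" "x = r * f i" using x(2) unfolding pr_def by auto
          have "s * w k - r * f i = 0 - c" using cs(1) r(2) by simp
          moreover have "0 - c \<in> C" using submod_diff[OF A CS(1) submodD(1)[OF CS(1)] cs(2)] .
          ultimately have "s * w k - r * f i \<in> C" by simp
          then show ?thesis using cs(3) r x(3) by blast
        qed
        then obtain s r where sr: "\<And>k. k \<in> Y \<Longrightarrow> s k \<in> A \<and> r k \<in> A \<and> s k * w k - r k * f i \<in> C \<and> r k * f i \<noteq> 0"
          by metis
        have "indep A {0} Y (\<lambda>k. r k * f i)"
        proof (rule indepI)
          fix z k assume z: "\<And>k. k \<in> Y \<Longrightarrow> z k \<in> A" and zs: "(\<Sum>k\<in>Y. z k * (r k * f i)) \<in> {0}" and k: "k \<in> Y"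
          have "(\<Sum>k\<in>Y. (z k * s k) * w k) = (\<Sum>k\<in>Y. z k * (s k * w k - r k * f i))"
            using zs by (simp add: right_diff_distrib sum_subtractf mult.assoc)
          also have "\<dots> \<in> C" by (rule submod_sum[OF CS(1)]) (use sr z submodD(3)[OF CS(1)] in auto)
          finally have "(z k * s k) * w k \<in> C"
            using indepD[of A C Y w "\<lambda>k. z k * s k" k] fam z sr subringD(5)[OF A] k
            unfolding indep_family_def by blast
          moreover have "z k * (s k * w k - r k * f i) \<in> C" using sr z k submodD(3)[OF CS(1)] by auto
          ultimately have "(z k * s k) * w k - z k * (s k * w k - r k * f i) \<in> C"
            using submod_diff[OF A CS(1)] by blast
          then have "z k * (r k * f i) \<in> C" by (simp add: algebra_simps)
          moreover have "z k * (r k * f i) \<in> pr (f i)"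
            unfolding pr_def using z sr k subringD(5)[OF A] by (auto simp: mult.assoc[symmetric])
          ultimately show "z k * (r k * f i) \<in> {0}" using CS(3) by blast
        qed
        then have "indep_family A {0} (pr (f i)) Y (\<lambda>k. r k * f i)"
          using fam sr unfolding indep_family_def pr_def by auto
        then show "card Y \<le> q" using udim_leD[OF q] by blast
      qed
      \<comment> \<open>A bound for \<open>C\<close> would bound \<open>L\<close> by exchange, so
        \<open>C\<close> inherits unboundedness.\<close>
      then have "udim_le A {0} C p \<Longrightarrow> udim_le A {0} L (q + p)" for p
        using udim_steinitz[OF A CS(1,2)] by blast
      then have "unb C" using L CS LS(2) unfolding unb_def by blast
      then show ?thesis using CS f by blast
    qed
  qed
  have "unb A" using no that submod_self[OF A] unfolding unb_def by blast
  have "\<exists>h :: nat \<Rightarrow> 'a \<times> 'a set. \<forall>n. unb (snd (h n)) \<and>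
      (fst (h (Suc n)) \<in> snd (h n) \<and> fst (h (Suc n)) \<noteq> 0 \<and> snd (h (Suc n)) \<subseteq> snd (h n)
         \<and> snd (h (Suc n)) \<inter> pr (fst (h (Suc n))) \<subseteq> {0})"
  proof (rule dependent_nat_choice)
    show "\<exists>x. unb (snd x)" using \<open>unb A\<close> by auto
  next
    fix x :: "'a \<times> 'a set" and n :: nat assume "unb (snd x)"
    then show "\<exists>y. unb (snd y) \<and> fst y \<in> snd x \<and> fst y \<noteq> 0 \<and> snd y \<subseteq> snd x \<and> snd y \<inter> pr (fst y) \<subseteq> {0}"
      using step[of "snd x"] by fastforce
  qed
  then obtain h :: "nat \<Rightarrow> 'a \<times> 'a set" where h: "\<And>n. unb (snd (h n))"
    "\<And>n. fst (h (Suc n)) \<in> snd (h n)" "\<And>n. fst (h (Suc n)) \<noteq> 0" "\<And>n. snd (h (Suc n)) \<subseteq> snd (h n)"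
    "\<And>n. snd (h (Suc n)) \<inter> pr (fst (h (Suc n))) \<subseteq> {0}" by blast
  define a where "a n = fst (h (Suc n))" for n
  define L where "L n = snd (h n)" for n
  have L: "submod A (L n)" "L n \<subseteq> A" "a n \<in> L n" "a n \<noteq> 0" "L (Suc n) \<inter> pr (a n) \<subseteq> {0}" for n
    using h unfolding a_def L_def unb_def by auto
  have Lm: "L m \<subseteq> L k" if "k \<le> m" for m k
    using lift_Suc_antimono_le[of L] h(4) that unfolding L_def by blast
  have prL: "pr (a n) \<subseteq> L n" for n using L(3) submodD(3)[OF L(1)] unfolding pr_def by auto
  have "indep_fam (\<lambda>n. pr (a n)) n" for n
    unfolding indep_fam_def
  proof (intro allI impI)
    fix l i assume "(\<forall>i<n. l i \<in> pr (a i)) \<and> sum l {..<n} = 0" and "i < n"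
    then have l: "\<And>i. i < n \<Longrightarrow> l i \<in> pr (a i)" "sum l {..<n} = 0" and i: "i < n" by auto
    from i show "l i = 0"
    proof (induction i rule: less_induct)
      case (less i)
      have "sum l {..<n} = sum l {i..<n}"
        by (rule sum.mono_neutral_right) (use less in auto)
      also have "\<dots> = l i + sum l {Suc i..<n}" using less.prems by (rule sum.atLeast_Suc_lessThan)
      finally have e: "l i = 0 - sum l {Suc i..<n}" using l(2) by (simp add: eq_neg_iff_add_eq_0)
      have "sum l {Suc i..<n} \<in> L (Suc i)"
      proof (rule submod_sum[OF L(1)])
        fix j assume "j \<in> {Suc i..<n}"
        then show "l j \<in> L (Suc i)" using l(1)[of j] prL[of j] Lm[of "Suc i" j] by auto
      qed
      then have "l i \<in> L (Suc i)" unfolding e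
        using submod_diff[OF A L(1) submodD(1)[OF L(1)]] by blast
      then show ?case using l(1)[OF less.prems] L(5) by blast
    qed
  qed
  moreover have "left_ideal A (pr (a n)) \<and> pr (a n) \<noteq> {0}" for n
  proof -
    have "1 * a n \<in> pr (a n)" unfolding pr_def using subringD(2)[OF A] by blast
    then have "pr (a n) \<noteq> {0}" using L(4) by auto
    then show ?thesis using pr[of "a n"] prL[of n] L(2)[of n] unfolding left_ideal_def submod_def by auto
  qed
  ultimately have "\<exists>L. (\<forall>i. left_ideal A (L i) \<and> L i \<noteq> {0}) \<and> (\<forall>n. indep_fam L n)"
    by (intro exI[of _ "\<lambda>n. pr (a n)"]) blast
  then show False using fin unfolding finite_udim_def by contradiction
qed

section \<open>Linearly closed subrings\<close>

text \<open>Each \<open>f\<close> in \<open>C\<close> is a column, so \<open>C\<close> is a matrix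
  without a fixed number of columns, and the unknowns stand on its left. One inequation is enough to
  keep a chosen term of a relation non-zero.\<close>

definition lin_closed :: "'a::ring_1 set \<Rightarrow> 'a set \<Rightarrow> bool" where
  "lin_closed A B \<longleftrightarrow> A \<subseteq> B \<and>
     (\<forall>(X::nat set) C v b. finite X \<and> finite C \<and> (\<forall>f\<in>insert v C. \<forall>i\<in>X. f i \<in> A) \<and> (\<forall>i\<in>X. b i \<in> B) \<and>
        (\<forall>f\<in>C. (\<Sum>i\<in>X. b i * f i) = 0) \<and> (\<Sum>i\<in>X. b i * v i) \<noteq> 0 \<longrightarrow>
        (\<exists>a. (\<forall>i\<in>X. a i \<in> A) \<and> (\<forall>f\<in>C. (\<Sum>i\<in>X. a i * f i) = 0) \<and> (\<Sum>i\<in>X. a i * v i) \<noteq> 0))"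

lemma lin_closed_subset: "lin_closed A B \<Longrightarrow> A \<subseteq> B"
  unfolding lin_closed_def by blast

lemma lin_closedI:
  assumes "A \<subseteq> B"
    and "\<And>(X::nat set) C v b. finite X \<Longrightarrow> finite C \<Longrightarrow> \<forall>f\<in>C. \<forall>i\<in>X. f i \<in> A \<Longrightarrow>
      \<forall>i\<in>X. v i \<in> A \<Longrightarrow> \<forall>i\<in>X. b i \<in> B \<Longrightarrow> \<forall>f\<in>C. (\<Sum>i\<in>X. b i * f i) = 0 \<Longrightarrow> (\<Sum>i\<in>X. b i * v i) \<noteq> 0 \<Longrightarrow>
      \<exists>a. (\<forall>i\<in>X. a i \<in> A) \<and> (\<forall>f\<in>C. (\<Sum>i\<in>X. a i * f i) = 0) \<and> (\<Sum>i\<in>X. a i * v i) \<noteq> 0"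
  shows "lin_closed A B"
  unfolding lin_closed_def
proof (intro conjI allI impI)
  show "A \<subseteq> B" by fact
  fix X :: "nat set" and C v b
  assume h: "finite X \<and> finite C \<and> (\<forall>f\<in>insert v C. \<forall>i\<in>X. f i \<in> A) \<and> (\<forall>i\<in>X. b i \<in> B) \<and>
        (\<forall>f\<in>C. (\<Sum>i\<in>X. b i * f i) = 0) \<and> (\<Sum>i\<in>X. b i * v i) \<noteq> 0"
  show "\<exists>a. (\<forall>i\<in>X. a i \<in> A) \<and> (\<forall>f\<in>C. (\<Sum>i\<in>X. a i * f i) = 0) \<and> (\<Sum>i\<in>X. a i * v i) \<noteq> 0"
    by (rule assms(2)[of X C v b]) (use h in blast)+
qed

text \<open>Frees the index set from being a set of naturals, since systems indexed by pairs occur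
  later.\<close>

lemma lin_closedE:
  fixes X :: "'b set"
  assumes lc: "lin_closed A B" and X: "finite X" and C: "finite C"
    and fA: "\<forall>f\<in>C. \<forall>i\<in>X. f i \<in> A" and vA: "\<forall>i\<in>X. v i \<in> A"
    and bB: "\<forall>i\<in>X. b i \<in> B"
    and b0: "\<forall>f\<in>C. (\<Sum>i\<in>X. b i * f i) = 0" and b1: "(\<Sum>i\<in>X. b i * v i) \<noteq> 0"
  obtains a where "\<forall>i\<in>X. a i \<in> A" "\<forall>f\<in>C. (\<Sum>i\<in>X. a i * f i) = 0"
    "(\<Sum>i\<in>X. a i * v i) \<noteq> 0"
proof -
  obtain h where h: "bij_betw h {0..<card X} X" using ex_bij_betw_nat_finite[OF X] by blast
  let ?Y = "{0..<card X}"
  define C' where "C' = (\<lambda>f. f \<circ> h) ` C"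
  have hX: "h j \<in> X" if "j \<in> ?Y" for j using that h by (auto simp: bij_betw_def)
  have re: "(\<Sum>j\<in>?Y. (p \<circ> h) j * (q \<circ> h) j) = (\<Sum>i\<in>X. p i * q i)" for p q :: "'b \<Rightarrow> 'a"
    using sum.reindex_bij_betw[OF h, of "\<lambda>i. p i * q i"] by simp
  have "\<exists>a. (\<forall>i\<in>?Y. a i \<in> A) \<and> (\<forall>f\<in>C'. (\<Sum>i\<in>?Y. a i * f i) = 0) \<and> (\<Sum>i\<in>?Y. a i * (v \<circ> h) i) \<noteq> 0"
  proof -
    have "\<forall>f\<in>insert (v \<circ> h) C'. \<forall>i\<in>?Y. f i \<in> A" using fA vA hX unfolding C'_def by auto
    moreover have "\<forall>i\<in>?Y. (b \<circ> h) i \<in> B" using bB hX by auto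
    moreover have "\<forall>f\<in>C'. (\<Sum>i\<in>?Y. (b \<circ> h) i * f i) = 0" unfolding C'_def using b0 re by fastforce
    moreover have "(\<Sum>i\<in>?Y. (b \<circ> h) i * (v \<circ> h) i) \<noteq> 0" using b1 re[of b v] by metis
    moreover have "finite C'" unfolding C'_def using C by blast
    ultimately show ?thesis using lc unfolding lin_closed_def by blast
  qed
  then obtain a where a: "\<And>i. i \<in> ?Y \<Longrightarrow> a i \<in> A" "\<And>f. f \<in> C' \<Longrightarrow> (\<Sum>i\<in>?Y. a i * f i) = 0"
    "(\<Sum>i\<in>?Y. a i * (v \<circ> h) i) \<noteq> 0" by blast
  define g where "g = inv_into ?Y h"
  have gh: "g (h j) = j" if "j \<in> ?Y" for j
    unfolding g_def using h that by (rule bij_betw_inv_into_left)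
  have gX: "g i \<in> ?Y" if "i \<in> X" for i
    unfolding g_def using h that by (metis bij_betw_def inv_into_into)
  have re2: "(\<Sum>i\<in>X. (a \<circ> g) i * q i) = (\<Sum>j\<in>?Y. a j * (q \<circ> h) j)" for q
    unfolding re[symmetric] by (rule sum.cong) (auto simp: gh)
  show ?thesis
  proof
    show "\<forall>i\<in>X. (a \<circ> g) i \<in> A" using a(1) gX by simp
    show "\<forall>f\<in>C. (\<Sum>i\<in>X. (a \<circ> g) i * f i) = 0"
      unfolding re2 using a(2) unfolding C'_def by blast
    show "(\<Sum>i\<in>X. (a \<circ> g) i * v i) \<noteq> 0" unfolding re2 by (rule a(3))
  qed
qed

lemma lin_closed_refl: "lin_closed A A"
  unfolding lin_closed_def by blast

lemma lin_closed_trans: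
  assumes "lin_closed A B" "lin_closed B C"
  shows "lin_closed A C"
proof (rule lin_closedI)
  show "A \<subseteq> C" using assms lin_closed_subset by blast
  fix X :: "nat set" and F v b
  assume h: "finite X" "finite F" "\<forall>f\<in>F. \<forall>i\<in>X. f i \<in> A" "\<forall>i\<in>X. v i \<in> A"
    "\<forall>i\<in>X. b i \<in> C" "\<forall>f\<in>F. (\<Sum>i\<in>X. b i * f i) = 0" "(\<Sum>i\<in>X. b i * v i) \<noteq> 0"
  have hB: "\<forall>f\<in>F. \<forall>i\<in>X. f i \<in> B" "\<forall>i\<in>X. v i \<in> B"
    using h(3,4) lin_closed_subset[OF assms(1)] by blast+
  obtain b' where b': "\<forall>i\<in>X. b' i \<in> B" "\<forall>f\<in>F. (\<Sum>i\<in>X. b' i * f i) = 0" "(\<Sum>i\<in>X. b' i * v i) \<noteq> 0"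
    using lin_closedE[OF assms(2) h(1,2) hB h(5,6,7)] .
  obtain a where "\<forall>i\<in>X. a i \<in> A" "\<forall>f\<in>F. (\<Sum>i\<in>X. a i * f i) = 0" "(\<Sum>i\<in>X. a i * v i) \<noteq> 0"
    using lin_closedE[OF assms(1) h(1,2,3,4) b'] .
  then show "\<exists>a. (\<forall>i\<in>X. a i \<in> A) \<and> (\<forall>f\<in>F. (\<Sum>i\<in>X. a i * f i) = 0) \<and> (\<Sum>i\<in>X. a i * v i) \<noteq> 0"
    by blast
qed

text \<open>One left multiplier from \<open>A\<close> moves all unknowns into \<open>A\<close>
  without killing the value at \<open>v\<close>, and equations survive left multiplication.\<close>

lemma lin_closed_nicely_ess:
  assumes "nicely_ess st A B" "is_subring B"
  shows "lin_closed A B"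
proof (rule lin_closedI)
  have A: "is_subring A" and AB: "A \<subseteq> B"
    and ne: "\<And>E. finite E \<Longrightarrow> E \<subseteq> B - {0} \<Longrightarrow> \<exists>a\<in>A. \<forall>e\<in>E. a * e \<in> A \<and> a * e \<noteq> 0"
    using assms unfolding nicely_ess_def by auto
  show "A \<subseteq> B" by fact
  fix X :: "nat set" and F v b
  assume h: "finite X" "finite F" "\<forall>f\<in>F. \<forall>i\<in>X. f i \<in> A" "\<forall>i\<in>X. v i \<in> A"
    "\<forall>i\<in>X. b i \<in> B" "\<forall>f\<in>F. (\<Sum>i\<in>X. b i * f i) = 0" "(\<Sum>i\<in>X. b i * v i) \<noteq> 0"
  define w where "w = (\<Sum>i\<in>X. b i * v i)"
  \<comment> \<open>The multiplier is only guaranteed for non-zero elements; unknowns that vanish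
    are carried into \<open>A\<close> trivially.\<close>
  define E where "E = insert w (b ` X) - {0}"
  have "w \<in> B" unfolding w_def
    by (rule subring_sum[OF assms(2)]) (use h(4,5) AB subringD(5)[OF assms(2)] in blast)
  then have "finite E" "E \<subseteq> B - {0}" unfolding E_def using h(1,5) by auto
  then have "\<exists>a\<in>A. \<forall>e\<in>E. a * e \<in> A \<and> a * e \<noteq> 0" by (rule ne)
  then obtain c where c: "c \<in> A" "\<And>e. e \<in> E \<Longrightarrow> c * e \<in> A \<and> c * e \<noteq> 0" by blast
  have "c * b i \<in> A" if "i \<in> X" for i
    using c(2)[of "b i"] that subringD(1)[OF A] unfolding E_def by (cases "b i = 0") auto
  moreover have dl: "(\<Sum>i\<in>X. c * b i * g i) = c * (\<Sum>i\<in>X. b i * g i)" for g :: "nat \<Rightarrow> 'a"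
    by (simp add: sum_distrib_left mult.assoc)
  moreover have "c * w \<noteq> 0" using c(2)[of w] h(7) unfolding E_def w_def by auto
  ultimately show "\<exists>a. (\<forall>i\<in>X. a i \<in> A) \<and> (\<forall>f\<in>F. (\<Sum>i\<in>X. a i * f i) = 0) \<and> (\<Sum>i\<in>X. a i * v i) \<noteq> 0"
    using h(6) by (intro exI[of _ "\<lambda>i. c * b i"]) (simp add: w_def)
qed

text \<open>A dependence over \<open>B\<close> with non-zero term at \<open>k\<close> solves one
  equation, with column \<open>f\<close>, and one inequation, with the column that is
  \<open>f k\<close> at \<open>k\<close> and zero elsewhere.\<close>

lemma indep_lin_closed:
  assumes lc: "lin_closed A B" and A: "is_subring A" and ind: "indep A {0} X f"
    and X: "finite X" and f: "\<And>i. i \<in> X \<Longrightarrow> f i \<in> A"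
  shows "indep B {0} X f"
proof (rule indepI, rule ccontr)
  fix c k assume c: "\<And>i. i \<in> X \<Longrightarrow> c i \<in> B" and s: "(\<Sum>i\<in>X. c i * f i) \<in> {0}" and k: "k \<in> X"
    and n: "c k * f k \<notin> {0}"
  define v where "v i = (if i = k then f k else 0)" for i
  have sv: "(\<Sum>i\<in>X. z i * v i) = z k * f k" for z
  proof -
    have "(\<Sum>i\<in>X. z i * v i) = (\<Sum>i\<in>X. if i = k then z k * f k else 0)"
      by (rule sum.cong) (auto simp: v_def)
    then show ?thesis using X k by simp
  qed
  obtain a where a: "\<forall>i\<in>X. a i \<in> A" "\<forall>g\<in>{f}. (\<Sum>i\<in>X. a i * g i) = 0"
    "(\<Sum>i\<in>X. a i * v i) \<noteq> 0"
    by (rule lin_closedE[of A B X "{f}" v c, OF lc X]) (use c s n f k sv subringD(1)[OF A] in \<open>auto simp: v_def\<close>)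
  then have "a k * f k \<in> {0}" using indepD[OF ind, of a k] k by simp
  then show False using a(3) sv by simp
qed

lemma udim_le_lin_closed:
  assumes lc: "lin_closed A B" and A: "is_subring A" and bd: "udim_le B {0} B n"
  shows "udim_le A {0} A n"
  unfolding udim_le_def
proof (intro allI impI)
  fix X :: "nat set" and f assume fam: "indep_family A {0} A X f"
  then have "indep_family B {0} B X f"
    using indep_lin_closed[OF lc A, of X f] lin_closed_subset[OF lc] unfolding indep_family_def by blast
  then show "card X \<le> n" by (rule udim_leD[OF bd])
qed

text \<open>A singular \<open>f\<close> of \<open>A\<close> is killed by \<open>n\<close> elements
  that are independent even over \<open>S\<close>. For non-zero \<open>f\<close>, nonsingularity of
  \<open>S\<close> adds an \<open>r\<close> none of whose non-zero multiples kills \<open>f\<close>,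
  so that \<open>n + 1\<close> elements of \<open>S\<close> would be independent.\<close>

lemma nonsing_lin_closed:
  assumes lc: "lin_closed A S" and A: "is_subring A" and S: "is_subring S" and ge: "udim_ge A n"
    and bd: "udim_le S {0} S n" and ns: "nonsing S"
  shows "nonsing A"
  unfolding nonsing_def
proof (intro ballI impI)
  fix f assume f: "f \<in> A" and sing: "\<forall>r\<in>A. r \<noteq> 0 \<longrightarrow> (\<exists>s\<in>A. s * r \<noteq> 0 \<and> s * r * f = 0)"
  have AS: "A \<subseteq> S" using lin_closed_subset[OF lc] .
  obtain g :: "nat \<Rightarrow> 'a" where g: "indep_family A {0} A {..<n} g" using ge unfolding udim_ge_def by blast
  then have "\<forall>i\<in>{..<n}. \<exists>s\<in>A. s * g i \<noteq> 0 \<and> s * g i * f = 0"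
    using sing unfolding indep_family_def by blast
  then obtain s where s: "\<And>i. i < n \<Longrightarrow> s i \<in> A \<and> s i * g i \<noteq> 0 \<and> s i * g i * f = 0" by (metis lessThan_iff)
  have gA: "g i \<in> A" if "i < n" for i using g that unfolding indep_family_def by auto
  have "indep A {0} {..<n} (\<lambda>i. s i * g i)"
    by (rule indep_left_mult[of A]) (use g s subringD(5)[OF A] in \<open>auto simp: indep_family_def\<close>)
  then have ind: "indep S {0} {..<n} (\<lambda>i. s i * g i)"
    by (rule indep_lin_closed[OF lc A]) (use s gA subringD(5)[OF A] in auto)
  define h where "h r i = (if i = n then r else s i * g i)" for r i
  show "f = 0"
  proof (rule ccontr)
    assume "f \<noteq> 0"
    then obtain r where r: "r \<in> S" "r \<noteq> 0" "\<And>t. t \<in> S \<Longrightarrow> t * r * f = 0 \<Longrightarrow> t * r = 0"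
      using ns f AS unfolding nonsing_def by blast
    have "indep S {0} {..<Suc n} (h r)"
    proof (rule indepI)
      fix c i assume c: "\<And>i. i \<in> {..<Suc n} \<Longrightarrow> c i \<in> S" and z: "(\<Sum>i<Suc n. c i * h r i) \<in> {0}"
        and i: "i \<in> {..<Suc n}"
      have e: "(\<Sum>i<n. c i * (s i * g i)) + c n * r = 0"
        using z by (simp add: h_def)
      have "(\<Sum>i<n. c i * (s i * g i)) * f = 0"
        using s by (simp add: sum_distrib_right mult.assoc)
      then have "c n * r * f = 0" using arg_cong[OF e, of "\<lambda>u. u * f"] by (simp add: distrib_right)
      then have cn: "c n * r = 0" using r(3) c by simp
      then have "(\<Sum>i<n. c i * (s i * g i)) \<in> {0}" using e by simp
      then have "i < n \<Longrightarrow> c i * (s i * g i) \<in> {0}"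
        using c by (intro indepD[OF ind, of c i]) auto
      then show "c i * h r i \<in> {0}" using cn i by (cases "i = n") (auto simp: h_def)
    qed
    moreover have "h r i \<in> S \<and> h r i \<noteq> 0" if "i < Suc n" for i
      using that r s gA subringD(5)[OF A] AS unfolding h_def by (auto simp: less_Suc_eq)
    ultimately have "indep_family S {0} S {..<Suc n} (h r)" unfolding indep_family_def by auto
    from udim_leD[OF bd this] show False by simp
  qed
qed

text \<open>Independence is lifted to the large ring \<open>B\<close>, where it holds for all
  coefficients, and then restricted to coefficients from \<open>C\<close>.\<close>

lemma udim_ge_trans:
  assumes g: "udim_ge A n" and A: "is_subring A" and lc: "lin_closed A B" and AC: "A \<subseteq> C" "C \<subseteq> B"
    and B: "is_subring B"
  shows "udim_ge C n"
proof -
  obtain f :: "nat \<Rightarrow> 'a" where f: "indep_family A {0} A {..<n} f" using g unfolding udim_ge_def by blast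
  have "indep B {0} {..<n} f"
    using f indep_lin_closed[OF lc A, of "{..<n}" f] unfolding indep_family_def by blast
  then have "indep C {0} {..<n} f"
    by (rule indep_mono) (use AC subringD(1)[OF B] in auto)
  then show ?thesis using f AC unfolding udim_ge_def indep_family_def by blast
qed

lemma udim_ge_nicely_ess:
  assumes g: "udim_ge B n" and B: "is_subring B" and ne: "nicely_ess st A B"
  shows "udim_ge A n"
proof -
  have A: "is_subring A" and AB: "A \<subseteq> B"
    using ne unfolding nicely_ess_def by auto
  obtain f :: "nat \<Rightarrow> 'a" where f: "indep_family B {0} B {..<n} f" using g unfolding udim_ge_def by blast
  then have "finite (f ` {..<n})" "f ` {..<n} \<subseteq> B - {0}" unfolding indep_family_def by auto
  then obtain a where a: "a \<in> A" "\<And>i. i < n \<Longrightarrow> a * f i \<in> A \<and> a * f i \<noteq> 0"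
    using ne unfolding nicely_ess_def by (metis image_eqI lessThan_iff)
  have "indep A {0} {..<n} (\<lambda>i. a * f i)"
    by (rule indep_left_mult[of B]) (use f a(1) AB subringD(5)[OF A] in \<open>auto simp: indep_family_def\<close>)
  then have "indep_family A {0} A {..<n} (\<lambda>i. a * f i)" using a unfolding indep_family_def by auto
  then show ?thesis unfolding udim_ge_def by blast
qed

section \<open>Comparison with uniform dimension in terms of left ideals\<close>

lemma udim_ge_iff:
  assumes A: "is_subring A"
  shows "udim_ge A n \<longleftrightarrow> (\<exists>L. (\<forall>i<n. left_ideal A (L i) \<and> L i \<noteq> {0}) \<and> indep_fam L n)"
proof
  assume "udim_ge A n"
  then obtain f :: "nat \<Rightarrow> 'a" where f: "indep_family A {0} A {..<n} f" unfolding udim_ge_def by blast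
  define L where "L i = (\<lambda>s. s * f i) ` A" for i
  have "left_ideal A (L i) \<and> L i \<noteq> {0}" if "i < n" for i
  proof -
    have fi: "f i \<in> A" "f i \<noteq> 0" using f that unfolding indep_family_def by auto
    have "1 * f i \<in> L i" unfolding L_def using subringD(2)[OF A] by blast
    moreover have "L i \<subseteq> A" unfolding L_def using fi subringD(5)[OF A] by blast
    ultimately show ?thesis
      using submod_principal[OF A, of "f i"] fi unfolding left_ideal_def L_def submod_def by auto
  qed
  moreover have "indep_fam L n"
    unfolding indep_fam_def
  proof (intro allI impI)
    fix l i assume l: "(\<forall>i<n. l i \<in> L i) \<and> sum l {..<n} = 0" and i: "i < n"
    from l have "\<forall>i\<in>{..<n}. \<exists>c. c \<in> A \<and> l i = c * f i" unfolding L_def by auto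
    then obtain c where "\<forall>i\<in>{..<n}. c i \<in> A \<and> l i = c i * f i" by (rule bchoice[THEN exE])
    then have c: "\<And>i. i < n \<Longrightarrow> c i \<in> A \<and> l i = c i * f i" by simp
    have "sum l {..<n} = (\<Sum>i<n. c i * f i)" by (rule sum.cong) (use c in auto)
    then have "(\<Sum>i<n. c i * f i) \<in> {0}" using l by simp
    moreover have "indep A {0} {..<n} f" using f unfolding indep_family_def by blast
    ultimately have "c i * f i \<in> {0}" using c i by (intro indepD[of A "{0}" "{..<n}" f c i]) auto
    then show "l i = 0" using c i by simp
  qed
  ultimately show "\<exists>L. (\<forall>i<n. left_ideal A (L i) \<and> L i \<noteq> {0}) \<and> indep_fam L n" by blast
next
  assume "\<exists>L. (\<forall>i<n. left_ideal A (L i) \<and> L i \<noteq> {0}) \<and> indep_fam L n"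
  then obtain L where L: "\<And>i. i < n \<Longrightarrow> left_ideal A (L i)" "\<And>i. i < n \<Longrightarrow> L i \<noteq> {0}" "indep_fam L n" by blast
  have "\<forall>i\<in>{..<n}. \<exists>f. f \<in> L i \<and> f \<noteq> 0" using L(1,2) unfolding left_ideal_def by blast
  then obtain f where "\<forall>i\<in>{..<n}. f i \<in> L i \<and> f i \<noteq> 0" by (rule bchoice[THEN exE])
  then have f: "\<And>i. i < n \<Longrightarrow> f i \<in> L i \<and> f i \<noteq> 0" by simp
  have "indep A {0} {..<n} f"
  proof (rule indepI)
    fix c i assume c: "\<And>i. i \<in> {..<n} \<Longrightarrow> c i \<in> A" and z: "(\<Sum>i<n. c i * f i) \<in> {0}" and i: "i \<in> {..<n}"
    have "\<forall>i<n. c i * f i \<in> L i" using c f L(1) unfolding left_ideal_def by blast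
    moreover have "(\<Sum>i<n. c i * f i) = 0" using z by blast
    ultimately have "\<forall>i<n. c i * f i = 0" using L(3) unfolding indep_fam_def by (elim allE[of _ "\<lambda>i. c i * f i"]) blast
    then show "c i * f i \<in> {0}" using i by blast
  qed
  then have "indep_family A {0} A {..<n} f"
    using f L(1) unfolding indep_family_def left_ideal_def by blast
  then show "udim_ge A n" unfolding udim_ge_def by blast
qed

lemma udim_eq:
  assumes A: "is_subring A" and ge: "udim_ge A n" and le: "udim_le A {0} A n"
  shows "udim A = enat n"
proof -
  have "m \<le> n" if "udim_ge A m" for m
    using that udim_leD[OF le] unfolding udim_ge_def by (metis card_lessThan)
  then show ?thesis
    unfolding udim_def udim_ge_iff[OF A, symmetric] using ge
    by (intro antisym Sup_least Sup_upper) auto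
qed

lemma finite_udim_if_udim_le:
  assumes A: "is_subring A" and le: "udim_le A {0} A n"
  shows "finite_udim A"
  unfolding finite_udim_def
proof
  assume "\<exists>L. (\<forall>i. left_ideal A (L i) \<and> L i \<noteq> {0}) \<and> (\<forall>n. indep_fam L n)"
  then have "udim_ge A (Suc n)" unfolding udim_ge_iff[OF A] by blast
  then show False using udim_leD[OF le] unfolding udim_ge_def by (metis card_lessThan not_less_eq_eq order_refl)
qed

lemma udim_attained:
  assumes A: "is_subring A" and fin: "finite_udim A"
  obtains n where "udim_ge A n" "udim_le A {0} A n"
proof -
  obtain m where m: "udim_le A {0} A m" using udim_le_if_finite_udim[OF A fin] .
  have b: "k \<le> m" if "udim_ge A k" for k
    using that udim_leD[OF m] unfolding udim_ge_def by (metis card_lessThan)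
  have "udim_ge A 0" unfolding udim_ge_def indep_family_def indep_def by simp
  then obtain n where n: "udim_ge A n" "\<And>k. udim_ge A k \<Longrightarrow> k \<le> n"
    using GreatestI_nat[of "udim_ge A" 0 m] Greatest_le_nat[of "udim_ge A" _ m] b by blast
  have "udim_le A {0} A n" unfolding udim_le_def using udim_geI n(2) by blast
  then show ?thesis using that n by blast
qed

section \<open>Ore extensions\<close>

lemma ring_autD:
  assumes B: "is_subring B" and am: "ring_aut B am"
  shows "p \<in> B \<Longrightarrow> am p \<in> B" "p \<in> B \<Longrightarrow> \<exists>q\<in>B. am q = p" "am 0 = 0" "p \<in> B \<Longrightarrow> am p = 0 \<Longrightarrow> p = 0"
    "p \<in> B \<Longrightarrow> q \<in> B \<Longrightarrow> am (p * q) = am p * am q"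
proof -
  have im: "am ` B = B" and inj: "inj_on am B" using am unfolding ring_aut_def bij_betw_def by blast+
  show "p \<in> B \<Longrightarrow> am p \<in> B" using im by blast
  show "\<exists>q\<in>B. am q = p" if "p \<in> B" using im that by (metis imageE)
  have "am (0 + 0) = am 0 + am 0" using am subringD(1)[OF B] unfolding ring_aut_def by blast
  then show z: "am 0 = 0" by simp
  show "p \<in> B \<Longrightarrow> am p = 0 \<Longrightarrow> p = 0" using inj_onD[OF inj, of p 0] z subringD(1)[OF B] by simp
  show "p \<in> B \<Longrightarrow> q \<in> B \<Longrightarrow> am (p * q) = am p * am q" using am unfolding ring_aut_def by blast
qed

lemma ring_aut_pow:
  assumes B: "is_subring B" and am: "ring_aut B am"
  shows "ring_aut B (am ^^ i)"
proof (induction i)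
  case 0
  then show ?case unfolding ring_aut_def by simp
next
  case (Suc i)
  note D = ring_autD(1)[OF B Suc]
  have "bij_betw (am ^^ Suc i) B B"
    using Suc am unfolding ring_aut_def by (auto intro: bij_betw_trans)
  then show ?case using Suc am D unfolding ring_aut_def by simp
qed

locale ore =
  fixes S T :: "'a::ring_1 set" and y :: 'a and a d :: "'a \<Rightarrow> 'a"
  assumes ore: "ore_ext S T y a d"
begin

lemma S: "is_subring S" and T: "is_subring T" and ST: "S \<subseteq> T" and yT: "y \<in> T"
  and aut: "ring_aut S a" and dS: "p \<in> S \<Longrightarrow> d p \<in> S" and comm: "p \<in> S \<Longrightarrow> y * p = a p * y + d p"
  using ore unfolding ore_ext_def by auto

lemmas aS = ring_autD(1)[OF S aut]
lemmas apow_S = ring_autD(1)[OF S ring_aut_pow[OF S aut]]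
  and apow_surj = ring_autD(2)[OF S ring_aut_pow[OF S aut]]
  and apow_zero = ring_autD(3)[OF S ring_aut_pow[OF S aut]]
  and apow_eq_zero = ring_autD(4)[OF S ring_aut_pow[OF S aut]]
  and apow_mult = ring_autD(5)[OF S ring_aut_pow[OF S aut]]

text \<open>Polynomials of degree less than \<open>m\<close>: the strict bound puts the zero
  polynomial into \<open>low 0\<close>, so that no degree of zero is needed.\<close>

definition low :: "nat \<Rightarrow> 'a set" where
  "low m = {(\<Sum>i<m. c i * y ^ i) | c. \<forall>i. c i \<in> S}"

text \<open>\<open>ld f m c\<close>: \<open>f\<close> has degree at most \<open>m\<close>, with coefficient \<open>c\<close> (possibly zero) at \<open>y ^ m\<close>.\<close>
definition ld :: "'a \<Rightarrow> nat \<Rightarrow> 'a \<Rightarrow> bool" where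
  "ld f m c \<longleftrightarrow> c \<in> S \<and> f - c * y ^ m \<in> low m"

lemma lowI: "(\<And>i. i < m \<Longrightarrow> c i \<in> S) \<Longrightarrow> (\<Sum>i<m. c i * y ^ i) \<in> low m"
  unfolding low_def
  by (rule CollectI, rule exI[of _ "\<lambda>i. if i < m then c i else 0"])
     (auto simp: subringD(1)[OF S] intro!: sum.cong)

lemma low_submod: "submod S (low m)"
  unfolding submod_def
proof (intro conjI ballI)
  show "0 \<in> low m" using lowI[of m "\<lambda>_. 0"] subringD(1)[OF S] by simp
next
  fix f g assume "f \<in> low m" "g \<in> low m"
  then obtain c e where "\<forall>i. c i \<in> S" "\<forall>i. e i \<in> S" "f = (\<Sum>i<m. c i * y ^ i)" "g = (\<Sum>i<m. e i * y ^ i)"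
    unfolding low_def by blast
  then show "f + g \<in> low m" using lowI[of m "\<lambda>i. c i + e i"] subringD(3)[OF S]
    by (simp add: distrib_right sum.distrib)
next
  fix r f assume r: "r \<in> S" and "f \<in> low m"
  then obtain c where "\<forall>i. c i \<in> S" "f = (\<Sum>i<m. c i * y ^ i)"
    unfolding low_def by blast
  then show "r * f \<in> low m" using lowI[of m "\<lambda>i. r * c i"] subringD(5)[OF S r]
    by (simp add: sum_distrib_left mult.assoc)
qed

lemmas low_simps = submodD[OF low_submod]
lemmas low_sum = submod_sum[OF low_submod]
lemmas low_diff = submod_diff[OF S low_submod]

lemma low_0: "low 0 = {0}"
  unfolding low_def using subringD(1)[OF S] by auto

lemma low_mono: "m \<le> n \<Longrightarrow> f \<in> low m \<Longrightarrow> f \<in> low n"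
proof -
  assume mn: "m \<le> n" and "f \<in> low m"
  then obtain c where c: "\<forall>i. c i \<in> S" "f = (\<Sum>i<m. c i * y ^ i)"
    unfolding low_def by blast
  have "f = (\<Sum>i<n. (if i < m then c i else 0) * y ^ i)"
    unfolding c(2) by (rule sum.mono_neutral_cong_left) (use mn in auto)
  then show "f \<in> low n" using lowI[of n "\<lambda>i. if i < m then c i else 0"] c(1) subringD(1)[OF S] by simp
qed

lemma term_low: "c \<in> S \<Longrightarrow> i < m \<Longrightarrow> c * y ^ i \<in> low m"
proof -
  assume c: "c \<in> S" and i: "i < m"
  have "(\<Sum>j<m. (if j = i then c else 0) * y ^ j) = (\<Sum>j<m. if j = i then c * y ^ i else 0)"
    by (rule sum.cong) auto
  also have "\<dots> = c * y ^ i" using i by simp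
  finally show ?thesis using lowI[of m "\<lambda>j. if j = i then c else 0"] c subringD(1)[OF S] by simp
qed

lemma ldI: "c \<in> S \<Longrightarrow> l \<in> low m \<Longrightarrow> ld (c * y ^ m + l) m c"
  unfolding ld_def by simp

lemma ldE:
  assumes "ld f m c"
  obtains l where "c \<in> S" "l \<in> low m" "f = c * y ^ m + l"
  using assms unfolding ld_def by (metis add.commute diff_add_cancel)

lemma low_Suc_iff: "f \<in> low (Suc m) \<longleftrightarrow> (\<exists>c. ld f m c)"
proof
  assume "f \<in> low (Suc m)"
  then obtain c where c: "\<forall>i. c i \<in> S" "f = (\<Sum>i<Suc m. c i * y ^ i)"
    unfolding low_def by blast
  have "f = c m * y ^ m + (\<Sum>i<m. c i * y ^ i)" using c(2) by simp
  then show "\<exists>c. ld f m c" using ldI[of "c m" "\<Sum>i<m. c i * y ^ i" m] lowI[of m c] c(1) by auto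
next
  assume "\<exists>c. ld f m c"
  then obtain c l where "c \<in> S" "l \<in> low m" "f = c * y ^ m + l" by (blast elim: ldE)
  then show "f \<in> low (Suc m)" using low_simps(2) term_low[of c m "Suc m"] low_mono[of m "Suc m" l] by simp
qed

lemma T_low: "t \<in> T \<Longrightarrow> \<exists>m. t \<in> low m"
proof -
  assume "t \<in> T"
  moreover have "\<forall>t\<in>T. \<exists>n c. (\<forall>i\<le>n. c i \<in> S) \<and> t = (\<Sum>i\<le>n. c i * y ^ i)"
    using ore unfolding ore_ext_def by (elim conjE)
  ultimately obtain n c where "\<forall>i\<le>n. c i \<in> S" "t = (\<Sum>i\<le>n. c i * y ^ i)" by blast
  then have "t \<in> low (Suc n)" using lowI[of "Suc n" c] by (simp add: lessThan_Suc_atMost)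
  then show ?thesis ..
qed

lemma low_T: "f \<in> low m \<Longrightarrow> f \<in> T"
proof -
  assume "f \<in> low m"
  then obtain c where c: "\<forall>i. c i \<in> S" "f = (\<Sum>i<m. c i * y ^ i)"
    unfolding low_def by blast
  have "c i * y ^ i \<in> T" for i using c(1) ST subringD(5)[OF T _ subring_pow[OF T yT]] by blast
  then show ?thesis unfolding c(2) by (intro subring_sum[OF T])
qed

lemma free: "(\<And>i. i < m \<Longrightarrow> c i \<in> S) \<Longrightarrow> (\<Sum>i<m. c i * y ^ i) = 0 \<Longrightarrow> i < m \<Longrightarrow> c i = 0"
proof -
  assume c: "\<And>i. i < m \<Longrightarrow> c i \<in> S" and s: "(\<Sum>i<m. c i * y ^ i) = 0" and i: "i < m"
  then obtain n where n: "m = Suc n" by (cases m) auto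
  have fr: "\<forall>n c. (\<forall>i\<le>n. c i \<in> S) \<and> (\<Sum>i\<le>n. c i * y ^ i) = 0 \<longrightarrow> (\<forall>i\<le>n. c i = 0)"
    using ore unfolding ore_ext_def by blast
  have "(\<forall>i\<le>n. c i \<in> S) \<and> (\<Sum>i\<le>n. c i * y ^ i) = 0" using c s n by (auto simp: lessThan_Suc_atMost)
  then have "\<forall>i\<le>n. c i = 0" using fr by blast
  then show ?thesis using i n by simp
qed

lemma ld_zero: "ld f m c \<Longrightarrow> f \<in> low m \<Longrightarrow> c = 0"
proof -
  assume "ld f m c" "f \<in> low m"
  then have c: "c \<in> S" "c * y ^ m \<in> low m"
    unfolding ld_def using low_diff[of f m "f - c * y ^ m"] by auto
  then obtain e where e: "\<forall>i. e i \<in> S" "c * y ^ m = (\<Sum>i<m. e i * y ^ i)"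
    unfolding low_def by blast
  define g where "g i = (if i = m then - c else e i)" for i
  have "(\<Sum>i<m. g i * y ^ i) = (\<Sum>i<m. e i * y ^ i)" by (rule sum.cong) (auto simp: g_def)
  then have "(\<Sum>i<Suc m. g i * y ^ i) = 0" using e(2) by (simp add: g_def)
  moreover have "g i \<in> S" for i using e(1) c(1) subringD(6)[OF S] by (simp add: g_def)
  ultimately have "g m = 0" by (intro free[of "Suc m" g m]) auto
  then show "c = 0" by (simp add: g_def)
qed

lemma ld_low: "f \<in> low m \<Longrightarrow> ld f m 0"
  unfolding ld_def using subringD(1)[OF S] by simp

lemma ld_0_low: "ld f m 0 \<Longrightarrow> f \<in> low m"
  unfolding ld_def by simp

lemma ld_add: "ld f m c \<Longrightarrow> ld g m e \<Longrightarrow> ld (f + g) m (c + e)"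
proof -
  assume h: "ld f m c" "ld g m e"
  have e: "f + g - (c + e) * y ^ m = (f - c * y ^ m) + (g - e * y ^ m)" by (simp add: algebra_simps)
  show ?thesis unfolding ld_def e using h low_simps(2) subringD(3)[OF S] unfolding ld_def by blast
qed

lemma ld_diff: "ld f m c \<Longrightarrow> ld g m e \<Longrightarrow> ld (f - g) m (c - e)"
proof -
  assume h: "ld f m c" "ld g m e"
  have e: "f - g - (c - e) * y ^ m = (f - c * y ^ m) - (g - e * y ^ m)" by (simp add: algebra_simps)
  show ?thesis unfolding ld_def e using h low_diff subringD(4)[OF S] unfolding ld_def by blast
qed

lemma ld_unique: "ld f m c \<Longrightarrow> ld f m e \<Longrightarrow> c = e"
  using ld_zero[OF ld_diff[of f m c f e]] low_simps(1) by simp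

lemma ld_sum: "finite X \<Longrightarrow> (\<And>i. i \<in> X \<Longrightarrow> ld (f i) m (c i)) \<Longrightarrow> ld (sum f X) m (sum c X)"
proof (induction X rule: finite_induct)
  case empty
  then show ?case using ld_low[OF low_simps(1)] by simp
next
  case (insert x F)
  then show ?case by (simp add: ld_add)
qed

lemma ld_const: "s \<in> S \<Longrightarrow> ld s 0 s"
  unfolding ld_def low_0 by simp

lemma ld_term: "s \<in> S \<Longrightarrow> ld (s * y ^ m) m s"
  unfolding ld_def using low_simps(1) by simp

lemma ld_T: "ld f m c \<Longrightarrow> f \<in> T"
  using low_T low_Suc_iff by blast

lemma ld_exists:
  assumes "f \<in> T" "f \<noteq> 0"
  obtains m c where "ld f m c" "c \<noteq> 0"
proof -
  define m where "m = (LEAST m. f \<in> low m)"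
  have m: "f \<in> low m" unfolding m_def using T_low[OF assms(1)] by (rule LeastI_ex)
  then obtain k where k: "m = Suc k" using low_0 assms(2) by (cases m) auto
  then obtain c where c: "ld f k c" using m low_Suc_iff by blast
  have "c \<noteq> 0"
  proof
    assume "c = 0"
    then have "f \<in> low k" using c ld_0_low by simp
    then have "m \<le> k" unfolding m_def by (rule Least_le)
    then show False using k by simp
  qed
  then show ?thesis using that c by blast
qed

lemma ld_nonzero: "ld f m c \<Longrightarrow> c \<noteq> 0 \<Longrightarrow> f \<noteq> 0"
  using ld_zero low_simps(1) by blast

section \<open>Degrees and leading coefficients of products\<close>

lemma low_ypow: "f \<in> low m \<Longrightarrow> f * y ^ k \<in> low (m + k)"
proof -
  assume "f \<in> low m"
  then obtain c where c: "\<forall>i. c i \<in> S" "f = (\<Sum>i<m. c i * y ^ i)"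
    unfolding low_def by blast
  have "f * y ^ k = (\<Sum>i<m. c i * y ^ (i + k))"
    unfolding c(2) by (simp add: sum_distrib_right mult.assoc power_add)
  then show ?thesis using c(1) by (auto intro!: low_sum term_low)
qed

lemma y_low: "f \<in> low m \<Longrightarrow> y * f \<in> low (Suc m)"
proof -
  assume "f \<in> low m"
  then obtain c where c: "\<forall>i. c i \<in> S" "f = (\<Sum>i<m. c i * y ^ i)"
    unfolding low_def by blast
  have "y * f = (\<Sum>i<m. y * c i * y ^ i)"
    unfolding c(2) by (simp add: sum_distrib_left mult.assoc)
  also have "\<dots> = (\<Sum>i<m. a (c i) * y ^ Suc i + d (c i) * y ^ i)"
    by (rule sum.cong) (use c(1) comm in \<open>auto simp: distrib_right mult.assoc\<close>)
  finally show ?thesis using c(1) aS dS by (auto intro!: low_sum low_simps(2) term_low simp del: power_Suc)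
qed

lemma ld_ypow: "p \<in> S \<Longrightarrow> ld (y ^ m * p) m ((a ^^ m) p)"
proof (induction m)
  case 0
  then show ?case using ld_const by simp
next
  case (Suc m)
  then obtain l where l: "(a ^^ m) p \<in> S" "l \<in> low m" "y ^ m * p = (a ^^ m) p * y ^ m + l"
    by (blast elim: ldE)
  have "y ^ Suc m * p = y * ((a ^^ m) p * y ^ m + l)" using l(3) by (simp add: mult.assoc)
  also have "\<dots> = (y * (a ^^ m) p) * y ^ m + y * l" by (simp add: distrib_left mult.assoc)
  also have "\<dots> = (a ^^ Suc m) p * y ^ Suc m + (d ((a ^^ m) p) * y ^ m + y * l)"
    using comm[OF l(1)] by (simp add: distrib_right mult.assoc)
  finally show ?case using ldI[of "(a ^^ Suc m) p" "d ((a ^^ m) p) * y ^ m + y * l" "Suc m"]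
     apow_S[OF Suc.prems, of "Suc m"] low_simps(2) term_low[OF dS[OF l(1)], of m "Suc m"] y_low[OF l(2)] by simp
qed

lemma low_mult: "f \<in> low (Suc m) \<Longrightarrow> g \<in> low k \<Longrightarrow> f * g \<in> low (m + k)"
proof -
  assume "f \<in> low (Suc m)" "g \<in> low k"
  then obtain c e where ce: "\<forall>i. c i \<in> S" "\<forall>i. e i \<in> S" "f = (\<Sum>i<Suc m. c i * y ^ i)" "g = (\<Sum>i<k. e i * y ^ i)"
    unfolding low_def by blast
  have "f * g = (\<Sum>i<Suc m. \<Sum>j<k. c i * (y ^ i * e j * y ^ j))"
    unfolding ce(3,4) sum_product by (simp only: mult.assoc)
  also have "\<dots> \<in> low (m + k)"
  proof (intro low_sum)
    fix i j assume i: "i \<in> {..<Suc m}" and j: "j \<in> {..<k}"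
    have "y ^ i * e j \<in> low (Suc i)" using ld_ypow ce(2) low_Suc_iff by blast
    then have "y ^ i * e j * y ^ j \<in> low (Suc i + j)" by (rule low_ypow)
    then have "y ^ i * e j * y ^ j \<in> low (m + k)" using low_mono[of "Suc i + j" "m + k"] i j by simp
    then show "c i * (y ^ i * e j * y ^ j) \<in> low (m + k)" using ce(1) low_simps(3) by blast
  qed
  finally show ?thesis .
qed

text \<open>The formal leading coefficients multiply with a twist by \<open>a ^^ m\<close>. The
  result may be zero, and that is exactly the information drawn later from products that
  vanish.\<close>

lemma ld_mult: "ld f m p \<Longrightarrow> ld g k q \<Longrightarrow> ld (f * g) (m + k) (p * (a ^^ m) q)"
proof -
  assume fp: "ld f m p" and gq: "ld g k q"
  obtain l where l: "p \<in> S" "l \<in> low m" "f = p * y ^ m + l" using ldE[OF fp] .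
  obtain l' where l': "q \<in> S" "l' \<in> low k" "g = q * y ^ k + l'" using ldE[OF gq] .
  obtain l'' where l'': "(a ^^ m) q \<in> S" "l'' \<in> low m" "y ^ m * q = (a ^^ m) q * y ^ m + l''"
    using ldE[OF ld_ypow[OF l'(1)]] .
  have "f * g = p * (y ^ m * q) * y ^ k + (p * y ^ m) * l' + l * g"
    unfolding l(3) l'(3) by (simp add: distrib_left distrib_right mult.assoc)
  also have "\<dots> = p * (a ^^ m) q * y ^ (m + k) + (p * (l'' * y ^ k) + (p * y ^ m) * l' + l * g)"
    unfolding l''(3) by (simp add: distrib_left distrib_right mult.assoc power_add)
  finally have e: "f * g = p * (a ^^ m) q * y ^ (m + k) + (p * (l'' * y ^ k) + (p * y ^ m) * l' + l * g)" .
  have "p * (l'' * y ^ k) \<in> low (m + k)" using low_simps(3)[OF l(1) low_ypow[OF l''(2)]] .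
  moreover have "(p * y ^ m) * l' \<in> low (m + k)" using low_mult[OF term_low[OF l(1) lessI] l'(2)] .
  moreover have "l * g \<in> low (m + k)"
  proof (cases m)
    case 0
    then show ?thesis using l(2) low_0 low_simps(1) by simp
  next
    case (Suc m')
    have "g \<in> low (Suc k)" using gq low_Suc_iff by blast
    then show ?thesis using low_mult[of l m' g "Suc k"] l(2) Suc by simp
  qed
  ultimately show ?thesis unfolding e
    using ldI[of "p * (a ^^ m) q"] low_simps(2) subringD(5)[OF S l(1) l''(1)] by simp
qed

lemma ld_smult: "s \<in> S \<Longrightarrow> ld f m c \<Longrightarrow> ld (s * f) m (s * c)"
  using ld_mult[OF ld_const, of s f m c] by simp

lemma ld_pow_mult: "ld f k q \<Longrightarrow> ld (y ^ j * f) (j + k) ((a ^^ j) q)"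
proof -
  assume "ld f k q"
  moreover have "ld (y ^ j) j 1" using ld_term[OF subringD(2)[OF S]] by simp
  ultimately show ?thesis using ld_mult by fastforce
qed

text \<open>Taking leading coefficients embeds \<open>low (Suc r)\<close> modulo
  \<open>low r\<close> into \<open>S\<close>, so by exchange each degree contributes at most
  \<open>n\<close>.\<close>

lemma udim_low:
  assumes bd: "udim_le S {0} S n"
  shows "udim_le S {0} (low r) (n * r)"
proof (induction r)
  case 0
  then show ?case unfolding udim_le_def indep_family_def low_0 by force
next
  case (Suc r)
  have "udim_le S (low r) (low (Suc r)) n"
    unfolding udim_le_def
  proof (intro allI impI)
    fix X :: "nat set" and w assume fam: "indep_family S (low r) (low (Suc r)) X w"
    then have X: "finite X" and w: "\<And>i. i \<in> X \<Longrightarrow> w i \<in> low (Suc r) \<and> w i \<notin> low r"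
      and ind: "indep S (low r) X w" unfolding indep_family_def by auto
    have "\<forall>i\<in>X. \<exists>c. ld (w i) r c" using w low_Suc_iff by blast
    then obtain c where "\<forall>i\<in>X. ld (w i) r (c i)" by (rule bchoice[THEN exE])
    then have c: "\<And>i. i \<in> X \<Longrightarrow> ld (w i) r (c i)" by blast
    have c0: "c i \<in> S \<and> c i \<noteq> 0" if "i \<in> X" for i
      using c[OF that] w[OF that] ld_0_low unfolding ld_def by auto
    have "indep S {0} X c"
    proof (rule indepI)
      fix z i assume z: "\<And>i. i \<in> X \<Longrightarrow> z i \<in> S" and s: "(\<Sum>i\<in>X. z i * c i) \<in> {0}" and i: "i \<in> X"
      have "ld (\<Sum>i\<in>X. z i * w i) r (\<Sum>i\<in>X. z i * c i)"
        by (rule ld_sum[OF X]) (use z c ld_smult in blast)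
      then have "(\<Sum>i\<in>X. z i * w i) \<in> low r" using s ld_0_low by simp
      then have "z i * w i \<in> low r" using z i by (intro indepD[OF ind, of z i]) auto
      then show "z i * c i \<in> {0}" using ld_zero[OF ld_smult[OF z[OF i] c[OF i]]] by simp
    qed
    then have "indep_family S {0} S X c" using X c0 unfolding indep_family_def by blast
    then show "card X \<le> n" by (rule udim_leD[OF bd])
  qed
  then have "udim_le S {0} (low (Suc r)) (n + n * r)"
    using udim_steinitz[OF S low_submod _ Suc] low_mono[of r "Suc r"] by (meson le_Suc_eq subsetI order_refl)
  then show ?case by simp
qed

lemma nonsingE:
  assumes "nonsing S" "e \<in> S" "e \<noteq> 0"
  obtains r where "r \<in> S" "r \<noteq> 0" "\<forall>s\<in>S. s * r * e = 0 \<longrightarrow> s * r = 0"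
  using assms unfolding nonsing_def by blast

text \<open>An \<open>r\<close> in \<open>S\<close> that witnesses that the leading coefficient
  \<open>c\<close> is not singular works for \<open>f\<close> itself: by induction on the degree of
  \<open>t\<close>, \<open>t * r * f = 0\<close> forces \<open>t * r = 0\<close>.\<close>

lemma nonsing_ore:
  assumes ns: "nonsing S"
  shows "nonsing T"
  unfolding nonsing_def
proof (intro ballI impI, rule ccontr)
  fix f assume f: "f \<in> T" "f \<noteq> 0" and sing: "\<forall>r\<in>T. r \<noteq> 0 \<longrightarrow> (\<exists>s\<in>T. s * r \<noteq> 0 \<and> s * r * f = 0)"
  obtain k c where kc: "ld f k c" "c \<noteq> 0" using ld_exists[OF f] .
  then have cS: "c \<in> S" unfolding ld_def by blast
  obtain r where r: "r \<in> S" "r \<noteq> 0" "\<forall>s\<in>S. s * r * c = 0 \<longrightarrow> s * r = 0"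
    using nonsingE[OF ns cS kc(2)] .
  have "t * r = 0" if "t \<in> low N" "t * r * f = 0" for t N
    using that
  proof (induction N arbitrary: t)
    case 0
    then show ?case using low_0 by simp
  next
    case (Suc N)
    obtain q where q: "ld t N q" using Suc.prems(1) low_Suc_iff by blast
    then have "q \<in> S" unfolding ld_def by blast
    then obtain u where u: "u \<in> S" "(a ^^ N) u = q" using apow_surj by blast
    have "ld (t * r * f) (N + 0 + k) (q * (a ^^ N) r * (a ^^ (N + 0)) c)"
      using ld_mult[OF ld_mult[OF q ld_const[OF r(1)]] kc(1)] .
    then have "q * (a ^^ N) r * (a ^^ N) c = 0" using ld_zero low_simps(1) Suc.prems(2) by fastforce
    then have "(a ^^ N) (u * r * c) = 0" using u r(1) cS subringD(5)[OF S] by (simp add: apow_mult)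
    then have "u * r * c = 0" using apow_eq_zero subringD(5)[OF S] u(1) r(1) cS by blast
    then have ur: "u * r = 0" using r(3) u(1) by blast
    \<comment> \<open>The leading term is removed with its coefficient on the right:
      \<open>y ^ N * u\<close> has leading coefficient \<open>q\<close> but is killed by
      \<open>r\<close>, so the degree drops while \<open>t' * r = t * r\<close>. Surjectivity of the
      automorphism provides \<open>u\<close>.\<close>
    define t' where "t' = t - y ^ N * u"
    have "ld t' N (q - q)" unfolding t'_def using ld_diff[OF q ld_ypow[OF u(1), of N]] u(2) by simp
    then have "t' \<in> low N" using ld_0_low by simp
    moreover have e: "t' * r = t * r" unfolding t'_def using ur by (simp add: left_diff_distrib mult.assoc)
    ultimately show ?case using Suc.IH[of t'] Suc.prems(2) by simp
  qed
  then show False using sing r(1,2) ST T_low by blast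
qed

text \<open>The elements \<open>r y ^ j f\<^sub>i\<close> with \<open>j \<le> N\<close>, for suitable \<open>r \<in> S\<close>, are \<open>S\<close>-independent; their number
  grows like \<open>(n + 1) N\<close>, whereas the polynomials of degree at most \<open>N + M\<close> only allow for \<open>n (N + M + 1)\<close>.\<close>
lemma udim_ore:
  assumes ns: "nonsing S" and bd: "udim_le S {0} S n"
  shows "udim_le T {0} T n"
  unfolding udim_le_def
proof (intro allI impI, rule ccontr)
  fix X :: "nat set" and f assume fam: "indep_family T {0} T X f" and nc: "\<not> card X \<le> n"
  have X: "finite X" and fT: "\<And>i. i \<in> X \<Longrightarrow> f i \<in> T \<and> f i \<noteq> 0" and ind: "indep T {0} X f"
    using fam unfolding indep_family_def by auto
  have "\<forall>i\<in>X. \<exists>p. ld (f i) (fst p) (snd p) \<and> snd p \<noteq> 0"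
    using fT ld_exists by (metis fst_conv snd_conv)
  then obtain p where "\<forall>i\<in>X. ld (f i) (fst (p i)) (snd (p i)) \<and> snd (p i) \<noteq> 0"
    by (rule bchoice[THEN exE])
  moreover define D c where "D i = fst (p i)" and "c i = snd (p i)" for i
  ultimately have Dc: "\<And>i. i \<in> X \<Longrightarrow> ld (f i) (D i) (c i)" "\<And>i. i \<in> X \<Longrightarrow> c i \<noteq> 0" by auto
  define M where "M = Max (insert 0 (D ` X))"
  have DM: "D i \<le> M" if "i \<in> X" for i unfolding M_def using X that by simp
  \<comment> \<open>With this value the final count
    \<open>(n + 1) * (N + 1) \<le> n * (N + M + 1)\<close> would amount to
    \<open>N + 1 \<le> N\<close>.\<close>
  define N where "N = n * M"
  have cS: "c i \<in> S" if "i \<in> X" for i using Dc(1)[OF that] unfolding ld_def by blast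
  \<comment> \<open>The factors \<open>r\<close> are chosen so that a left multiple of
    \<open>w (i, j)\<close> vanishes as soon as its formal leading coefficient does.\<close>
  have "\<forall>q\<in>X \<times> {..<Suc N}. \<exists>r. r \<in> S \<and> r \<noteq> 0 \<and> (\<forall>s\<in>S. s * r * (a ^^ snd q) (c (fst q)) = 0 \<longrightarrow> s * r = 0)"
  proof
    fix q assume q: "q \<in> X \<times> {..<Suc N}"
    have "(a ^^ snd q) (c (fst q)) \<in> S" "(a ^^ snd q) (c (fst q)) \<noteq> 0"
      using q apow_S[OF cS] apow_eq_zero[OF cS] Dc(2) by (auto simp: mem_Times_iff)
    from nonsingE[OF ns this]
    show "\<exists>r. r \<in> S \<and> r \<noteq> 0 \<and> (\<forall>s\<in>S. s * r * (a ^^ snd q) (c (fst q)) = 0 \<longrightarrow> s * r = 0)"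
      by blast
  qed
  then obtain r where r: "\<forall>q\<in>X \<times> {..<Suc N}. r q \<in> S \<and> r q \<noteq> 0 \<and> (\<forall>s\<in>S. s * r q * (a ^^ snd q) (c (fst q)) = 0 \<longrightarrow> s * r q = 0)"
    by (rule bchoice[THEN exE])
  define w where "w q = r q * (y ^ snd q * f (fst q))" for q
  have ldw: "ld (w (i, j)) (j + D i) (r (i, j) * (a ^^ j) (c i))" if "i \<in> X" "j < Suc N" for i j
    unfolding w_def using ld_smult[OF _ ld_pow_mult[OF Dc(1)[OF that(1)]]] r that by simp
  have rn: "r (i, j) * (a ^^ j) (c i) \<noteq> 0" if "i \<in> X" "j < Suc N" for i j
  proof
    assume "r (i, j) * (a ^^ j) (c i) = 0"
    then have "1 * r (i, j) * (a ^^ j) (c i) = 0" by simp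
    then have "1 * r (i, j) = 0" using r that subringD(2)[OF S] by force
    then show False using r that by force
  qed
  have wlow: "w q \<in> low (Suc (N + M)) \<and> w q \<notin> {0}" if qX: "q \<in> X \<times> {..<Suc N}" for q
  proof -
    obtain i j where q: "q = (i, j)" "i \<in> X" "j < Suc N" using qX by auto
    have "w q \<in> low (Suc (j + D i))" using ldw q low_Suc_iff by blast
    then have "w q \<in> low (Suc (N + M))" using low_mono[of "Suc (j + D i)" "Suc (N + M)"] DM[OF q(2)] q(3) by simp
    then show ?thesis using ld_nonzero[OF ldw[OF q(2,3)] rn[OF q(2,3)]] q(1) by simp
  qed
  have "indep S {0} (X \<times> {..<Suc N}) w"
  proof (rule indepI)
    fix z q assume z: "\<And>q. q \<in> X \<times> {..<Suc N} \<Longrightarrow> z q \<in> S" and s: "(\<Sum>q\<in>X \<times> {..<Suc N}. z q * w q) \<in> {0}"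
      and q: "q \<in> X \<times> {..<Suc N}"
    \<comment> \<open>For fixed \<open>i\<close> the terms are collected into one coefficient from
      \<open>T\<close> in front of \<open>f i\<close>. Independence over \<open>T\<close> isolates
      each \<open>i\<close>, and within one \<open>i\<close> the degrees \<open>j + D i\<close> are
      distinct.\<close>
    define b where "b i = (\<Sum>j<Suc N. z (i, j) * r (i, j) * y ^ j)" for i
    have bf: "b i * f i = (\<Sum>j<Suc N. z (i, j) * w (i, j))" for i
      unfolding b_def w_def sum_distrib_right by (simp only: mult.assoc fst_conv snd_conv)
    have "(\<Sum>q\<in>X \<times> {..<Suc N}. z q * w q) = (\<Sum>i\<in>X. \<Sum>j<Suc N. z (i, j) * w (i, j))"
      by (simp add: sum.cartesian_product case_prod_unfold del: sum.lessThan_Suc)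
    then have "(\<Sum>i\<in>X. b i * f i) \<in> {0}" using s by (simp only: bf)
    moreover have "b i \<in> T" if "i \<in> X" for i
    proof -
      have "b i \<in> low (Suc N)" unfolding b_def
        by (rule lowI) (use z r that subringD(5)[OF S] in blast)
      then show ?thesis by (rule low_T)
    qed
    ultimately have b0: "b i * f i \<in> {0}" if "i \<in> X" for i using that by (intro indepD[OF ind])
    obtain i j where ij: "q = (i, j)" "i \<in> X" "j \<in> {..<Suc N}" using q by auto
    have "indep S {0} {..<Suc N} (\<lambda>j. w (i, j))"
    proof (rule indep_triangular)
      fix e k assume k: "k < Suc N" and e: "\<And>j. j \<le> k \<Longrightarrow> e j \<in> S" and es: "(\<Sum>j<Suc k. e j * w (i, j)) = 0"
      have l: "ld (e k * w (i, k)) (k + D i) (e k * (r (i, k) * (a ^^ k) (c i)))"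
        using ld_smult[OF _ ldw[OF ij(2) k]] e by simp
      have "(\<Sum>j<k. e j * w (i, j)) \<in> low (k + D i)"
      proof (rule low_sum)
        fix j assume j: "j \<in> {..<k}"
        have "w (i, j) \<in> low (Suc (j + D i))" using ldw[OF ij(2), of j] j k low_Suc_iff by auto
        then have "w (i, j) \<in> low (k + D i)" using low_mono[of "Suc (j + D i)" "k + D i"] j by simp
        then show "e j * w (i, j) \<in> low (k + D i)" using low_simps(3) e j by simp
      qed
      moreover have "e k * w (i, k) = 0 - (\<Sum>j<k. e j * w (i, j))"
        using es by (simp add: eq_neg_iff_add_eq_0 add.commute)
      ultimately have "e k * w (i, k) \<in> low (k + D i)" by (simp only: low_diff low_simps(1))
      then have "e k * r (i, k) * (a ^^ k) (c i) = 0" using ld_zero[OF l] by (simp add: mult.assoc)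
      then have "e k * r (i, k) = 0" using r ij(2) k e by force
      then show "e k * w (i, k) = 0" unfolding w_def by (simp add: mult.assoc[symmetric])
    qed
    moreover have "(\<Sum>j<Suc N. z (i, j) * w (i, j)) \<in> {0}" using b0[OF ij(2)] bf by simp
    ultimately have "z (i, j) * w (i, j) \<in> {0}"
      using ij z by (intro indepD[of S "{0}" "{..<Suc N}" "\<lambda>j. w (i, j)" "\<lambda>j. z (i, j)" j]) auto
    then show "z q * w q \<in> {0}" using ij(1) by simp
  qed
  then have "indep_family S {0} (low (Suc (N + M))) (X \<times> {..<Suc N}) w"
    using wlow X unfolding indep_family_def by blast
  from udim_leD[OF udim_low[OF bd] this]
  have "card X * Suc N \<le> n * Suc (N + M)" by (simp add: card_cartesian_product)
  moreover have "Suc n * Suc N \<le> card X * Suc N" using nc by (intro mult_le_mono1) simp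
  ultimately have "Suc n * Suc N \<le> n * Suc (N + M)" by linarith
  then show False unfolding N_def by (simp add: algebra_simps)
qed

end

section \<open>Coefficients and the decomposition modulo a degree\<close>

lemma regular_inD:
  assumes "regular_in S u"
  shows "u \<in> S" "s \<in> S \<Longrightarrow> s * u = 0 \<Longrightarrow> s = 0" "s \<in> S \<Longrightarrow> u * s = 0 \<Longrightarrow> s = 0"
  using assms unfolding regular_in_def by auto

lemma regular_in_mult:
  assumes S: "is_subring S" and u: "regular_in S u" and v: "regular_in S v"
  shows "regular_in S (u * v)"
proof -
  have uv: "u \<in> S" "v \<in> S" using u v regular_inD(1) by auto
  have "s = 0" if "s \<in> S" "s * (u * v) = 0" for s
  proof -
    have "s * u = 0"
      by (rule regular_inD(2)[OF v subringD(5)[OF S that(1) uv(1)]]) (simp add: that(2) mult.assoc)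
    then show ?thesis using regular_inD(2)[OF u that(1)] by blast
  qed
  moreover have "s = 0" if "s \<in> S" "u * v * s = 0" for s
  proof -
    have "v * s = 0"
      by (rule regular_inD(3)[OF u subringD(5)[OF S uv(2) that(1)]]) (simp add: that(2) mult.assoc[symmetric])
    then show ?thesis using regular_inD(3)[OF v that(1)] by blast
  qed
  ultimately show ?thesis unfolding regular_in_def using subringD(5)[OF S uv] by blast
qed

text \<open>For regular \<open>u\<close> the left ideal \<open>S u\<close> is essential, and so are
  its preimages under right multiplication. The denominators are treated one after another, and
  nonsingularity keeps \<open>c * e\<close> non-zero each time; \<open>c\<close> is not claimed to
  be regular.\<close>

lemma common_denominator:
  assumes S: "is_subring S" and ns: "nonsing S" and bd: "udim_le S {0} S n"
    and P: "finite P" "\<forall>p\<in>P. fst p \<in> S \<and> regular_in S (snd p)" and e: "e \<in> S" "e \<noteq> 0"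
  shows "\<exists>c\<in>S. c * e \<noteq> 0 \<and> (\<forall>p\<in>P. \<exists>z\<in>S. c * fst p = z * snd p)"
  using P
proof (induction P rule: finite_induct)
  case empty
  then show ?case using e subringD(2)[OF S] by force
next
  case (insert p P)
  then obtain c where c: "c \<in> S" "c * e \<noteq> 0" "\<forall>p\<in>P. \<exists>z\<in>S. c * fst p = z * snd p" by auto
  have p: "fst p \<in> S" "regular_in S (snd p)" using insert.prems by auto
  define E where "E = (\<lambda>z. z * snd p) ` S"
  have "ess_in S E"
    unfolding ess_in_def
  proof (intro ballI impI)
    fix r assume r: "r \<in> S" "r \<noteq> 0"
    obtain s z where "s \<in> S" "z \<in> S" "s * r \<noteq> 0" "s * r = z * snd p"
    proof (rule ess_in_right_mult[OF S submod_self[OF S] order_refl _ _ _ bd r])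
      show "snd p \<in> S" using regular_inD(1)[OF p(2)] .
      show "s = 0" if "s \<in> S" "s * snd p = 0" for s using regular_inD(2)[OF p(2) that] .
      show "z * snd p \<in> S" if "z \<in> S" for z using subringD(5)[OF S that regular_inD(1)[OF p(2)]] .
    qed
    then show "\<exists>s\<in>S. s * r \<noteq> 0 \<and> s * r \<in> E" unfolding E_def by blast
  qed
  moreover have "0 \<in> E" unfolding E_def using subringD(1)[OF S] by force
  moreover have "c * fst p \<in> S" "c * e \<in> S" using subringD(5)[OF S c(1)] p(1) e(1) by auto
  ultimately have "ess_in S {z \<in> S. z * (c * fst p) \<in> E}" by (intro ess_in_vimage[OF S])
  then obtain z where z: "z \<in> S" "z \<in> {z \<in> S. z * (c * fst p) \<in> E}" "z * (c * e) \<noteq> 0"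
    using nonsing_ess_in[OF S ns _ \<open>c * e \<in> S\<close> c(2)] by blast
  have "\<exists>w\<in>S. z * c * fst q = w * snd q" if q: "q \<in> insert p P" for q
  proof (cases "q = p")
    case True
    then show ?thesis using z(2) unfolding E_def by (auto simp: mult.assoc)
  next
    case False
    then obtain w where w: "w \<in> S" "c * fst q = w * snd q" using c(3) q by blast
    have "z * c * fst q = (z * w) * snd q" using w(2) by (simp add: mult.assoc)
    then show ?thesis using subringD(5)[OF S z(1) w(1)] by blast
  qed
  then show ?case using z(3) subringD(5)[OF S z(1) c(1)] by (intro bexI[of _ "z * c"]) (simp_all add: mult.assoc)
qed

context ore
begin

section \<open>Coefficient functions of elements of the Ore extension\<close>

definition coeff_of :: "'a \<Rightarrow> (nat \<Rightarrow> 'a) \<Rightarrow> bool" where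
  "coeff_of f c \<longleftrightarrow> (\<forall>i. c i \<in> S) \<and> (\<exists>m. (\<forall>i\<ge>m. c i = 0) \<and> f = (\<Sum>i<m. c i * y ^ i))"

definition cf :: "'a \<Rightarrow> nat \<Rightarrow> 'a" where
  "cf f = (SOME c. coeff_of f c)"

lemma coeff_of_extend:
  assumes "coeff_of f c"
  obtains m where "\<forall>i\<ge>m. c i = 0" "\<forall>n\<ge>m. f = (\<Sum>i<n. c i * y ^ i)"
proof -
  obtain m where m: "\<forall>i\<ge>m. c i = 0" "f = (\<Sum>i<m. c i * y ^ i)" using assms unfolding coeff_of_def by blast
  have "f = (\<Sum>i<n. c i * y ^ i)" if "m \<le> n" for n
    unfolding m(2) by (rule sum.mono_neutral_left) (use that m(1) in auto)
  then show ?thesis using that m(1) by blast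
qed

lemma coeff_of_unique:
  assumes "coeff_of f c" "coeff_of f e"
  shows "c = e"
proof
  fix i
  obtain m where m: "\<forall>n\<ge>m. f = (\<Sum>i<n. c i * y ^ i)" using coeff_of_extend[OF assms(1)] by metis
  obtain k where k: "\<forall>n\<ge>k. f = (\<Sum>i<n. e i * y ^ i)" using coeff_of_extend[OF assms(2)] by metis
  define n where "n = Suc (i + m + k)"
  have "(\<Sum>i<n. c i * y ^ i) = f" by (rule m[rule_format, symmetric]) (simp add: n_def)
  moreover have "(\<Sum>i<n. e i * y ^ i) = f" by (rule k[rule_format, symmetric]) (simp add: n_def)
  ultimately have "(\<Sum>i<n. (c i - e i) * y ^ i) = 0" by (simp add: left_diff_distrib sum_subtractf)
  moreover have "c j - e j \<in> S" for j using assms subringD(4)[OF S] unfolding coeff_of_def by blast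
  moreover have "i < n" unfolding n_def by simp
  ultimately have "c i - e i = 0" using free[of n "\<lambda>j. c j - e j" i] by blast
  then show "c i = e i" by simp
qed

lemma coeff_of_low:
  assumes "f \<in> low m"
  obtains c where "coeff_of f c" "\<forall>i\<ge>m. c i = 0"
proof -
  obtain c where c: "\<forall>i. c i \<in> S" "f = (\<Sum>i<m. c i * y ^ i)" using assms unfolding low_def by blast
  define e where "e i = (if i < m then c i else 0)" for i
  have "f = (\<Sum>i<m. e i * y ^ i)" unfolding c(2) by (rule sum.cong) (auto simp: e_def)
  moreover have "\<forall>i\<ge>m. e i = 0" "\<forall>i. e i \<in> S" unfolding e_def using c(1) subringD(1)[OF S] by auto
  ultimately show ?thesis using that[of e] unfolding coeff_of_def by blast
qed

lemma coeff_of_cf: "f \<in> T \<Longrightarrow> coeff_of f (cf f)"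
proof -
  assume "f \<in> T"
  then obtain m where "f \<in> low m" using T_low by blast
  then obtain c where "coeff_of f c" by (rule coeff_of_low)
  then show ?thesis unfolding cf_def by (rule someI[of "coeff_of f" c])
qed

lemma cf_eq: "coeff_of f c \<Longrightarrow> cf f = c"
  unfolding cf_def by (rule some_equality) (simp_all add: coeff_of_unique)

lemma cf_S: "f \<in> T \<Longrightarrow> cf f i \<in> S"
  using coeff_of_cf unfolding coeff_of_def by blast

lemma cf_rep:
  assumes "f \<in> T"
  obtains m where "\<forall>i\<ge>m. cf f i = 0" "\<forall>n\<ge>m. f = (\<Sum>i<n. cf f i * y ^ i)"
  using coeff_of_extend[OF coeff_of_cf[OF assms]] .

lemma cf_low: "f \<in> low m \<Longrightarrow> i \<ge> m \<Longrightarrow> cf f i = 0"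
proof -
  assume f: "f \<in> low m" and i: "i \<ge> m"
  obtain c where "coeff_of f c" "\<forall>i\<ge>m. c i = 0" using coeff_of_low[OF f] .
  then show ?thesis using cf_eq[of f c] i by simp
qed

lemma cf_add:
  assumes "f \<in> T" "g \<in> T"
  shows "cf (f + g) i = cf f i + cf g i"
proof -
  obtain m where m: "\<forall>i\<ge>m. cf f i = 0" "\<forall>n\<ge>m. f = (\<Sum>i<n. cf f i * y ^ i)" using cf_rep[OF assms(1)] .
  obtain k where k: "\<forall>i\<ge>k. cf g i = 0" "\<forall>n\<ge>k. g = (\<Sum>i<n. cf g i * y ^ i)" using cf_rep[OF assms(2)] .
  have "f + g = (\<Sum>i<m + k. cf f i * y ^ i) + (\<Sum>i<m + k. cf g i * y ^ i)"
    using m(2)[rule_format, of "m + k"] k(2)[rule_format, of "m + k"] by simp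
  then have "f + g = (\<Sum>i<m + k. (cf f i + cf g i) * y ^ i)" by (simp add: distrib_right sum.distrib)
  then have "coeff_of (f + g) (\<lambda>i. cf f i + cf g i)"
    unfolding coeff_of_def using cf_S assms subringD(3)[OF S] m(1) k(1)
    by (intro conjI allI exI[of _ "m + k"]) auto
  from cf_eq[OF this] show ?thesis by simp
qed

lemma cf_smult:
  assumes "s \<in> S" "f \<in> T"
  shows "cf (s * f) i = s * cf f i"
proof -
  obtain m where m: "\<forall>i\<ge>m. cf f i = 0" "\<forall>n\<ge>m. f = (\<Sum>i<n. cf f i * y ^ i)" using cf_rep[OF assms(2)] .
  have "s * f = s * (\<Sum>i<m. cf f i * y ^ i)" using m(2)[rule_format, of m] by simp
  then have "s * f = (\<Sum>i<m. (s * cf f i) * y ^ i)" by (simp add: sum_distrib_left mult.assoc)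
  then have "coeff_of (s * f) (\<lambda>i. s * cf f i)"
    unfolding coeff_of_def using cf_S assms subringD(5)[OF S] m(1)
    by (intro conjI allI exI[of _ m]) auto
  from cf_eq[OF this] show ?thesis by simp
qed

lemma cf_zero: "cf 0 i = 0"
  using cf_low[of 0 0 i] low_0 by simp

lemma cf_sum:
  assumes "finite X" "\<forall>q\<in>X. s q \<in> S \<and> g q \<in> T"
  shows "cf (\<Sum>q\<in>X. s q * g q) i = (\<Sum>q\<in>X. s q * cf (g q) i)"
  using assms
proof (induction X rule: finite_induct)
  case empty
  then show ?case by (simp add: cf_zero)
next
  case (insert x F)
  have sg: "s q * g q \<in> T" if "q \<in> insert x F" for q using insert.prems that ST subringD(5)[OF T] by blast
  have "(\<Sum>q\<in>F. s q * g q) \<in> T" by (rule subring_sum[OF T]) (use sg in blast)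
  then show ?case using insert sg by (simp add: cf_add cf_smult)
qed

lemma cf_nonzero: "f \<in> T \<Longrightarrow> f \<noteq> 0 \<Longrightarrow> \<exists>i. cf f i \<noteq> 0"
proof (rule ccontr)
  assume "f \<in> T" "f \<noteq> 0" "\<nexists>i. cf f i \<noteq> 0"
  then have "\<exists>m. f = (\<Sum>i<m. cf f i * y ^ i)" "\<And>i. cf f i = 0"
    using coeff_of_cf[of f] unfolding coeff_of_def by blast+
  then show False using \<open>f \<noteq> 0\<close> by simp
qed

lemma cf_ld:
  assumes "ld f m c" shows "cf f m = c"
proof -
  have f: "f \<in> low (Suc m)" using assms low_Suc_iff by blast
  then have fT: "f \<in> T" by (rule low_T)
  have c: "c \<in> S" "f - c * y ^ m \<in> low m" using assms unfolding ld_def by auto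
  obtain k where k: "\<forall>n\<ge>k. f = (\<Sum>i<n. cf f i * y ^ i)" using cf_rep[OF fT] by metis
  have z: "cf f i = 0" if "i \<ge> Suc m" for i using cf_low[OF f that] .
  have "f = (\<Sum>i<Suc m + k. cf f i * y ^ i)" by (rule k[rule_format]) simp
  also have "\<dots> = (\<Sum>i<Suc m. cf f i * y ^ i)" by (rule sum.mono_neutral_right) (use z in auto)
  also have "\<dots> = cf f m * y ^ m + (\<Sum>i<m. cf f i * y ^ i)" by simp
  finally have "ld f m (cf f m)" using ldI[OF cf_S[OF fT] lowI[of m "cf f"]] cf_S[OF fT] by metis
  then show ?thesis using ld_unique assms by blast
qed

lemma cf_term: "s \<in> S \<Longrightarrow> cf (s * y ^ m) i = (if i = m then s else 0)"
proof -
  assume s: "s \<in> S"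
  have "s * y ^ m = (\<Sum>i<Suc m. (if i = m then s else 0) * y ^ i)"
    by (subst sum.mono_neutral_right[of _ "{m}"]) auto
  then have "coeff_of (s * y ^ m) (\<lambda>i. if i = m then s else 0)"
    unfolding coeff_of_def using s subringD(1)[OF S] by (intro conjI exI[of _ "Suc m"]) auto
  from cf_eq[OF this] show ?thesis by simp
qed

text \<open>For \<open>e = 0\<close> these are the constants, and \<open>residues 0 N\<close> below is all of \<open>{..<N}\<close> because
  \<open>r mod 0 = r\<close>; so the inclusion \<open>S \<subseteq> T\<close> is covered as well.\<close>
definition Hd :: "nat \<Rightarrow> 'a set" where
  "Hd e = {f \<in> T. \<forall>i. cf f i \<noteq> 0 \<longrightarrow> e dvd i}"

lemma Hd_submod: "submod S (Hd e)"
  unfolding submod_def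
proof (intro conjI ballI)
  show "0 \<in> Hd e" unfolding Hd_def using subringD(1)[OF T] by (simp add: cf_zero)
next
  fix f g assume "f \<in> Hd e" "g \<in> Hd e"
  then have fg: "f \<in> T" "g \<in> T" "\<And>i. cf f i \<noteq> 0 \<Longrightarrow> e dvd i" "\<And>i. cf g i \<noteq> 0 \<Longrightarrow> e dvd i"
    unfolding Hd_def by auto
  have "e dvd i" if "cf (f + g) i \<noteq> 0" for i
    using that fg(3,4)[of i] unfolding cf_add[OF fg(1,2)] by force
  then show "f + g \<in> Hd e" unfolding Hd_def using subringD(3)[OF T fg(1,2)] by blast
next
  fix r f assume r: "r \<in> S" "f \<in> Hd e"
  then have "r * f \<in> T" unfolding Hd_def using ST subringD(5)[OF T] by blast
  moreover have "e dvd i" if "cf (r * f) i \<noteq> 0" for i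
  proof -
    have "cf (r * f) i = r * cf f i" using r unfolding Hd_def by (intro cf_smult) auto
    then have "cf f i \<noteq> 0" using that by auto
    then show ?thesis using r unfolding Hd_def by blast
  qed
  ultimately show "r * f \<in> Hd e" unfolding Hd_def by blast
qed

lemma Hd_term: "s \<in> S \<Longrightarrow> e dvd m \<Longrightarrow> s * y ^ m \<in> Hd e"
  unfolding Hd_def using ld_T[OF ld_term[of s m]] by (auto simp: cf_term)

lemma Hd_zero: "Hd 0 = S"
proof
  show "S \<subseteq> Hd 0" using Hd_term[of _ 0 0] by auto
  show "Hd 0 \<subseteq> S"
  proof
    fix f assume f: "f \<in> Hd 0"
    then have "f \<in> T" unfolding Hd_def by blast
    then obtain m where m: "\<forall>n\<ge>m. f = (\<Sum>i<n. cf f i * y ^ i)" using cf_rep[of f] by blast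
    have "f = (\<Sum>i<Suc m. cf f i * y ^ i)" by (rule m[rule_format]) simp
    also have "\<dots> = (\<Sum>i\<in>{0}. cf f i * y ^ i)"
    proof (rule sum.mono_neutral_right)
      have "cf f i = 0" if "i \<noteq> 0" for i using f that unfolding Hd_def by auto
      then show "\<forall>i\<in>{..<Suc m} - {0}. cf f i * y ^ i = 0" by simp
    qed auto
    finally show "f \<in> S" using cf_S[of f 0] f unfolding Hd_def by simp
  qed
qed

definition residues :: "nat \<Rightarrow> nat \<Rightarrow> nat set" where
  "residues e N = {r. r < N \<and> r mod e = r}"

lemma finite_residues: "finite (residues e N)"
  unfolding residues_def by simp

text \<open>Powers of \<open>y\<close> are split off on the left so that right multiplication acts
  on the factors from \<open>Hd e\<close>. A leading term in degree \<open>n\<close> is matched with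
  \<open>r = n mod e\<close>, its coefficient being pulled back along \<open>a ^^ r\<close>.\<close>

lemma Hd_decompose:
  assumes "t \<in> low n" "n \<le> N"
  shows "\<exists>h. (\<forall>r. h r \<in> Hd e) \<and> t = (\<Sum>r\<in>residues e N. y ^ r * h r)"
  using assms
proof (induction n arbitrary: t)
  case 0
  then have "t = (\<Sum>r\<in>residues e N. y ^ r * 0)" using low_0 by simp
  then show ?case using submodD(1)[OF Hd_submod] by (intro exI[of _ "\<lambda>_. 0"]) simp
next
  case (Suc n)
  obtain c where c: "ld t n c" using Suc.prems(1) low_Suc_iff by blast
  define r where "r = n mod e"
  have r: "r \<in> residues e N" "r \<le> n" unfolding r_def residues_def using Suc.prems(2)
    by (auto intro: le_less_trans[OF mod_less_eq_dividend])
  obtain u where u: "u \<in> S" "(a ^^ r) u = c" using apow_surj c unfolding ld_def by blast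
  define g where "g = u * y ^ (n - r)"
  have g: "g \<in> Hd e" unfolding g_def r_def using u(1) dvd_minus_mod by (intro Hd_term)
  have "ld (y ^ r * g) n c" using ld_pow_mult[OF ld_term[OF u(1), of "n - r"], of r] r(2) u(2) unfolding g_def by simp
  then have "t - y ^ r * g \<in> low n" using ld_diff[OF c] ld_0_low by fastforce
  then obtain h where h: "\<forall>r. h r \<in> Hd e" "t - y ^ r * g = (\<Sum>r\<in>residues e N. y ^ r * h r)"
    using Suc.IH Suc.prems(2) by (meson Suc_leD)
  define h' where "h' = h(r := h r + g)"
  have "(\<Sum>q\<in>residues e N. y ^ q * h' q) = (\<Sum>q\<in>residues e N. y ^ q * h q + (if q = r then y ^ r * g else 0))"
    by (rule sum.cong) (auto simp: h'_def distrib_left)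
  also have "\<dots> = (\<Sum>q\<in>residues e N. y ^ q * h q) + y ^ r * g"
    using r(1) finite_residues by (simp add: sum.distrib)
  also have "\<dots> = t" using h(2) by (metis diff_add_cancel)
  finally have "t = (\<Sum>q\<in>residues e N. y ^ q * h' q)" by simp
  moreover have "\<forall>q. h' q \<in> Hd e" using h(1) g submodD(2)[OF Hd_submod] unfolding h'_def by simp
  ultimately show ?case by blast
qed

text \<open>The leading degree of \<open>y ^ r * h r\<close> is congruent to \<open>r\<close> modulo
  \<open>e\<close>, so only one summand can reach the top degree. Truncated subtraction makes
  \<open>low (n - r)\<close> the zero set once \<open>r \<ge> n\<close>, which is where the descent
  on \<open>n\<close> ends.\<close>

lemma Hd_unique_low:
  assumes "\<forall>r\<in>residues e N. h r \<in> Hd e \<and> h r \<in> low (n - r)" "(\<Sum>r\<in>residues e N. y ^ r * h r) = 0"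
  shows "\<forall>r\<in>residues e N. h r = 0"
  using assms(1)
proof (induction n)
  case 0
  then show ?case using low_0 by simp
next
  case (Suc n)
  have other: "h r \<in> low (n - r)" if r: "r \<in> residues e N" "r \<noteq> n mod e" for r
  proof (cases "r \<le> n")
    case True
    have "h r \<in> low (Suc n - r)" using Suc.prems r(1) by blast
    then obtain c where c: "ld (h r) (n - r) c" using low_Suc_iff by (auto simp: Suc_diff_le True)
    have "\<not> e dvd n - r"
    proof
      assume "e dvd n - r"
      then have "n mod e = r mod e" using True by (simp add: mod_eq_dvd_iff_nat)
      then show False using r unfolding residues_def by simp
    qed
    then have "c = 0" using cf_ld[OF c] Suc.prems r(1) unfolding Hd_def by blast
    then show ?thesis using c ld_0_low by simp
  next
    case False
    then have "Suc n - r = 0" by simp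
    then have "h r \<in> low 0" using Suc.prems r(1) by metis
    then show ?thesis using low_mono by blast
  qed
  have "h r \<in> low (n - r)" if r: "r \<in> residues e N" for r
  proof (cases "r = n mod e")
    case True
    then have rn: "r \<le> n" by simp
    have "h r \<in> low (Suc n - r)" using Suc.prems r(1) by blast
    then obtain c where c: "ld (h r) (n - r) c" using low_Suc_iff by (auto simp: Suc_diff_le rn)
    then have l: "ld (y ^ r * h r) n ((a ^^ r) c)" using ld_pow_mult[OF c, of r] rn by simp
    have "(\<Sum>q\<in>residues e N - {r}. y ^ q * h q) \<in> low n"
    proof (rule low_sum)
      fix q assume q: "q \<in> residues e N - {r}"
      then have hq: "h q \<in> low (n - q)" using other True by simp
      show "y ^ q * h q \<in> low n"
      proof (cases "q \<le> n")
        case qn: True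
        have "y ^ q \<in> low (Suc q)" using term_low[OF subringD(2)[OF S], of q "Suc q"] by simp
        then show ?thesis using low_mult[OF _ hq] qn by fastforce
      next
        case False
        then show ?thesis using hq low_0 low_simps(1) by simp
      qed
    qed
    moreover have "y ^ r * h r = 0 - (\<Sum>q\<in>residues e N - {r}. y ^ q * h q)"
      using assms(2) sum.remove[OF finite_residues r, of "\<lambda>q. y ^ q * h q"] by (simp add: eq_neg_iff_add_eq_0)
    ultimately have "y ^ r * h r \<in> low n" by (simp only: low_diff low_simps(1))
    then have "(a ^^ r) c = 0" using ld_zero[OF l] by simp
    then have "c = 0" using apow_eq_zero c unfolding ld_def by blast
    then show ?thesis using c ld_0_low by simp
  qed (use other r in blast)
  then show ?case using Suc.IH Suc.prems by blast
qed

lemma Hd_unique: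
  assumes "\<forall>r\<in>residues e N. h r \<in> Hd e" "(\<Sum>r\<in>residues e N. y ^ r * h r) = 0" "r \<in> residues e N"
  shows "h r = 0"
proof -
  have "\<forall>r\<in>residues e N. \<exists>m. h r \<in> low m" using assms(1) T_low unfolding Hd_def by blast
  then obtain m where m: "\<forall>r\<in>residues e N. h r \<in> low (m r)" by (rule bchoice[THEN exE])
  define n where "n = Max (insert 0 (m ` residues e N)) + N"
  have "h q \<in> low (n - q)" if q: "q \<in> residues e N" for q
  proof -
    have "m q \<le> Max (insert 0 (m ` residues e N))" using finite_residues q by simp
    moreover have "q < N" using q unfolding residues_def by simp
    ultimately have "m q \<le> n - q" unfolding n_def by simp
    then show ?thesis using low_mono m q by blast
  qed
  then show ?thesis using Hd_unique_low[of e N h n] assms by blast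
qed

text \<open>The decomposition over residues is direct and right multiplication by \<open>G\<close>
  respects it. Hence the equations hold at every residue separately, and a residue at which the
  inequation survives gives a solution in \<open>Hd e\<close>.\<close>

lemma T_to_Hd:
  fixes X :: "'b set"
  assumes G: "\<forall>h\<in>Hd e. \<forall>g\<in>G. h * g \<in> Hd e" and X: "finite X"
    and C: "\<forall>f\<in>C. \<forall>i\<in>X. f i \<in> G" and v: "\<forall>i\<in>X. v i \<in> G" and t: "\<forall>i\<in>X. t i \<in> T"
    and t0: "\<forall>f\<in>C. (\<Sum>i\<in>X. t i * f i) = 0" and t1: "(\<Sum>i\<in>X. t i * v i) \<noteq> 0"
  shows "\<exists>h. (\<forall>i\<in>X. h i \<in> Hd e) \<and> (\<forall>f\<in>C. (\<Sum>i\<in>X. h i * f i) = 0) \<and> (\<Sum>i\<in>X. h i * v i) \<noteq> 0"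
proof -
  have "\<forall>i\<in>X. \<exists>m. t i \<in> low m" using t T_low by blast
  then obtain m where m: "\<forall>i\<in>X. t i \<in> low (m i)" by (rule bchoice[THEN exE])
  define N where "N = Max (insert 0 (m ` X))"
  have "\<forall>i\<in>X. \<exists>h. (\<forall>r. h r \<in> Hd e) \<and> t i = (\<Sum>r\<in>residues e N. y ^ r * h r)"
  proof
    fix i assume i: "i \<in> X"
    have "m i \<le> N" unfolding N_def using X i by simp
    then show "\<exists>h. (\<forall>r. h r \<in> Hd e) \<and> t i = (\<Sum>r\<in>residues e N. y ^ r * h r)"
      using Hd_decompose m i by blast
  qed
  then obtain h where h: "\<forall>i\<in>X. (\<forall>r. h i r \<in> Hd e) \<and> t i = (\<Sum>r\<in>residues e N. y ^ r * h i r)"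
    by (rule bchoice[THEN exE])
  have sums: "(\<Sum>i\<in>X. t i * f i) = (\<Sum>r\<in>residues e N. y ^ r * (\<Sum>i\<in>X. h i r * f i))" for f
  proof -
    have "(\<Sum>i\<in>X. t i * f i) = (\<Sum>i\<in>X. \<Sum>r\<in>residues e N. y ^ r * (h i r * f i))"
      by (rule sum.cong) (use h in \<open>auto simp: sum_distrib_right mult.assoc\<close>)
    also have "\<dots> = (\<Sum>r\<in>residues e N. \<Sum>i\<in>X. y ^ r * (h i r * f i))" by (rule sum.swap)
    finally show ?thesis by (simp add: sum_distrib_left)
  qed
  obtain r where r: "r \<in> residues e N" "y ^ r * (\<Sum>i\<in>X. h i r * v i) \<noteq> 0"
    using t1 unfolding sums by (meson sum.not_neutral_contains_not_neutral)
  have "(\<Sum>i\<in>X. h i r * f i) = 0" if f: "f \<in> C" for f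
  proof (rule Hd_unique[where h="\<lambda>r. \<Sum>i\<in>X. h i r * f i", OF _ _ r(1)])
    show "\<forall>r\<in>residues e N. (\<Sum>i\<in>X. h i r * f i) \<in> Hd e"
      using h C f G by (intro ballI submod_sum[OF Hd_submod]) blast
    show "(\<Sum>r\<in>residues e N. y ^ r * (\<Sum>i\<in>X. h i r * f i)) = 0" using t0 f unfolding sums by blast
  qed
  moreover have "(\<Sum>i\<in>X. h i r * v i) \<noteq> 0" using r(2) by auto
  ultimately show ?thesis using h by (intro exI[of _ "\<lambda>i. h i r"]) blast
qed

lemma lin_closed_ore: "lin_closed S T"
proof (rule lin_closedI[OF ST])
  fix X :: "nat set" and C v b
  assume h: "finite X" "finite C" "\<forall>f\<in>C. \<forall>i\<in>X. f i \<in> S" "\<forall>i\<in>X. v i \<in> S"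
    "\<forall>i\<in>X. b i \<in> T" "\<forall>f\<in>C. (\<Sum>i\<in>X. b i * f i) = 0" "(\<Sum>i\<in>X. b i * v i) \<noteq> 0"
  show "\<exists>a. (\<forall>i\<in>X. a i \<in> S) \<and> (\<forall>f\<in>C. (\<Sum>i\<in>X. a i * f i) = 0) \<and> (\<Sum>i\<in>X. a i * v i) \<noteq> 0"
    using T_to_Hd[of 0 S, unfolded Hd_zero, OF _ h(1,3-7)] subringD(5)[OF S] by blast
qed

end

section \<open>Special subextensions\<close>

locale special_ext = ore S T y a d
  for S T :: "'a::ring_1 set" and y :: 'a and a d :: "'a \<Rightarrow> 'a" +
  fixes R A :: "'a set" and B :: "nat \<Rightarrow> 'a set" and n :: nat
  assumes special: "special R S y T A B" and ns: "nonsing S" and bd: "udim_le S {0} S n"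
begin

definition D :: nat where "D = dA S y A"

lemma A: "is_subring A"
  using special unfolding special_def by (elim conjE)

lemma AT: "A \<subseteq> T"
  using special unfolding special_def by (elim conjE)

lemma B0: "B 0 = A \<inter> S"
  using special unfolding special_def by (elim conjE)

lemma Deg_eq: "Deg S y A = {D * k | k. True}"
  using special unfolding special_def D_def by (elim conjE)

section \<open>Degrees and homogeneous components in a special subextension\<close>

lemma ore_deg_ld:
  assumes "ld f m c" "c \<noteq> 0"
  shows "ore_deg S y f = m"
  unfolding ore_deg_def
proof (rule Least_equality)
  have "f \<in> low (Suc m)" using assms low_Suc_iff by blast
  then obtain e where "\<forall>i. e i \<in> S" "f = (\<Sum>i<Suc m. e i * y ^ i)" unfolding low_def by blast
  then show "\<exists>c. (\<forall>i\<le>m. c i \<in> S) \<and> f = (\<Sum>i\<le>m. c i * y ^ i)"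
    unfolding lessThan_Suc_atMost by (intro exI[of _ e]) simp
next
  fix k assume "\<exists>c. (\<forall>i\<le>k. c i \<in> S) \<and> f = (\<Sum>i\<le>k. c i * y ^ i)"
  then obtain e where "\<forall>i\<le>k. e i \<in> S" "f = (\<Sum>i\<le>k. e i * y ^ i)" by blast
  then have f: "f \<in> low (Suc k)" using lowI[of "Suc k" e] by (simp add: lessThan_Suc_atMost)
  show "m \<le> k"
  proof (rule ccontr)
    assume "\<not> m \<le> k"
    then have "f \<in> low m" using low_mono[OF _ f, of m] by simp
    then show False using ld_zero assms by blast
  qed
qed

lemma low_ore_deg:
  assumes "f \<in> T" "ore_deg S y f < m"
  shows "f \<in> low m"
proof -
  obtain k where "f \<in> low k" using T_low[OF assms(1)] by blast
  then have "f \<in> low (Suc k)" using low_mono[of k "Suc k"] by simp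
  then obtain e where "\<forall>i. e i \<in> S" "f = (\<Sum>i<Suc k. e i * y ^ i)" unfolding low_def by blast
  then have "\<exists>c. (\<forall>i\<le>k. c i \<in> S) \<and> f = (\<Sum>i\<le>k. c i * y ^ i)"
    unfolding lessThan_Suc_atMost by (intro exI[of _ e]) simp
  then have "\<exists>n c. (\<forall>i\<le>n. c i \<in> S) \<and> f = (\<Sum>i\<le>n. c i * y ^ i)" by blast
  then have "\<exists>c. (\<forall>i\<le>ore_deg S y f. c i \<in> S) \<and> f = (\<Sum>i\<le>ore_deg S y f. c i * y ^ i)"
    unfolding ore_deg_def by (rule LeastI_ex)
  then obtain e where "\<forall>i\<le>ore_deg S y f. e i \<in> S" "f = (\<Sum>i\<le>ore_deg S y f. e i * y ^ i)" by blast
  then have "f \<in> low (Suc (ore_deg S y f))" using lowI[of "Suc (ore_deg S y f)" e] by (simp add: lessThan_Suc_atMost)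
  then show ?thesis using low_mono assms(2) by (metis Suc_leI)
qed

lemma term_A_dvd:
  assumes "c \<in> S" "c * y ^ i \<in> A" "c \<noteq> 0"
  shows "D dvd i"
proof -
  have l: "ld (c * y ^ i) i c" using ld_term[OF assms(1)] .
  have "i \<in> Deg S y A"
    unfolding Deg_def using ore_deg_ld[OF l assms(3)] ld_nonzero[OF l assms(3)] assms(2)
    by (intro CollectI exI[of _ "c * y ^ i"]) simp
  then show ?thesis unfolding Deg_eq by auto
qed

lemma cf_A: "f \<in> A \<Longrightarrow> cf f i * y ^ i \<in> A"
proof -
  assume f: "f \<in> A"
  have "\<forall>f\<in>A. \<exists>n c. (\<forall>i\<le>n. c i \<in> S \<and> c i * y ^ i \<in> A) \<and> f = (\<Sum>i\<le>n. c i * y ^ i)"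
    using special unfolding special_def by (elim conjE)
  then obtain n c where c: "\<forall>i\<le>n. c i \<in> S \<and> c i * y ^ i \<in> A" "f = (\<Sum>i\<le>n. c i * y ^ i)"
    using f by blast
  define e where "e i = (if i \<le> n then c i else 0)" for i
  have e: "e i \<in> S" "e i * y ^ i \<in> A" "i \<ge> Suc n \<Longrightarrow> e i = 0" for i
    using c(1) subringD(1)[OF S] subringD(1)[OF A] by (auto simp: e_def)
  have "f = (\<Sum>i<Suc n. e i * y ^ i)"
    unfolding c(2) lessThan_Suc_atMost by (rule sum.cong) (auto simp: e_def)
  then have "coeff_of f e" unfolding coeff_of_def using e(1,3) by blast
  then show ?thesis using cf_eq e(2) by simp
qed

lemma cf_A_dvd: "f \<in> A \<Longrightarrow> cf f i \<noteq> 0 \<Longrightarrow> D dvd i"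
  using term_A_dvd[OF cf_S cf_A] AT by blast

lemma A_Hd: "A \<subseteq> Hd D"
  unfolding Hd_def using AT cf_A_dvd by blast

text \<open>The condition on degrees is restated with \<open>low m\<close> so that it also makes sense for \<open>m = 0\<close>, where it
  holds with \<open>\<upsilon> = 1\<close> and the identity automorphism.\<close>
definition attached :: "nat \<Rightarrow> 'a \<Rightarrow> ('a \<Rightarrow> 'a) \<Rightarrow> bool" where
  "attached m \<upsilon> am \<longleftrightarrow> regular_in S \<upsilon> \<and> \<upsilon> * y ^ m \<in> A \<and>
     is_subring (B m) \<and> B m \<subseteq> A \<inter> S \<and> ring_aut (B m) am \<and>
     (\<forall>p\<in>B m. \<upsilon> * y ^ m * p - am p * (\<upsilon> * y ^ m) \<in> low m) \<and>
     (\<forall>q\<in>S. q * y ^ m \<in> A \<longrightarrow> (\<exists>u\<in>B m. regular_in S u \<and> (\<exists>b\<in>B m. u * q = b * \<upsilon>)))"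

lemma attached_ex:
  assumes "D dvd m"
  shows "\<exists>\<upsilon> am. attached m \<upsilon> am"
proof (cases "m = 0")
  case True
  have 1: "regular_in S 1" unfolding regular_in_def using subringD(2)[OF S] by simp
  have 2: "is_subring (A \<inter> S)" using A S unfolding is_subring_def by auto
  have 3: "ring_aut (A \<inter> S) id" unfolding ring_aut_def by simp
  have "attached m 1 id"
    unfolding attached_def True B0 using 1 2 3 subringD(2)[OF A] subringD(2)[OF 2] low_0 by auto
  then show ?thesis by blast
next
  case False
  have m: "m \<in> Deg S y A" unfolding Deg_eq using assms by (auto elim: dvdE)
  have "\<forall>m\<in>Deg S y A. m \<noteq> 0 \<longrightarrow>
        (\<exists>\<upsilon> am. regular_in S \<upsilon> \<and> \<upsilon> * y ^ m \<in> A \<and>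
           is_subring (B m) \<and> R \<subseteq> B m \<and> B m \<subseteq> A \<inter> S \<and> ring_aut (B m) am \<and>
           (\<forall>p\<in>B m. ore_deg S y (\<upsilon> * y ^ m * p - am p * (\<upsilon> * y ^ m)) < m) \<and>
           (\<forall>q\<in>S. q * y ^ m \<in> A \<longrightarrow>
              (\<exists>u\<in>B m. regular_in S u \<and> (\<exists>b\<in>B m. u * q * y ^ m = b * (\<upsilon> * y ^ m)))))"
    using special unfolding special_def by (elim conjE)
  then obtain \<upsilon> am where u: "regular_in S \<upsilon>" "\<upsilon> * y ^ m \<in> A" "is_subring (B m)" "B m \<subseteq> A \<inter> S" "ring_aut (B m) am"
    and dg: "\<forall>p\<in>B m. ore_deg S y (\<upsilon> * y ^ m * p - am p * (\<upsilon> * y ^ m)) < m"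
    and q: "\<forall>q\<in>S. q * y ^ m \<in> A \<longrightarrow>
              (\<exists>u\<in>B m. regular_in S u \<and> (\<exists>b\<in>B m. u * q * y ^ m = b * (\<upsilon> * y ^ m)))"
    using m False by blast
  have "\<upsilon> * y ^ m * p - am p * (\<upsilon> * y ^ m) \<in> low m" if p: "p \<in> B m" for p
  proof (rule low_ore_deg)
    have "am p \<in> B m" using u(5) p unfolding ring_aut_def bij_betw_def by blast
    then have "p \<in> A" "am p \<in> A" using u(4) p by auto
    then show "\<upsilon> * y ^ m * p - am p * (\<upsilon> * y ^ m) \<in> T" using u(2) subringD(4,5)[OF A] AT by blast
  qed (use dg p in blast)
  moreover have "\<exists>u\<in>B m. regular_in S u \<and> (\<exists>b\<in>B m. u * q = b * \<upsilon>)" if qS: "q \<in> S" "q * y ^ m \<in> A" for q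
  proof -
    obtain u' b where ub: "u' \<in> B m" "regular_in S u'" "b \<in> B m" "u' * q * y ^ m = b * (\<upsilon> * y ^ m)"
      using q qS by blast
    have S2: "u' * q \<in> S" "b * \<upsilon> \<in> S"
      using ub u(4) qS(1) regular_inD(1)[OF u(1)] subringD(5)[OF S] by blast+
    have "ld ((u' * q) * y ^ m) m (u' * q)" using ld_term[OF S2(1)] .
    moreover have "ld ((u' * q) * y ^ m) m (b * \<upsilon>)" using ld_term[OF S2(2), of m] ub(4) by (simp add: mult.assoc)
    ultimately have "u' * q = b * \<upsilon>" by (rule ld_unique)
    then show ?thesis using ub by blast
  qed
  ultimately have "attached m \<upsilon> am" unfolding attached_def using u by blast
  then show ?thesis by blast
qed

definition ups :: "nat \<Rightarrow> 'a" where "ups m = (SOME \<upsilon>. \<exists>am. attached m \<upsilon> am)"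
definition aut_at :: "nat \<Rightarrow> 'a \<Rightarrow> 'a" where "aut_at m = (SOME am. attached m (ups m) am)"

lemma attached: "D dvd m \<Longrightarrow> attached m (ups m) (aut_at m)"
proof -
  assume "D dvd m"
  then have "\<exists>am. attached m (ups m) am" unfolding ups_def by (rule someI_ex[OF attached_ex])
  then show ?thesis unfolding aut_at_def by (rule someI_ex)
qed

lemma attachedD:
  assumes "D dvd m"
  shows "regular_in S (ups m)" "ups m * y ^ m \<in> A" "is_subring (B m)" "B m \<subseteq> A \<inter> S" "ring_aut (B m) (aut_at m)"
    "p \<in> B m \<Longrightarrow> ups m * y ^ m * p - aut_at m p * (ups m * y ^ m) \<in> low m"
    "q \<in> S \<Longrightarrow> q * y ^ m \<in> A \<Longrightarrow> \<exists>u\<in>B m. regular_in S u \<and> (\<exists>b\<in>B m. u * q = b * ups m)"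
  using attached[OF assms] unfolding attached_def by blast+

text \<open>The regular multipliers from the attached rings are accumulated on the left, which
  preserves the factorizations through \<open>ups\<close> already obtained. All of them lie in
  \<open>A \<inter> S\<close>, so one \<open>u\<close> serves for coefficients in different
  degrees.\<close>

lemma A_denominator:
  assumes "finite P" "\<forall>p\<in>P. fst p \<in> S \<and> fst p * y ^ snd p \<in> A \<and> D dvd snd p"
  shows "\<exists>u\<in>A \<inter> S. regular_in S u \<and> (\<forall>p\<in>P. \<exists>b\<in>A \<inter> S. u * fst p = b * ups (snd p))"
  using assms
proof (induction P rule: finite_induct)
  case empty
  have "regular_in S 1" unfolding regular_in_def using subringD(2)[OF S] by simp
  then show ?case using subringD(2)[OF S] subringD(2)[OF A] by blast
next
  case (insert p P)
  then obtain u where u: "u \<in> A" "u \<in> S" "regular_in S u" "\<forall>p\<in>P. \<exists>b\<in>A \<inter> S. u * fst p = b * ups (snd p)"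
    by blast
  have p: "fst p \<in> S" "fst p * y ^ snd p \<in> A" "D dvd snd p" using insert.prems by auto
  have up: "u * fst p \<in> S" using subringD(5)[OF S u(2) p(1)] .
  have "u * (fst p * y ^ snd p) \<in> A" using subringD(5)[OF A u(1) p(2)] .
  then have "u * fst p * y ^ snd p \<in> A" by (simp add: mult.assoc)
  then obtain u' b where u': "u' \<in> B (snd p)" "regular_in S u'" "b \<in> B (snd p)" "u' * (u * fst p) = b * ups (snd p)"
    using attachedD(7)[OF p(3) up] by blast
  have u'A: "u' \<in> A" "u' \<in> S" "b \<in> A" "b \<in> S" using u' attachedD(4)[OF p(3)] by auto
  have "\<exists>b\<in>A \<inter> S. u' * u * fst q = b * ups (snd q)" if q: "q \<in> insert p P" for q
  proof (cases "q = p")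
    case True
    then show ?thesis using u'(4) u'A by (metis IntI mult.assoc)
  next
    case False
    then obtain b' where b': "b' \<in> A" "b' \<in> S" "u * fst q = b' * ups (snd q)" using u(4) q by blast
    have "u' * u * fst q = (u' * b') * ups (snd q)" using b'(3) by (simp add: mult.assoc)
    moreover have "u' * b' \<in> A \<inter> S" using subringD(5)[OF S u'A(2) b'(2)] subringD(5)[OF A u'A(1) b'(1)] by blast
    ultimately show ?thesis by blast
  qed
  moreover have "u' * u \<in> A \<inter> S" using subringD(5)[OF S u'A(2) u(2)] subringD(5)[OF A u'A(1) u(1)] by blast
  ultimately show ?case using regular_in_mult[OF S u'(2) u(3)] by blast
qed

lemma clear_T:
  assumes "finite P" "\<forall>p\<in>P. fst p \<in> S \<and> regular_in S (snd p)" and w: "w \<in> T" "w \<noteq> 0"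
  obtains c where "c \<in> S" "c * w \<noteq> 0" "\<forall>p\<in>P. \<exists>z\<in>S. c * fst p = z * snd p"
proof -
  obtain i where i: "cf w i \<noteq> 0" using cf_nonzero[OF w] by blast
  obtain c where c: "c \<in> S" "c * cf w i \<noteq> 0" "\<forall>p\<in>P. \<exists>z\<in>S. c * fst p = z * snd p"
    using common_denominator[OF S ns bd assms(1,2) cf_S[OF w(1)] i] by blast
  have "c * w \<noteq> 0" using c(2) cf_smult[OF c(1) w(1), of i] cf_zero by auto
  then show ?thesis using that c by blast
qed

text \<open>Moving \<open>y ^ m\<close> past \<open>f\<close> could create terms in degrees not
  divisible by \<open>D\<close>. A multiplier \<open>c\<close> turns \<open>s * y ^ m\<close> into a
  multiple of \<open>ups m * y ^ m\<close>, whose product with \<open>f\<close> stays in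
  \<open>A\<close>; since \<open>c\<close> keeps the coefficient at \<open>i\<close> non-zero, a bad
  degree \<open>i\<close> is excluded.\<close>

lemma Hd_mult_A:
  assumes h: "h \<in> Hd D" and f: "f \<in> A"
  shows "h * f \<in> Hd D"
proof -
  have monomial: "s * y ^ m * f \<in> Hd D" if s: "s \<in> S" "D dvd m" for s m
  proof -
    let ?g = "s * y ^ m * f"
    have gT: "?g \<in> T" using s(1) f AT ST subringD(5)[OF T] subring_pow[OF T yT] by blast
    have "D dvd i" if i: "cf ?g i \<noteq> 0" for i
    proof -
      have "\<exists>c\<in>S. c * cf ?g i \<noteq> 0 \<and> (\<forall>p\<in>{(s, ups m)}. \<exists>z\<in>S. c * fst p = z * snd p)"
        by (rule common_denominator[OF S ns bd _ _ cf_S[OF gT] i]) (use s attachedD(1)[OF s(2)] in auto)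
      then obtain c z where cz: "c \<in> S" "c * cf ?g i \<noteq> 0" "z \<in> S" "c * s = z * ups m" by auto
      have "c * ?g = z * (ups m * y ^ m * f)" using cz(4) by (metis mult.assoc)
      moreover have "ups m * y ^ m * f \<in> Hd D" using subringD(5)[OF A attachedD(2)[OF s(2)] f] A_Hd by blast
      ultimately have "c * ?g \<in> Hd D" using submodD(3)[OF Hd_submod cz(3)] by simp
      moreover have "cf (c * ?g) i \<noteq> 0" using cz(2) cf_smult[OF cz(1) gT] by simp
      ultimately show ?thesis unfolding Hd_def by blast
    qed
    then show ?thesis unfolding Hd_def using gT by blast
  qed
  have hT: "h \<in> T" using h unfolding Hd_def by blast
  obtain k where k: "\<forall>n\<ge>k. h = (\<Sum>i<n. cf h i * y ^ i)" using cf_rep[OF hT] by blast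
  have "h * f = (\<Sum>i<k. cf h i * y ^ i * f)"
    unfolding sum_distrib_right[symmetric] using k by simp
  also have "\<dots> \<in> Hd D"
  proof (rule submod_sum[OF Hd_submod])
    fix i
    show "cf h i * y ^ i * f \<in> Hd D"
    proof (cases "cf h i = 0")
      case True
      then show ?thesis using submodD(1)[OF Hd_submod] by simp
    next
      case False
      then have "D dvd i" using h unfolding Hd_def by blast
      then show ?thesis using monomial cf_S[OF hT] by blast
    qed
  qed
  finally show ?thesis .
qed

text \<open>After left multiplication by a common regular \<open>u\<close>, all coefficients of the system lie in
  \<open>(A \<inter> S) ups j\<close> in degree \<open>j\<close>, which reduces it to a system over \<open>A \<inter> S\<close>.\<close>
lemma S_to_base:
  fixes X :: "'b set"
  assumes lc: "lin_closed (A \<inter> S) S" and X: "finite X" and C: "finite C"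
    and f: "\<forall>f\<in>C. \<forall>i\<in>X. f i \<in> A" and v: "\<forall>i\<in>X. v i \<in> A" and z: "\<forall>i\<in>X. z i \<in> S"
    and z0: "\<forall>f\<in>C. (\<Sum>i\<in>X. z i * f i) = 0" and z1: "(\<Sum>i\<in>X. z i * v i) \<noteq> 0"
  shows "\<exists>b. (\<forall>i\<in>X. b i \<in> A \<inter> S) \<and> (\<forall>f\<in>C. (\<Sum>i\<in>X. b i * f i) = 0) \<and> (\<Sum>i\<in>X. b i * v i) \<noteq> 0"
proof -
  define G where "G = (\<Union>f\<in>insert v C. f ` X)"
  have GA: "g \<in> A" "g \<in> T" if "g \<in> G" for g using that f v AT unfolding G_def by auto
  have finG: "finite G" unfolding G_def using X C by blast
  have inG: "f i \<in> G" if "f \<in> insert v C" "i \<in> X" for f i using that unfolding G_def by blast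
  have "\<forall>g\<in>G. \<exists>m. \<forall>i\<ge>m. cf g i = 0" using cf_rep GA(2) by metis
  then obtain m where m: "\<forall>g\<in>G. \<forall>i\<ge>m g. cf g i = 0" by (rule bchoice[THEN exE])
  define N where "N = Max (insert 0 (m ` G))"
  have cN: "cf g i = 0" if "g \<in> G" "i \<ge> N" for g i
  proof -
    have "m g \<le> N" unfolding N_def using finG that(1) by simp
    then show ?thesis using m that by auto
  qed
  define P where "P = (\<lambda>(g, i). (cf g i, i)) ` (G \<times> {i. i < N \<and> D dvd i})"
  have "finite P" unfolding P_def using finG by simp
  moreover have "\<forall>p\<in>P. fst p \<in> S \<and> fst p * y ^ snd p \<in> A \<and> D dvd snd p"
    unfolding P_def using GA cf_A cf_S by auto
  ultimately have "\<exists>u\<in>A \<inter> S. regular_in S u \<and> (\<forall>p\<in>P. \<exists>b\<in>A \<inter> S. u * fst p = b * ups (snd p))"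
    by (rule A_denominator)
  then obtain u where u: "u \<in> A \<inter> S" "regular_in S u" "\<forall>p\<in>P. \<exists>b\<in>A \<inter> S. u * fst p = b * ups (snd p)"
    by blast
  define \<beta> where "\<beta> g i = (SOME b. b \<in> A \<inter> S \<and> u * cf g i = b * ups i)" for g i
  have \<beta>: "\<beta> g i \<in> A \<inter> S \<and> u * cf g i = \<beta> g i * ups i" if g: "g \<in> G" for g i
  proof -
    have "\<exists>b. b \<in> A \<inter> S \<and> u * cf g i = b * ups i"
    proof (cases "cf g i = 0")
      case True
      then show ?thesis using subringD(1)[OF S] subringD(1)[OF A] by (intro exI[of _ 0]) simp
    next
      case False
      then have "(cf g i, i) \<in> P" unfolding P_def using g cN[OF g, of i] cf_A_dvd[OF GA(1)[OF g]]
        by (force simp: not_le[symmetric])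
      then show ?thesis using u(3) by force
    qed
    then show ?thesis unfolding \<beta>_def by (rule someI_ex)
  qed
  have vT: "(\<Sum>i\<in>X. z i * v i) \<in> T"
    by (rule subring_sum[OF T]) (use z v AT ST subringD(5)[OF T] in blast)
  have "\<forall>p\<in>(\<lambda>i. (z i, u)) ` X. fst p \<in> S \<and> regular_in S (snd p)" using z u(2) by auto
  then obtain c where c: "c \<in> S" "c * (\<Sum>i\<in>X. z i * v i) \<noteq> 0" "\<forall>p\<in>(\<lambda>i. (z i, u)) ` X. \<exists>w\<in>S. c * fst p = w * snd p"
    using clear_T[OF finite_imageI[OF X] _ vT z1] by blast
  then have "\<forall>i\<in>X. \<exists>w. w \<in> S \<and> c * z i = w * u" by auto
  \<comment> \<open>The matrix is to be multiplied by \<open>u\<close> on the left, so the unknowns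
    have to be divisible by \<open>u\<close> on the right; the quotients \<open>w i\<close> become
    the new unknowns.\<close>
  then obtain w where w: "\<forall>i\<in>X. w i \<in> S \<and> c * z i = w i * u" by (rule bchoice[THEN exE])
  \<comment> \<open>In degree \<open>j\<close> the sum carries the factor \<open>ups j\<close> on
    the right, which is regular when \<open>D dvd j\<close>. What remains is a linear form in
    \<open>e\<close> with coefficients from \<open>A \<inter> S\<close>.\<close>
  have key: "cf (\<Sum>i\<in>X. (e i * u) * g i) j = (\<Sum>i\<in>X. e i * \<beta> (g i) j) * ups j"
    if e: "\<forall>i\<in>X. e i \<in> S" and g: "g \<in> insert v C" for e g j
  proof -
    have "cf (\<Sum>i\<in>X. (e i * u) * g i) j = (\<Sum>i\<in>X. (e i * u) * cf (g i) j)"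
      by (rule cf_sum[OF X]) (use e u(1) GA(2) inG[OF g] subringD(5)[OF S] in blast)
    also have "\<dots> = (\<Sum>i\<in>X. e i * \<beta> (g i) j * ups j)"
      by (rule sum.cong) (use \<beta> inG[OF g] in \<open>auto simp: mult.assoc\<close>)
    finally show ?thesis by (simp add: sum_distrib_right)
  qed
  have wz: "(\<Sum>i\<in>X. (w i * u) * g i) = c * (\<Sum>i\<in>X. z i * g i)" for g
  proof -
    have "(\<Sum>i\<in>X. (w i * u) * g i) = (\<Sum>i\<in>X. c * z i * g i)" by (rule sum.cong) (use w in auto)
    then show ?thesis by (simp add: sum_distrib_left mult.assoc)
  qed
  have \<beta>S: "(\<Sum>i\<in>X. e i * \<beta> (g i) j) \<in> S" if "\<forall>i\<in>X. e i \<in> S" "g \<in> insert v C" for e g j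
    by (rule subring_sum[OF S]) (use that \<beta> inG subringD(5)[OF S] in blast)
  have wS: "\<forall>i\<in>X. w i \<in> S" using w by blast
  \<comment> \<open>Each equation splits into one equation per degree, whereas the inequation is
    kept in a single degree \<open>j\<close> only. Outside the listed degrees all coefficients of
    the equations vanish.\<close>
  define C' where "C' = (\<lambda>(g, j). \<lambda>i. \<beta> (g i) j) ` (C \<times> {j. j < N \<and> D dvd j})"
  have "c * (\<Sum>i\<in>X. z i * v i) \<in> T" using c(1) vT ST subringD(5)[OF T] by blast
  then obtain j where j: "cf (\<Sum>i\<in>X. (w i * u) * v i) j \<noteq> 0" using cf_nonzero c(2) unfolding wz by blast
  have "\<exists>b. (\<forall>i\<in>X. b i \<in> A \<inter> S) \<and> (\<forall>g\<in>C'. (\<Sum>i\<in>X. b i * g i) = 0) \<and> (\<Sum>i\<in>X. b i * \<beta> (v i) j) \<noteq> 0"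
  proof (rule lin_closedE[OF lc X, of C' "\<lambda>i. \<beta> (v i) j" w])
    show "finite C'" unfolding C'_def using C by simp
    show "\<forall>g\<in>C'. \<forall>i\<in>X. g i \<in> A \<inter> S" unfolding C'_def using \<beta> inG by auto
    show "\<forall>i\<in>X. \<beta> (v i) j \<in> A \<inter> S" using \<beta> inG by blast
    show "\<forall>i\<in>X. w i \<in> S" by (rule wS)
    show "(\<Sum>i\<in>X. w i * \<beta> (v i) j) \<noteq> 0" using j key[OF wS, of v j] by auto
    show "\<forall>g\<in>C'. (\<Sum>i\<in>X. w i * g i) = 0"
    proof
      fix h assume "h \<in> C'"
      then obtain g k where g: "g \<in> C" "D dvd k" "h = (\<lambda>i. \<beta> (g i) k)" unfolding C'_def by auto
      have "(\<Sum>i\<in>X. (w i * u) * g i) = 0" using z0 g(1) unfolding wz by simp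
      then have "(\<Sum>i\<in>X. w i * \<beta> (g i) k) * ups k = 0" using key[OF wS, of g k] g(1) cf_zero by simp
      then have "(\<Sum>i\<in>X. w i * \<beta> (g i) k) = 0"
        using regular_inD(2)[OF attachedD(1)[OF g(2)]] \<beta>S[OF wS, of g k] g(1) by blast
      then show "(\<Sum>i\<in>X. w i * h i) = 0" unfolding g(3) .
    qed
  qed blast
  then obtain b where b: "\<forall>i\<in>X. b i \<in> A \<inter> S" "\<forall>g\<in>C'. (\<Sum>i\<in>X. b i * g i) = 0" "(\<Sum>i\<in>X. b i * \<beta> (v i) j) \<noteq> 0"
    by blast
  have bS: "\<forall>i\<in>X. b i \<in> S" using b(1) by blast
  have buS: "b i * u \<in> S" if "i \<in> X" for i
    using subringD(5)[OF S] bS u(1) that by simp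
  have buT: "(\<Sum>i\<in>X. (b i * u) * g i) \<in> T" if "g \<in> insert v C" for g
    by (rule subring_sum[OF T], rule subringD(5)[OF T]) (use buS ST GA(2) inG[OF that] in auto)
  have "(\<Sum>i\<in>X. (b i * u) * g i) = 0" if g: "g \<in> C" for g
  proof (rule ccontr)
    assume "(\<Sum>i\<in>X. (b i * u) * g i) \<noteq> 0"
    then obtain k where k: "cf (\<Sum>i\<in>X. (b i * u) * g i) k \<noteq> 0" using cf_nonzero buT[of g] g by blast
    have ins: "g \<in> insert v C" using g by blast
    have kk: "k < N \<and> D dvd k"
    proof (rule ccontr)
      assume nk: "\<not> (k < N \<and> D dvd k)"
      have "cf (g i) k = 0" if i: "i \<in> X" for i
        using nk cN[OF inG[OF ins i], of k] cf_A_dvd[OF GA(1)[OF inG[OF ins i]], of k] by fastforce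
      moreover have "cf (\<Sum>i\<in>X. (b i * u) * g i) k = (\<Sum>i\<in>X. (b i * u) * cf (g i) k)"
        by (rule cf_sum[OF X]) (use buS GA(2) inG[OF ins] in simp)
      ultimately show False using k by simp
    qed
    then have "(\<lambda>i. \<beta> (g i) k) \<in> C'" unfolding C'_def using g by force
    from bspec[OF b(2) this] have "(\<Sum>i\<in>X. b i * \<beta> (g i) k) = 0" .
    then show False using k key[OF bS ins, of k] by simp
  qed
  moreover have "(\<Sum>i\<in>X. (b i * u) * v i) \<noteq> 0"
  proof
    assume z: "(\<Sum>i\<in>X. (b i * u) * v i) = 0"
    have "D dvd j"
    proof (rule ccontr)
      assume nk: "\<not> D dvd j"
      have "cf (v i) j = 0" if i: "i \<in> X" for i
        using nk cf_A_dvd[of "v i" j] v i by blast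
      moreover have "cf (\<Sum>i\<in>X. (w i * u) * v i) j = (\<Sum>i\<in>X. (w i * u) * cf (v i) j)"
        by (rule cf_sum[OF X]) (use wS u(1) v AT subringD(5)[OF S] in blast)
      ultimately show False using j by simp
    qed
    moreover have "(\<Sum>i\<in>X. b i * \<beta> (v i) j) * ups j = 0" using key[OF bS, of v j] z cf_zero by simp
    ultimately show False using regular_inD(2)[OF attachedD(1)] \<beta>S[OF bS, of v j] b(3) by blast
  qed
  moreover have "b i * u \<in> A \<inter> S" if "i \<in> X" for i
    using that b(1) u(1) subringD(5)[OF S] subringD(5)[OF A] by blast
  ultimately show ?thesis by (intro exI[of _ "\<lambda>i. b i * u"]) blast
qed

text \<open>Once the unknowns lie in \<open>Hd D\<close>, a left multiplier makes them combinations
  of the elements \<open>ups j * y ^ j\<close> of \<open>A\<close> with coefficients in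
  \<open>S\<close>. Absorbing these elements into the columns gives a system over \<open>A\<close>
  with unknowns in \<open>S\<close>, indexed by pairs.\<close>

lemma lin_closed_special:
  assumes lc: "lin_closed (A \<inter> S) S"
  shows "lin_closed A T"
proof (rule lin_closedI[OF AT])
  fix X :: "nat set" and C v t
  assume X: "finite X" and C: "finite C" and f: "\<forall>f\<in>C. \<forall>i\<in>X. f i \<in> A" and v: "\<forall>i\<in>X. v i \<in> A"
    and t: "\<forall>i\<in>X. t i \<in> T" and t0: "\<forall>f\<in>C. (\<Sum>i\<in>X. t i * f i) = 0" and t1: "(\<Sum>i\<in>X. t i * v i) \<noteq> 0"
  obtain h where h: "\<forall>i\<in>X. h i \<in> Hd D" "\<forall>f\<in>C. (\<Sum>i\<in>X. h i * f i) = 0" "(\<Sum>i\<in>X. h i * v i) \<noteq> 0"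
    using T_to_Hd[OF _ X f v t t0 t1, of D] Hd_mult_A by blast
  have hT: "h i \<in> T" if "i \<in> X" for i using h(1) that unfolding Hd_def by blast
  have "\<forall>i\<in>X. \<exists>m. \<forall>n\<ge>m. h i = (\<Sum>j<n. cf (h i) j * y ^ j)" using cf_rep hT by metis
  then obtain m where m: "\<forall>i\<in>X. \<forall>n\<ge>m i. h i = (\<Sum>j<n. cf (h i) j * y ^ j)" by (rule bchoice[THEN exE])
  define N where "N = Max (insert 0 (m ` X))"
  define Md where "Md = {j. j < N \<and> D dvd j}"
  have finM: "finite Md" unfolding Md_def by simp
  have hN: "h i = (\<Sum>j\<in>Md. cf (h i) j * y ^ j)" if i: "i \<in> X" for i
  proof -
    have "m i \<le> N" unfolding N_def using X i by simp
    then have "h i = (\<Sum>j<N. cf (h i) j * y ^ j)" using m i by blast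
    also have "\<dots> = (\<Sum>j\<in>Md. cf (h i) j * y ^ j)"
    proof (rule sum.mono_neutral_right)
      have "cf (h i) j = 0" if "\<not> D dvd j" for j using h(1) i that unfolding Hd_def by blast
      then show "\<forall>j\<in>{..<N} - Md. cf (h i) j * y ^ j = 0" unfolding Md_def by auto
    qed (auto simp: Md_def)
    finally show ?thesis .
  qed
  define P where "P = (\<lambda>(i, j). (cf (h i) j, ups j)) ` (X \<times> Md)"
  have "(\<Sum>i\<in>X. h i * v i) \<in> T"
    by (rule subring_sum[OF T]) (use hT v AT subringD(5)[OF T] in blast)
  moreover have "finite P" unfolding P_def using X finM by simp
  moreover have "\<forall>p\<in>P. fst p \<in> S \<and> regular_in S (snd p)"
    unfolding P_def Md_def using cf_S hT attachedD(1) by auto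
  ultimately obtain c where c: "c \<in> S" "c * (\<Sum>i\<in>X. h i * v i) \<noteq> 0" "\<forall>p\<in>P. \<exists>z\<in>S. c * fst p = z * snd p"
    using clear_T[of P "\<Sum>i\<in>X. h i * v i"] h(3) by blast
  have "\<forall>q\<in>X \<times> Md. \<exists>z. z \<in> S \<and> c * cf (h (fst q)) (snd q) = z * ups (snd q)"
    using c(3) unfolding P_def by force
  then obtain z where z: "\<forall>q\<in>X \<times> Md. z q \<in> S \<and> c * cf (h (fst q)) (snd q) = z q * ups (snd q)"
    by (rule bchoice[THEN exE])
  define L where "L g q = ups (snd q) * y ^ snd q * g (fst q)" for g :: "nat \<Rightarrow> 'a" and q
  have sums: "(\<Sum>q\<in>X \<times> Md. e q * L g q) = (\<Sum>i\<in>X. (\<Sum>j\<in>Md. e (i, j) * (ups j * y ^ j)) * g i)" for e g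
  proof -
    have "(\<Sum>q\<in>X \<times> Md. e q * L g q) = (\<Sum>i\<in>X. \<Sum>j\<in>Md. e (i, j) * L g (i, j))"
      by (simp add: sum.cartesian_product case_prod_unfold)
    then show ?thesis unfolding L_def by (simp add: sum_distrib_right mult.assoc)
  qed
  have zsum: "(\<Sum>q\<in>X \<times> Md. z q * L g q) = c * (\<Sum>i\<in>X. h i * g i)" for g
  proof -
    have "(\<Sum>j\<in>Md. z (i, j) * (ups j * y ^ j)) = c * h i" if i: "i \<in> X" for i
    proof -
      have "(\<Sum>j\<in>Md. z (i, j) * (ups j * y ^ j)) = (\<Sum>j\<in>Md. c * cf (h i) j * y ^ j)"
        by (rule sum.cong) (use z i in \<open>auto simp: mult.assoc[symmetric]\<close>)
      also have "\<dots> = c * (\<Sum>j\<in>Md. cf (h i) j * y ^ j)" by (simp add: sum_distrib_left mult.assoc)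
      finally show ?thesis using hN[OF i] by simp
    qed
    then have "(\<Sum>q\<in>X \<times> Md. z q * L g q) = (\<Sum>i\<in>X. c * h i * g i)"
      unfolding sums by (intro sum.cong) auto
    then show ?thesis by (simp add: sum_distrib_left mult.assoc)
  qed
  have LA: "L g q \<in> A" if "q \<in> X \<times> Md" "\<forall>i\<in>X. g i \<in> A" for g q
    using that attachedD(2) subringD(5)[OF A] unfolding L_def Md_def by auto
  have "\<exists>b. (\<forall>q\<in>X \<times> Md. b q \<in> A \<inter> S) \<and> (\<forall>g\<in>L ` C. (\<Sum>q\<in>X \<times> Md. b q * g q) = 0)
      \<and> (\<Sum>q\<in>X \<times> Md. b q * L v q) \<noteq> 0"
  proof (rule S_to_base[OF lc])
    show "finite (X \<times> Md)" "finite (L ` C)" using X finM C by auto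
    show "\<forall>g\<in>L ` C. \<forall>q\<in>X \<times> Md. g q \<in> A" using LA f by blast
    show "\<forall>q\<in>X \<times> Md. L v q \<in> A" using LA v by blast
    show "\<forall>q\<in>X \<times> Md. z q \<in> S" using z by blast
    show "\<forall>g\<in>L ` C. (\<Sum>q\<in>X \<times> Md. z q * g q) = 0" using zsum h(2) by auto
    show "(\<Sum>q\<in>X \<times> Md. z q * L v q) \<noteq> 0" using zsum[of v] c(2) by simp
  qed
  then obtain b where b: "\<forall>q\<in>X \<times> Md. b q \<in> A \<inter> S" "\<forall>g\<in>C. (\<Sum>q\<in>X \<times> Md. b q * L g q) = 0"
    "(\<Sum>q\<in>X \<times> Md. b q * L v q) \<noteq> 0" by blast
  \<comment> \<open>Undoes the absorption: with coefficients now from \<open>A \<inter> S\<close>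
    the combination lies in \<open>A\<close>.\<close>
  define a' where "a' i = (\<Sum>j\<in>Md. b (i, j) * (ups j * y ^ j))" for i
  have "a' i \<in> A" if i: "i \<in> X" for i
    unfolding a'_def
  proof (rule subring_sum[OF A])
    fix j assume j: "j \<in> Md"
    then have "ups j * y ^ j \<in> A" using attachedD(2) unfolding Md_def by blast
    moreover have "b (i, j) \<in> A" using b(1) i j by blast
    ultimately show "b (i, j) * (ups j * y ^ j) \<in> A" using subringD(5)[OF A] by blast
  qed
  moreover have "(\<Sum>i\<in>X. a' i * g i) = (\<Sum>q\<in>X \<times> Md. b q * L g q)" for g
    unfolding sums a'_def ..
  ultimately show "\<exists>a. (\<forall>i\<in>X. a i \<in> A) \<and> (\<forall>f\<in>C. (\<Sum>i\<in>X. a i * f i) = 0) \<and> (\<Sum>i\<in>X. a i * v i) \<noteq> 0"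
    using b(2,3) by (intro exI[of _ a']) simp
qed

end

section \<open>Primeness and semiprimeness\<close>

text \<open>The powers of the automorphism spread \<open>p\<close> over pairwise annihilating, hence independent,
  left ideals, of which there are only finitely many.\<close>
lemma semiprime_orbit:
  assumes B: "is_subring B" and sp: "elt_semiprime B" and am: "ring_aut B am" and bd: "udim_le B {0} B n"
    and p: "p \<in> B" and z: "\<And>i w. w \<in> B \<Longrightarrow> p * w * (am ^^ Suc i) p = 0"
  shows "p = 0"
proof (rule ccontr)
  assume p0: "p \<noteq> 0"
  define c where "c i = (am ^^ i) p" for i
  note au = ring_autD[OF B ring_aut_pow[OF B am]]
  note mB = subringD(5)[OF B]
  have c: "c i \<in> B" "c i \<noteq> 0" for i using au(1,4) p p0 unfolding c_def by blast+
  have lt: "c i * w * c j = 0" if ij: "i < j" and w: "w \<in> B" for i j w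
  proof -
    \<comment> \<open>Pulling back along \<open>am ^^ i\<close> reduces the pair of exponents to
      \<open>0\<close> and \<open>j - i\<close>, where the hypothesis applies.\<close>
    obtain w' where w': "w' \<in> B" "(am ^^ i) w' = w" using au(2)[OF w] by blast
    obtain k where k: "j = i + Suc k" using ij less_imp_Suc_add by fastforce
    have "c j = (am ^^ i) ((am ^^ Suc k) p)" unfolding c_def k by (simp only: funpow_add comp_apply)
    moreover have "(am ^^ Suc k) p \<in> B" using au(1)[OF p] .
    ultimately have "c i * w * c j = (am ^^ i) (p * w' * (am ^^ Suc k) p)"
      unfolding c_def[of i] w'(2)[symmetric] using au(5) p w'(1) mB by presburger
    then show ?thesis using z[OF w'(1), of k] au(3) by simp
  qed
  \<comment> \<open>This order of the exponents is not covered by the hypothesis, but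
    \<open>?t * q * ?t\<close> contains the factor \<open>c i * q * c j\<close>, so semiprimeness
    gives \<open>?t = 0\<close>.\<close>
  have gt: "c j * w * c i = 0" if ij: "i < j" and w: "w \<in> B" for i j w
  proof -
    let ?t = "c j * w * c i"
    have "?t * q * ?t = 0" if q: "q \<in> B" for q
    proof -
      have "?t * q * ?t = c j * w * (c i * q * c j) * (w * c i)" by (simp add: mult.assoc)
      then show ?thesis using lt[OF ij q] by simp
    qed
    moreover have "?t \<in> B" using c(1) w mB by simp
    ultimately show ?thesis using sp unfolding elt_semiprime_def by blast
  qed
  have orth: "c i * w * c j = 0" if "i \<noteq> j" "w \<in> B" for i j w
    using lt[of i j w] gt[of j i w] that by (cases "i < j") auto
  have "indep B {0} {..<Suc n} c"
  proof (rule indepI)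
    fix e k assume e: "\<And>i. i \<in> {..<Suc n} \<Longrightarrow> e i \<in> B" and s: "(\<Sum>i<Suc n. e i * c i) \<in> {0}" and k: "k \<in> {..<Suc n}"
    \<comment> \<open>Multiplying the relation by \<open>?t * q\<close> on the left leaves only the
      term at \<open>k\<close>, by orthogonality.\<close>
    let ?t = "e k * c k"
    have "?t * q * ?t = 0" if q: "q \<in> B" for q
    proof -
      have "0 = ?t * q * (\<Sum>i<Suc n. e i * c i)" using s by simp
      also have "\<dots> = (\<Sum>i<Suc n. e k * (c k * (q * e i) * c i))"
        by (simp only: sum_distrib_left mult.assoc)
      also have "\<dots> = (\<Sum>i\<in>{k}. e k * (c k * (q * e i) * c i))"
        by (rule sum.mono_neutral_right) (use k orth e mB[OF q] in auto)
      finally show ?thesis by (simp add: mult.assoc)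
    qed
    moreover have "?t \<in> B" using c(1) e k mB by blast
    ultimately show "?t \<in> {0}" using sp unfolding elt_semiprime_def by blast
  qed
  then have "indep_family B {0} B {..<Suc n} c" unfolding indep_family_def using c by auto
  from udim_leD[OF bd this] show False by simp
qed

context special_ext
begin

text \<open>The coefficient at \<open>y ^ m\<close> in the degree condition for
  \<open>ups m * y ^ m\<close>. It relates the twist by \<open>a\<close> on \<open>S\<close> to the
  automorphism of \<open>B m\<close>.\<close>

lemma ups_aut:
  assumes m: "D dvd m" and p: "p \<in> B m"
  shows "ups m * (a ^^ m) p = aut_at m p * ups m"
proof -
  have uS: "ups m \<in> S" using regular_inD(1)[OF attachedD(1)[OF m]] .
  have pS: "p \<in> S" "aut_at m p \<in> S"
    using p ring_autD(1)[OF attachedD(3,5)[OF m]] attachedD(4)[OF m] by blast+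
  have "ld (ups m * y ^ m * p) (m + 0) (ups m * (a ^^ m) p)"
    using ld_mult[OF ld_term[OF uS] ld_const[OF pS(1)]] .
  moreover have "ld (aut_at m p * (ups m * y ^ m)) m (aut_at m p * ups m)"
    using ld_smult[OF pS(2) ld_term[OF uS]] .
  ultimately have "ld (ups m * y ^ m * p - aut_at m p * (ups m * y ^ m)) m (ups m * (a ^^ m) p - aut_at m p * ups m)"
    using ld_diff by simp
  from ld_zero[OF this attachedD(6)[OF m p]] show ?thesis by simp
qed

text \<open>The attached data speak about monomials of \<open>A\<close> only; \<open>cf_A\<close>
  makes the leading monomial of \<open>f\<close> available, and regularity of the multiplier keeps
  its coefficient non-zero.\<close>

lemma lead_attached:
  assumes f: "f \<in> A" "ld f m q" "q \<noteq> 0"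
  shows "D dvd m" "\<exists>u\<in>A. \<exists>p\<in>B m. p \<noteq> 0 \<and> ld (u * f) m (p * ups m)"
proof -
  have q: "cf f m = q" using cf_ld[OF f(2)] .
  then have qA: "q * y ^ m \<in> A" and qS: "q \<in> S" using cf_A[OF f(1), of m] f(2) unfolding ld_def by auto
  show m: "D dvd m" using term_A_dvd[OF qS qA f(3)] .
  obtain u p where up: "u \<in> B m" "regular_in S u" "p \<in> B m" "u * q = p * ups m"
    using attachedD(7)[OF m qS qA] by blast
  have "u * q \<noteq> 0" using regular_inD(3)[OF up(2) qS] f(3) by blast
  then have "p \<noteq> 0" using up(4) by auto
  moreover have "ld (u * f) m (p * ups m)" using ld_smult[OF regular_inD(1)[OF up(2)] f(2)] up(4) by simp
  ultimately show "\<exists>u\<in>A. \<exists>p\<in>B m. p \<noteq> 0 \<and> ld (u * f) m (p * ups m)"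
    using up attachedD(4)[OF m] by blast
qed

text \<open>The one-sided condition is what strips factors from the right end of a leading
  coefficient, and it passes to products and to images under the automorphism.\<close>

definition cancel :: "'a \<Rightarrow> bool" where
  "cancel w \<longleftrightarrow> w \<in> S \<and> (\<forall>s\<in>S. s * w = 0 \<longrightarrow> s = 0)"

lemma cancel_ups: "D dvd m \<Longrightarrow> cancel (ups m)"
  using regular_inD(1,2)[OF attachedD(1)] unfolding cancel_def by blast

lemma cancel_apow:
  assumes w: "cancel w"
  shows "cancel ((a ^^ m) w)"
proof -
  have wS: "w \<in> S" using w unfolding cancel_def by blast
  have "s = 0" if s: "s \<in> S" "s * (a ^^ m) w = 0" for s
  proof -
    obtain s' where s': "s' \<in> S" "(a ^^ m) s' = s" using apow_surj[OF s(1)] by blast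
    have "(a ^^ m) (s' * w) = 0" using apow_mult[OF s'(1) wS] s(2) s'(2) by simp
    then have "s' * w = 0" using apow_eq_zero[OF subringD(5)[OF S s'(1) wS]] by blast
    then have "s' = 0" using w s'(1) unfolding cancel_def by blast
    then show ?thesis using s'(2) apow_zero by simp
  qed
  then show ?thesis unfolding cancel_def using apow_S[OF wS] by blast
qed

lemma cancel_mult:
  assumes "cancel v" "cancel w"
  shows "cancel (v * w)"
proof -
  have vS: "v \<in> S" "w \<in> S" using assms unfolding cancel_def by auto
  have "s = 0" if s: "s \<in> S" "s * (v * w) = 0" for s
  proof -
    have "s * v \<in> S" "s * v * w = 0" using subringD(5)[OF S s(1) vS(1)] s(2) by (simp_all add: mult.assoc)
    then have "s * v = 0" using assms(2) unfolding cancel_def by blast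
    then show ?thesis using assms(1) s(1) unfolding cancel_def by blast
  qed
  then show ?thesis unfolding cancel_def using subringD(5)[OF S vS] by blast
qed

text \<open>Moving \<open>ups m\<close> to the right past \<open>z\<close> and \<open>r\<close> by
  \<open>ups_aut\<close> replaces the twist on \<open>S\<close> by the one on \<open>B m\<close>;
  the factor left over on the right cancels.\<close>

lemma lead_product:
  assumes m: "D dvd m" and f: "ld f m (p * ups m)" and p: "p \<in> B m" and z: "z \<in> B m"
    and g: "ld g k (r * w)" and r: "r \<in> B m" and w: "cancel w" and fg: "f * z * g = 0"
  shows "p * aut_at m z * aut_at m r = 0"
proof -
  note au = ring_autD[OF attachedD(3,5)[OF m]]
  have inS: "b \<in> S" if "b \<in> B m" for b using that attachedD(4)[OF m] by blast
  have wS: "w \<in> S" using w unfolding cancel_def by blast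
  have "ld (f * z * g) (m + 0 + k) (p * ups m * (a ^^ m) z * (a ^^ (m + 0)) (r * w))"
    using ld_mult[OF ld_mult[OF f ld_const[OF inS[OF z]]] g] .
  then have "p * ups m * (a ^^ m) z * (a ^^ m) (r * w) = 0"
    using ld_zero low_simps(1) fg by fastforce
  also have "p * ups m * (a ^^ m) z * (a ^^ m) (r * w) = p * (ups m * (a ^^ m) z) * (a ^^ m) r * (a ^^ m) w"
    using apow_mult[OF inS[OF r] wS] by (simp add: mult.assoc)
  also have "\<dots> = p * aut_at m z * (ups m * (a ^^ m) r) * (a ^^ m) w"
    using ups_aut[OF m z] by (simp add: mult.assoc)
  also have "\<dots> = p * aut_at m z * aut_at m r * (ups m * (a ^^ m) w)"
    using ups_aut[OF m r] by (simp add: mult.assoc)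
  finally have "p * aut_at m z * aut_at m r * (ups m * (a ^^ m) w) = 0" .
  moreover have "p * aut_at m z * aut_at m r \<in> S"
    using inS p au(1) z r subringD(5)[OF S] by simp
  ultimately show ?thesis using cancel_mult[OF cancel_ups[OF m] cancel_apow[OF w]] unfolding cancel_def by blast
qed

lemma prime_special:
  assumes pr: "\<And>m. D dvd m \<Longrightarrow> elt_prime (B m)"
  shows "elt_prime A"
  unfolding elt_prime_def
proof (intro ballI impI, rule ccontr)
  fix \<alpha> \<beta> assume ab: "\<alpha> \<in> A" "\<beta> \<in> A" and z: "\<forall>z\<in>A. \<alpha> * z * \<beta> = 0" and n0: "\<not> (\<alpha> = 0 \<or> \<beta> = 0)"
  note mA = subringD(5)[OF A]
  obtain m q where mq: "ld \<alpha> m q" "q \<noteq> 0" using ld_exists[of \<alpha>] ab AT n0 by blast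
  obtain k r where kr: "ld \<beta> k r" "r \<noteq> 0" using ld_exists[of \<beta>] ab AT n0 by blast
  have dm: "D dvd m" and dk: "D dvd k" using lead_attached(1) ab mq kr by blast+
  \<comment> \<open>An element of \<open>A\<close> of degree \<open>k\<close> is multiplied onto
    \<alpha> and one of degree \<open>m\<close> onto \<beta>. Both products then have degree
    \<open>m + k\<close>, and both leading coefficients can be moved into the same attached
    ring.\<close>
  define M where "M = m + k"
  have dM: "D dvd M" unfolding M_def using dm dk by simp
  define lk where "lk = ups k * y ^ k"
  define lm where "lm = ups m * y ^ m"
  have lA: "lk \<in> A" "lm \<in> A" unfolding lk_def lm_def using attachedD(2) dm dk by auto
  have qS: "q \<in> S" "r \<in> S" using mq kr unfolding ld_def by auto
  have uS: "ups k \<in> S" "ups m \<in> S" using cancel_ups dm dk unfolding cancel_def by auto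
  have l1: "ld (\<alpha> * lk) M (q * (a ^^ m) (ups k))"
    unfolding lk_def M_def using ld_mult[OF mq(1) ld_term[OF uS(1)]] .
  have n1: "q * (a ^^ m) (ups k) \<noteq> 0"
    using cancel_apow[OF cancel_ups[OF dk]] qS(1) mq(2) unfolding cancel_def by blast
  have l2: "ld (\<beta> * lm) M (r * (a ^^ k) (ups m))"
    unfolding lm_def M_def using ld_mult[OF kr(1) ld_term[OF uS(2), of m]] by (simp add: add.commute)
  have n2: "r * (a ^^ k) (ups m) \<noteq> 0"
    using cancel_apow[OF cancel_ups[OF dm]] qS(2) kr(2) unfolding cancel_def by blast
  obtain u p where u: "u \<in> A" "p \<in> B M" "p \<noteq> 0" "ld (u * (\<alpha> * lk)) M (p * ups M)"
    using lead_attached(2)[OF mA[OF ab(1) lA(1)] l1 n1] by blast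
  obtain v t where v: "v \<in> A" "t \<in> B M" "t \<noteq> 0" "ld (v * (\<beta> * lm)) M (t * ups M)"
    using lead_attached(2)[OF mA[OF ab(2) lA(2)] l2 n2] by blast
  note au = ring_autD[OF attachedD(3,5)[OF dM]]
  have "p * s * aut_at M t = 0" if s: "s \<in> B M" for s
  proof -
    \<comment> \<open>By surjectivity of the automorphism the twisted middle factor runs through all
      of \<open>B M\<close>.\<close>
    obtain s' where s': "s' \<in> B M" "aut_at M s' = s" using au(2)[OF s] by blast
    have "s' \<in> A" using s'(1) attachedD(4)[OF dM] by blast
    then have "lk * s' * v \<in> A" using mA lA(1) v(1) by simp
    then have "\<alpha> * (lk * s' * v) * \<beta> = 0" using z by blast
    moreover have "u * (\<alpha> * lk) * s' * (v * (\<beta> * lm)) = u * (\<alpha> * (lk * s' * v) * \<beta>) * lm"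
      by (simp add: mult.assoc)
    ultimately have "u * (\<alpha> * lk) * s' * (v * (\<beta> * lm)) = 0" by simp
    from lead_product[OF dM u(4,2) s'(1) v(4,2) cancel_ups[OF dM] this]
    show ?thesis using s'(2) by simp
  qed
  then have "aut_at M t = 0" using pr[OF dM] u(2,3) au(1)[OF v(2)] unfolding elt_prime_def by blast
  then show False using au(4)[OF v(2)] v(3) by blast
qed

text \<open>A direct comparison of leading coefficients gives only
  \<open>p * s * aut_at m p = 0\<close>, with a twisted second factor. Inserting powers of
  \<open>ups m * y ^ m\<close> gives this for all iterates of the automorphism, which is what
  \<open>semiprime_orbit\<close> needs.\<close>

lemma semiprime_special:
  assumes pr: "\<And>m. D dvd m \<Longrightarrow> elt_semiprime (B m)" and le: "\<And>m. D dvd m \<Longrightarrow> udim_le (B m) {0} (B m) k"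
  shows "elt_semiprime A"
  unfolding elt_semiprime_def
proof (intro ballI impI, rule ccontr)
  fix \<alpha> assume ab: "\<alpha> \<in> A" and z: "\<forall>z\<in>A. \<alpha> * z * \<alpha> = 0" and n0: "\<alpha> \<noteq> 0"
  note mA = subringD(5)[OF A]
  obtain m q where mq: "ld \<alpha> m q" "q \<noteq> 0" using ld_exists[of \<alpha>] ab AT n0 by blast
  have dm: "D dvd m" using lead_attached(1) ab mq by blast
  obtain u p where u: "u \<in> A" "p \<in> B m" "p \<noteq> 0" "ld (u * \<alpha>) m (p * ups m)"
    using lead_attached(2)[OF ab mq] by blast
  define f where "f = u * \<alpha>"
  define l where "l = ups m * y ^ m"
  have lA: "l \<in> A" unfolding l_def using attachedD(2) dm by auto
  have uS: "ups m \<in> S" using cancel_ups dm unfolding cancel_def by auto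
  note au = ring_autD[OF attachedD(3)[OF dm] ring_aut_pow[OF attachedD(3,5)[OF dm]]]
  note au1 = ring_autD[OF attachedD(3,5)[OF dm]]
  have inS: "b \<in> S" if "b \<in> B m" for b using that attachedD(4)[OF dm] by blast
  have lead: "\<exists>K w. cancel w \<and> ld (l ^ i * f) K ((aut_at m ^^ i) p * w)" for i
  proof (induction i)
    case 0
    then show ?case using cancel_ups[OF dm] u(4) unfolding f_def by auto
  next
    case (Suc i)
    then obtain K w where w: "cancel w" "ld (l ^ i * f) K ((aut_at m ^^ i) p * w)" by blast
    have wS: "w \<in> S" using w(1) unfolding cancel_def by blast
    let ?r = "(aut_at m ^^ i) p"
    have r: "?r \<in> B m" using au(1)[OF u(2)] .
    have "ld (l * (l ^ i * f)) (m + K) (ups m * (a ^^ m) (?r * w))"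
      unfolding l_def using ld_mult[OF ld_term[OF uS] w(2)[unfolded l_def]] .
    moreover have "ups m * (a ^^ m) (?r * w) = (ups m * (a ^^ m) ?r) * (a ^^ m) w"
      using apow_mult[OF inS[OF r] wS] by (simp add: mult.assoc)
    moreover have "\<dots> = (aut_at m ^^ Suc i) p * (ups m * (a ^^ m) w)"
      using ups_aut[OF dm r] by (simp add: mult.assoc)
    ultimately have "ld (l ^ Suc i * f) (m + K) ((aut_at m ^^ Suc i) p * (ups m * (a ^^ m) w))"
      by (simp add: mult.assoc)
    then show ?case using cancel_mult[OF cancel_ups[OF dm] cancel_apow[OF w(1)]] by blast
  qed
  have "p * s * (aut_at m ^^ Suc i) p = 0" if s: "s \<in> B m" for i s
  proof -
    obtain s' where s': "s' \<in> B m" "aut_at m s' = s" using au1(2)[OF s] by blast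
    obtain K w where w: "cancel w" "ld (l ^ i * f) K ((aut_at m ^^ i) p * w)" using lead by blast
    have "s' \<in> A" using s'(1) attachedD(4)[OF dm] by blast
    then have "s' * l ^ i * u \<in> A" using mA subring_pow[OF A lA] u(1) by simp
    then have "\<alpha> * (s' * l ^ i * u) * \<alpha> = 0" using z by blast
    moreover have "f * s' * (l ^ i * f) = u * (\<alpha> * (s' * l ^ i * u) * \<alpha>)"
      unfolding f_def by (simp add: mult.assoc)
    ultimately have "f * s' * (l ^ i * f) = 0" by simp
    from lead_product[OF dm u(4)[folded f_def] u(2) s'(1) w(2) au(1)[OF u(2)] w(1) this]
    show ?thesis using s'(2) by simp
  qed
  then have "p = 0"
    by (intro semiprime_orbit[OF attachedD(3)[OF dm] pr[OF dm] attachedD(5)[OF dm] le[OF dm] u(2)])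
  then show False using u(3) by blast
qed

end

text \<open>With \<open>X = {x \<in> A. x A b = 0}\<close> and \<open>c e \<in> A\<close>, right multiplication by \<open>c\<close> embeds \<open>X\<close> into itself, so
  \<open>X c\<close> is essential in \<open>X\<close> by finiteness of the uniform dimension; hence an essential left ideal
  of \<open>A\<close> annihilates \<open>a e b\<close>.\<close>
lemma strongly_nicely_ess_annihilates:
  assumes ne: "nicely_ess True A B" and B: "is_subring B" and ns: "nonsing A" and bd: "udim_le A {0} A n"
    and ab: "a \<in> A" "b \<in> A" and z: "\<forall>z\<in>A. a * z * b = 0" and e: "e \<in> B"
  shows "a * e * b = 0"
proof (rule ccontr)
  let ?w = "a * e * b"
  assume w0: "?w \<noteq> 0"
  have A: "is_subring A" and AB: "A \<subseteq> B"
    and fin: "\<And>E. finite E \<Longrightarrow> E \<subseteq> B - {0} \<Longrightarrow> \<exists>a\<in>A. \<forall>e\<in>E. a * e \<in> A \<and> a * e \<noteq> 0"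
    and st: "\<And>e. e \<in> B \<Longrightarrow> \<exists>c\<in>A. (\<forall>a\<in>A. a * c = 0 \<longrightarrow> a = 0) \<and> c * e \<in> A"
    using ne unfolding nicely_ess_def by auto
  note mA = subringD(5)[OF A]
  obtain c where c: "c \<in> A" "\<forall>a\<in>A. a * c = 0 \<longrightarrow> a = 0" "c * e \<in> A" using st[OF e] by blast
  define X where "X = {x \<in> A. \<forall>z\<in>A. x * z * b = 0}"
  have X: "submod A X"
    unfolding submod_def X_def using subringD(1,3,5)[OF A] by (auto simp: distrib_right mult.assoc)
  have XA: "X \<subseteq> A" unfolding X_def by blast
  have Xr: "x * r \<in> X" if "x \<in> X" "r \<in> A" for x r
  proof -
    have x: "x \<in> A" "\<forall>z\<in>A. x * z * b = 0" using that unfolding X_def by auto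
    have "x * r * z * b = 0" if "z \<in> A" for z
      using bspec[OF x(2) mA[OF \<open>r \<in> A\<close> that]] by (simp add: mult.assoc)
    then show ?thesis unfolding X_def using mA[OF x(1) \<open>r \<in> A\<close>] by blast
  qed
  have aX: "a \<in> X" unfolding X_def using ab z by blast
  \<comment> \<open>These multipliers push \<open>a\<close> into \<open>X c\<close>, where the
    factor \<open>c\<close> meets \<open>e\<close> and \<open>c * e\<close> lies in
    \<open>A\<close>.\<close>
  define E where "E = {z \<in> A. z * a \<in> (\<lambda>x. x * c) ` X}"
  have E0: "0 \<in> E" unfolding E_def using subringD(1)[OF A] submodD(1)[OF X] by force
  have "ess_in A E"
    unfolding ess_in_def
  proof (intro ballI impI)
    fix r assume r: "r \<in> A" "r \<noteq> 0"
    show "\<exists>s\<in>A. s * r \<noteq> 0 \<and> s * r \<in> E"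
    proof (cases "r * a = 0")
      case True
      then have "1 * r \<in> E" unfolding E_def using r submodD(1)[OF X] by force
      then show ?thesis using r subringD(2)[OF A] by (intro bexI[of _ 1]) auto
    next
      case False
      have raX: "r * a \<in> X" using submodD(3)[OF X r(1) aX] .
      obtain s x where s: "s \<in> A" "x \<in> X" "s * (r * a) \<noteq> 0" "s * (r * a) = x * c"
        by (rule ess_in_right_mult[OF A X XA c(1) _ _ bd raX False]) (use c Xr in blast)+
      have "s * r \<in> E" unfolding E_def using s mA[OF s(1) r(1)] by (auto simp: mult.assoc)
      moreover have "s * r \<noteq> 0" using s(3) by (metis mult.assoc mult_zero_left)
      ultimately show ?thesis using s(1) by blast
    qed
  qed
  have Ew: "q * ?w = 0" if q: "q \<in> E" for q
  proof -
    obtain x where x: "x \<in> X" "q * a = x * c" using q unfolding E_def by blast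
    have "q * ?w = q * a * e * b" by (simp add: mult.assoc)
    also have "\<dots> = x * (c * e) * b" unfolding x(2) by (simp add: mult.assoc)
    also have "\<dots> = 0" using x(1) c(3) unfolding X_def by blast
    finally show ?thesis .
  qed
  \<comment> \<open>\<open>?w\<close> is only known to lie in \<open>B\<close>, while nonsingularity
    concerns \<open>A\<close>: a multiplier \<open>g\<close> brings it into \<open>A\<close>, and
    \<open>E\<close> is pulled back along right multiplication by \<open>g\<close>.\<close>
  have "?w \<in> B" using ab AB e subringD(5)[OF B] by blast
  then have "\<exists>a\<in>A. \<forall>e\<in>{?w}. a * e \<in> A \<and> a * e \<noteq> 0" by (intro fin) (use w0 in auto)
  then obtain g where g: "g \<in> A" "g * ?w \<in> A" "g * ?w \<noteq> 0" by blast
  obtain q where q: "q \<in> A" "q \<in> {z \<in> A. z * g \<in> E}" "q * (g * ?w) \<noteq> 0"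
    using nonsing_ess_in[OF A ns ess_in_vimage[OF A \<open>ess_in A E\<close> E0 g(1)] g(2,3)] .
  then have "q * g * ?w = 0" using Ew by blast
  then show False using q(3) by (simp add: mult.assoc)
qed

section \<open>The tower of skew polynomial rings\<close>

lemma lin_closed_single:
  assumes lc: "lin_closed U V" and s: "s \<in> V" "p \<in> U" "q \<in> U" "s * p = 0" "s * q \<noteq> 0"
  obtains t where "t \<in> U" "t * p = 0" "t * q \<noteq> 0"
proof -
  obtain a where "\<forall>i\<in>{0::nat}. a i \<in> U" "\<forall>f\<in>{\<lambda>_. p}. (\<Sum>i\<in>{0::nat}. a i * f i) = 0" "(\<Sum>i\<in>{0::nat}. a i * q) \<noteq> 0"
    by (rule lin_closedE[OF lc, of "{0::nat}" "{\<lambda>_. p}" "\<lambda>_. q" "\<lambda>_. s"]) (use s in auto)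
  then show ?thesis using that[of "a 0"] by simp
qed

lemma finite_subset_directed_union:
  fixes G :: "'i::linorder \<Rightarrow> 'a set"
  assumes "finite F" "F \<subseteq> (\<Union>k\<in>L. G k)" "j \<in> L" "\<And>k k'. k \<in> L \<Longrightarrow> k' \<in> L \<Longrightarrow> k \<le> k' \<Longrightarrow> G k \<subseteq> G k'"
  shows "\<exists>k\<in>L. j \<le> k \<and> F \<subseteq> G k"
  using assms(1,2)
proof (induction F rule: finite_induct)
  case empty
  then show ?case using assms(3) by auto
next
  case (insert x F)
  then obtain k where k: "k \<in> L" "j \<le> k" "F \<subseteq> G k" by auto
  obtain i where i: "i \<in> L" "x \<in> G i" using insert.prems by auto
  have "max i k \<in> L" using i k by (simp add: max_def)
  moreover have "G i \<subseteq> G (max i k)" "G k \<subseteq> G (max i k)" using assms(4) i(1) k(1) calculation by simp_all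
  ultimately show ?case using k i by (intro bexI[of _ "max i k"]) (auto simp: le_max_iff_disj)
qed

section \<open>Primeness in terms of ideals and in terms of elements\<close>

lemma ideal_right_ann:
  assumes A: "is_subring A" and a: "a \<in> A"
  shows "two_sided_ideal A {q \<in> A. \<forall>z\<in>A. a * z * q = 0}"
proof -
  have "a * z * (r * q) = 0" if "r \<in> A" "z \<in> A" "\<forall>z\<in>A. a * z * q = 0" for r z q
    using bspec[OF that(3) subringD(5)[OF A that(2,1)]] by (simp add: mult.assoc)
  moreover have "a * z * (q * r) = 0" if "z \<in> A" "\<forall>z\<in>A. a * z * q = 0" for r z q
    using bspec[OF that(2,1)] by (simp add: mult.assoc[symmetric])
  ultimately show ?thesis
    unfolding two_sided_ideal_def left_ideal_def
    using subringD(1,3,5)[OF A] by (auto simp: distrib_left)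
qed

lemma ideal_left_ann:
  assumes A: "is_subring A" and Q: "two_sided_ideal A Q"
  shows "two_sided_ideal A {p \<in> A. \<forall>q\<in>Q. p * q = 0}"
proof -
  have "p * r * q = 0" if "r \<in> A" "q \<in> Q" "\<forall>q\<in>Q. p * q = 0" for p r q
  proof -
    have "r * q \<in> Q" using Q that unfolding two_sided_ideal_def left_ideal_def by blast
    then show ?thesis using that(3) by (simp add: mult.assoc)
  qed
  then show ?thesis
    unfolding two_sided_ideal_def left_ideal_def
    using subringD(1,3,5)[OF A] by (auto simp: distrib_right mult.assoc)
qed

text \<open>Annihilators take the place of the ideals generated by \<open>a\<close> and
  \<open>b\<close>, so that no finite sums of products occur.\<close>

lemma annihilating_ideals:
  assumes A: "is_subring A" and ab: "a \<in> A" "b \<in> A" and z: "\<forall>z\<in>A. a * z * b = 0"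
  obtains P Q where "two_sided_ideal A P" "two_sided_ideal A Q" "a \<in> P" "b \<in> Q" "\<forall>p\<in>P. \<forall>q\<in>Q. p * q = 0"
proof -
  define Q where "Q = {q \<in> A. \<forall>z\<in>A. a * z * q = 0}"
  define P where "P = {p \<in> A. \<forall>q\<in>Q. p * q = 0}"
  have Q: "two_sided_ideal A Q" unfolding Q_def by (rule ideal_right_ann[OF A ab(1)])
  have P: "two_sided_ideal A P" unfolding P_def by (rule ideal_left_ann[OF A Q])
  have "a * q = 0" if "q \<in> Q" for q
  proof -
    have "a * 1 * q = 0" using that subringD(2)[OF A] unfolding Q_def by blast
    then show ?thesis by simp
  qed
  then have "a \<in> P" unfolding P_def using ab by blast
  moreover have "b \<in> Q" unfolding Q_def using ab z by blast
  moreover have "\<forall>p\<in>P. \<forall>q\<in>Q. p * q = 0" unfolding P_def by blast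
  ultimately show ?thesis using that P Q by blast
qed

lemma elt_prime_iff:
  assumes A: "is_subring A"
  shows "prime_ring A \<longleftrightarrow> elt_prime A"
proof
  assume pr: "prime_ring A"
  show "elt_prime A"
    unfolding elt_prime_def
  proof (intro ballI impI)
    fix a b assume ab: "a \<in> A" "b \<in> A" and z: "\<forall>z\<in>A. a * z * b = 0"
    obtain P Q where PQ: "two_sided_ideal A P" "two_sided_ideal A Q" "a \<in> P" "b \<in> Q" "\<forall>p\<in>P. \<forall>q\<in>Q. p * q = 0"
      using annihilating_ideals[OF A ab z] .
    then have "P = {0} \<or> Q = {0}" using pr unfolding prime_ring_def by blast
    then show "a = 0 \<or> b = 0" using PQ by blast
  qed
next
  assume pr: "elt_prime A"
  show "prime_ring A"
    unfolding prime_ring_def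
  proof (intro conjI allI impI)
    show "\<exists>a\<in>A. a \<noteq> 0" using subringD(2)[OF A] by (intro bexI[of _ 1]) auto
  next
    fix P Q assume h: "two_sided_ideal A P \<and> two_sided_ideal A Q \<and> (\<forall>p\<in>P. \<forall>q\<in>Q. p * q = 0)"
    then have P: "P \<subseteq> A" "0 \<in> P" "\<forall>r\<in>A. \<forall>a\<in>P. a * r \<in> P" and Q: "Q \<subseteq> A" "0 \<in> Q"
      unfolding two_sided_ideal_def left_ideal_def by blast+
    have "p = 0 \<or> q = 0" if "p \<in> P" "q \<in> Q" for p q
    proof -
      have "\<forall>z\<in>A. p * z * q = 0" using P(3) h that by blast
      then show ?thesis using pr P(1) Q(1) that unfolding elt_prime_def by blast
    qed
    then show "P = {0} \<or> Q = {0}" using P(2) Q(2) by blast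
  qed
qed

lemma elt_semiprime_iff:
  assumes A: "is_subring A"
  shows "semiprime_ring A \<longleftrightarrow> elt_semiprime A"
proof
  assume pr: "semiprime_ring A"
  show "elt_semiprime A"
    unfolding elt_semiprime_def
  proof (intro ballI impI)
    fix a assume a: "a \<in> A" and z: "\<forall>z\<in>A. a * z * a = 0"
    obtain P Q where PQ: "two_sided_ideal A P" "two_sided_ideal A Q" "a \<in> P" "a \<in> Q" "\<forall>p\<in>P. \<forall>q\<in>Q. p * q = 0"
      using annihilating_ideals[OF A a a z] .
    \<comment> \<open>The intersection still contains \<open>a\<close> and has square zero, so a
      single ideal results from the pair.\<close>
    then have "two_sided_ideal A (P \<inter> Q)" unfolding two_sided_ideal_def left_ideal_def by blast
    then have "P \<inter> Q = {0}" using pr PQ(5) unfolding semiprime_ring_def by blast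
    then show "a = 0" using PQ by blast
  qed
next
  assume pr: "elt_semiprime A"
  show "semiprime_ring A"
    unfolding semiprime_ring_def
  proof (intro allI impI)
    fix P assume h: "two_sided_ideal A P \<and> (\<forall>p\<in>P. \<forall>q\<in>P. p * q = 0)"
    then have P: "P \<subseteq> A" "0 \<in> P" "\<forall>r\<in>A. \<forall>a\<in>P. a * r \<in> P"
      unfolding two_sided_ideal_def left_ideal_def by blast+
    have "p = 0" if "p \<in> P" for p
    proof -
      have "\<forall>z\<in>A. p * z * p = 0" using P(3) h that by blast
      then show ?thesis using pr P(1) that unfolding elt_semiprime_def by blast
    qed
    then show "P = {0}" using P(2) by blast
  qed
qed

section \<open>Cuts of the index set and induction over them\<close>

lemma is_cut_seg: "is_cut I (seg I k)"
  unfolding is_cut_def seg_def by auto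

lemma is_cut_insert_seg: "k \<in> I \<Longrightarrow> is_cut I (insert k (seg I k))"
  unfolding is_cut_def seg_def by auto

lemma seg_mono: "k \<le> k' \<Longrightarrow> seg I k \<subseteq> seg I k'"
  unfolding seg_def by auto

text \<open>A cut is empty, has a greatest element, or is a limit. Induction over the well-order
  reaches the segments \<open>seg I k\<close>; a cut such as \<open>I\<close> need not be of this
  form and takes one further step.\<close>

lemma cut_induct [consumes 1, case_names empty succ limit]:
  fixes I :: "'i::wellorder set"
  assumes J: "is_cut I J" and e: "P {}"
    and s: "\<And>k. k \<in> I \<Longrightarrow> P (seg I k) \<Longrightarrow> P (insert k (seg I k))"
    and l: "\<And>J. is_cut I J \<Longrightarrow> J \<noteq> {} \<Longrightarrow> \<forall>j\<in>J. \<exists>j'\<in>J. j < j' \<Longrightarrow> (\<And>j. j \<in> J \<Longrightarrow> P (seg I j)) \<Longrightarrow> P J"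
  shows "P J"
proof -
  have step: "P J" if J: "is_cut I J" and IH: "\<And>j. j \<in> J \<Longrightarrow> P (seg I j)" for J
  proof -
    consider "J = {}" | "J \<noteq> {}" "\<forall>j\<in>J. \<exists>j'\<in>J. j < j'" | k where "k \<in> J" "\<forall>j\<in>J. j \<le> k"
      by (meson not_le)
    then show ?thesis
    proof cases
      case 1
      then show ?thesis using e by simp
    next
      case 2
      from l[OF J this IH] show ?thesis .
    next
      case 3
      have "J \<subseteq> I" "\<And>t. t \<in> I \<Longrightarrow> t \<le> k \<Longrightarrow> t \<in> J" using J 3(1) unfolding is_cut_def by blast+
      then have "J = insert k (seg I k)" using 3 unfolding seg_def by (auto simp: le_less)
      moreover have "k \<in> I" using J 3(1) unfolding is_cut_def by blast
      ultimately show ?thesis using s[OF _ IH[OF 3(1)]] by simp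
    qed
  qed
  have "P (seg I k)" for k
  proof (induction k rule: less_induct)
    case (less k)
    show ?case by (rule step[OF is_cut_seg]) (use less in \<open>auto simp: seg_def\<close>)
  qed
  then show ?thesis using step[OF J] by blast
qed

lemma sub_cut_insert_seg:
  assumes "is_cut I K" "K \<subseteq> insert k (seg I k)"
  shows "K = insert k (seg I k) \<or> K \<subseteq> seg I k"
proof (cases "k \<in> K")
  case True
  have "seg I k \<subseteq> K" using assms(1) True unfolding is_cut_def seg_def by force
  then show ?thesis using assms(2) True by blast
qed (use assms in blast)

lemma sub_cut_seg:
  assumes "is_cut I K" "is_cut I J" "K \<subseteq> J" "K \<noteq> J"
  obtains j where "j \<in> J" "K \<subseteq> seg I j"
proof -
  obtain j where j: "j \<in> J" "j \<notin> K" using assms by blast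
  have "K \<subseteq> seg I j"
  proof
    fix t assume t: "t \<in> K"
    have "j \<in> I" using j assms(2) unfolding is_cut_def by blast
    then have "\<not> j \<le> t" using assms(1) t j(2) unfolding is_cut_def by blast
    then show "t \<in> seg I j" using t assms(1) unfolding is_cut_def seg_def by auto
  qed
  then show ?thesis using that j by blast
qed

text \<open>\<open>n\<close> is the exact uniform dimension of \<open>R\<close>. Nonsingularity
  stands in for the primeness assumptions, so that the prime and the semiprime case share one
  tower.\<close>

locale skew =
  fixes R :: "'a::ring_1 set" and I :: "'i::wellorder set" and x :: "'i \<Rightarrow> 'a"
    and Sk :: "'i set \<Rightarrow> 'a set" and \<alpha> \<delta> :: "'i \<Rightarrow> 'a \<Rightarrow> 'a" and n :: nat
  assumes setting: "skew_setting R I x Sk \<alpha> \<delta>"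
    and nsR: "nonsing R" and leR: "udim_le R {0} R n" and geR: "udim_ge R n"
begin

lemma Sk_empty: "Sk {} = R"
  using setting unfolding skew_setting_def by (elim conjE)

lemma Sk_subring: "is_cut I J \<Longrightarrow> is_subring (Sk J)"
proof -
  have "\<forall>J. is_cut I J \<longrightarrow> is_subring (Sk J) \<and> free_std R x J (Sk J)"
    using setting unfolding skew_setting_def by (elim conjE)
  then show "is_cut I J \<Longrightarrow> is_subring (Sk J)" by simp
qed

lemma Sk_ore: "k \<in> I \<Longrightarrow> ore (Sk (seg I k)) (Sk (insert k (seg I k))) (x k) (\<alpha> k) (\<delta> k)"
proof -
  have "\<forall>k\<in>I. ore_ext (Sk (seg I k)) (Sk (insert k (seg I k))) (x k) (\<alpha> k) (\<delta> k)"
    using setting unfolding skew_setting_def by (elim conjE)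
  then show "k \<in> I \<Longrightarrow> ?thesis" unfolding ore_def by simp
qed

lemma Sk_limit: "is_cut I J \<Longrightarrow> J \<noteq> {} \<Longrightarrow> \<forall>j\<in>J. \<exists>j'\<in>J. j < j' \<Longrightarrow> Sk J = (\<Union>k\<in>J. Sk (seg I k))"
proof -
  have "\<forall>J. is_cut I J \<and> J \<noteq> {} \<and> (\<forall>j\<in>J. \<exists>j'\<in>J. j < j') \<longrightarrow> Sk J = (\<Union>k\<in>J. Sk (seg I k))"
    using setting unfolding skew_setting_def by (elim conjE)
  then show "is_cut I J \<Longrightarrow> J \<noteq> {} \<Longrightarrow> \<forall>j\<in>J. \<exists>j'\<in>J. j < j' \<Longrightarrow> ?thesis" by simp
qed

lemma R: "is_subring R"
  using Sk_subring[of "{}"] Sk_empty unfolding is_cut_def by simp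

text \<open>The properties go through the induction together: the dimension bound at a successor
  uses nonsingularity, and nonsingularity at a limit uses linear closedness of the stages.\<close>

lemma Sk_props:
  assumes "is_cut I J"
  shows "nonsing (Sk J) \<and> udim_le (Sk J) {0} (Sk J) n \<and> (\<forall>K. is_cut I K \<and> K \<subseteq> J \<longrightarrow> lin_closed (Sk K) (Sk J))"
  using assms
proof (induction J rule: cut_induct)
  case empty
  then show ?case using Sk_empty nsR leR by (simp add: lin_closed_refl)
next
  case (succ k)
  interpret ore "Sk (seg I k)" "Sk (insert k (seg I k))" "x k" "\<alpha> k" "\<delta> k" by (rule Sk_ore[OF succ(1)])
  have "lin_closed (Sk K) (Sk (insert k (seg I k)))" if K: "is_cut I K" "K \<subseteq> insert k (seg I k)" for K
    using sub_cut_insert_seg[OF K]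
  proof
    assume "K \<subseteq> seg I k"
    then show ?thesis using lin_closed_trans[OF _ lin_closed_ore] succ(2) K(1) by blast
  qed (simp add: lin_closed_refl)
  then show ?case using nonsing_ore udim_ore succ(2) by blast
next
  case (limit J)
  have un: "Sk J = (\<Union>k\<in>J. Sk (seg I k))" using Sk_limit limit(1-3) by blast
  have SJ: "is_subring (Sk J)" using Sk_subring limit(1) by blast
  have mono: "Sk (seg I k) \<subseteq> Sk (seg I k')" if "k \<in> J" "k' \<in> J" "k \<le> k'" for k k'
    using limit(4)[OF that(2)] is_cut_seg[of I k] seg_mono[OF that(3)] lin_closed_subset by blast
  have lc: "lin_closed (Sk K) (Sk J)" if K: "is_cut I K" "K \<subseteq> J" for K
  proof (cases "K = J")
    case True
    then show ?thesis using lin_closed_refl by simp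
  next
    case False
    then obtain j where j: "j \<in> J" "K \<subseteq> seg I j" using sub_cut_seg[OF K(1) limit(1) K(2)] by blast
    show ?thesis
    proof (rule lin_closedI)
      show "Sk K \<subseteq> Sk J" using limit(4)[OF j(1)] K(1) j lin_closed_subset un by blast
      fix X :: "nat set" and C v b
      assume h: "finite X" "finite C" "\<forall>f\<in>C. \<forall>i\<in>X. f i \<in> Sk K" "\<forall>i\<in>X. v i \<in> Sk K"
        "\<forall>i\<in>X. b i \<in> Sk J" "\<forall>f\<in>C. (\<Sum>i\<in>X. b i * f i) = 0" "(\<Sum>i\<in>X. b i * v i) \<noteq> 0"
      have "b ` X \<subseteq> (\<Union>k\<in>J. Sk (seg I k))" using h(5) un by blast
      from finite_subset_directed_union[OF finite_imageI[OF h(1)] this j(1) mono]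
      obtain k where k: "k \<in> J" "j \<le> k" "b ` X \<subseteq> Sk (seg I k)" by blast
      have lk: "lin_closed (Sk K) (Sk (seg I k))"
        using limit(4)[OF k(1)] K(1) j(2) seg_mono[OF k(2)] by blast
      have bk: "\<forall>i\<in>X. b i \<in> Sk (seg I k)" using k(3) by blast
      obtain a where "\<forall>i\<in>X. a i \<in> Sk K" "\<forall>f\<in>C. (\<Sum>i\<in>X. a i * f i) = 0" "(\<Sum>i\<in>X. a i * v i) \<noteq> 0"
        using lin_closedE[OF lk h(1-4) bk h(6,7)] .
      then show "\<exists>a. (\<forall>i\<in>X. a i \<in> Sk K) \<and> (\<forall>f\<in>C. (\<Sum>i\<in>X. a i * f i) = 0) \<and> (\<Sum>i\<in>X. a i * v i) \<noteq> 0"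
        by blast
    qed
  qed
  have segJ: "seg I k \<subseteq> J" if "k \<in> J" for k using limit(1) that unfolding is_cut_def seg_def by force
  have "nonsing (Sk J)"
    unfolding nonsing_def
  proof (intro ballI impI)
    fix f assume "f \<in> Sk J" and sing: "\<forall>r\<in>Sk J. r \<noteq> 0 \<longrightarrow> (\<exists>s\<in>Sk J. s * r \<noteq> 0 \<and> s * r * f = 0)"
    then obtain k where k: "k \<in> J" "f \<in> Sk (seg I k)" using un by blast
    have lk: "lin_closed (Sk (seg I k)) (Sk J)" using lc[OF is_cut_seg segJ[OF k(1)]] .
    \<comment> \<open>The multiplier found in \<open>Sk J\<close> has to be replaced by one in the
      stage of \<open>f\<close>: \<open>s * (r * f) = 0\<close> with \<open>s * r \<noteq> 0\<close>
      is a system in one unknown over that stage.\<close>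
    have "\<exists>s\<in>Sk (seg I k). s * r \<noteq> 0 \<and> s * r * f = 0" if r: "r \<in> Sk (seg I k)" "r \<noteq> 0" for r
    proof -
      obtain s where s: "s \<in> Sk J" "s * r \<noteq> 0" "s * r * f = 0"
        using sing r lin_closed_subset[OF lk] by blast
      have "r * f \<in> Sk (seg I k)" using subringD(5)[OF Sk_subring[OF is_cut_seg] r(1) k(2)] .
      moreover have "s * (r * f) = 0" using s(3) by (simp add: mult.assoc)
      ultimately obtain t where "t \<in> Sk (seg I k)" "t * (r * f) = 0" "t * r \<noteq> 0"
        using lin_closed_single[OF lk s(1) _ r(1) _ s(2)] by blast
      then show ?thesis by (auto simp: mult.assoc)
    qed
    then show "f = 0" using limit(4)[OF k(1)] k(2) unfolding nonsing_def by blast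
  qed
  moreover have "udim_le (Sk J) {0} (Sk J) n"
    unfolding udim_le_def
  proof (intro allI impI)
    fix X :: "nat set" and f assume fam: "indep_family (Sk J) {0} (Sk J) X f"
    then have X: "finite X" and f: "f ` X \<subseteq> (\<Union>k\<in>J. Sk (seg I k))" using un unfolding indep_family_def by blast+
    obtain j where j: "j \<in> J" using limit(2) by blast
    from finite_subset_directed_union[OF finite_imageI[OF X] f j mono]
    obtain k where k: "k \<in> J" "f ` X \<subseteq> Sk (seg I k)" by blast
    have "indep (Sk (seg I k)) {0} X f"
      using fam indep_mono[of "Sk J" "{0}" X f X "Sk (seg I k)"] X subringD(1)[OF SJ] un k(1)
      unfolding indep_family_def by blast
    then have "indep_family (Sk (seg I k)) {0} (Sk (seg I k)) X f"
      using fam k(2) unfolding indep_family_def by blast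
    then show "card X \<le> n" using udim_leD limit(4)[OF k(1)] by blast
  qed
  ultimately show ?case using lc by blast
qed

text \<open>The invariant of the induction over \<open>ess\<close>. The upper bound for the
  dimension is absent because it follows from linear closedness in \<open>S\<close>.\<close>

definition good :: "bool \<Rightarrow> 'a set \<Rightarrow> 'a set \<Rightarrow> bool" where
  "good st S A \<longleftrightarrow> is_subring A \<and> lin_closed A S \<and> udim_ge A n \<and>
     (st \<longrightarrow> (elt_prime R \<longrightarrow> elt_prime A) \<and> (elt_semiprime R \<longrightarrow> elt_semiprime A))"

lemma good_nicely_ess:
  assumes S: "is_subring S" "nonsing S" "udim_le S {0} S n" and B: "good st S B" and ne: "nicely_ess st A B"
  shows "good st S A"
proof -
  have sB: "is_subring B" and lB: "lin_closed B S" and gB: "udim_ge B n" using B unfolding good_def by auto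
  have A: "is_subring A" and AB: "A \<subseteq> B" using ne unfolding nicely_ess_def by auto
  have lA: "lin_closed A S" using lin_closed_trans[OF lin_closed_nicely_ess[OF ne sB] lB] .
  have gA: "udim_ge A n" using udim_ge_nicely_ess[OF gB sB ne] .
  \<comment> \<open>Here the lower bound for \<open>A\<close> and the upper bound for
    \<open>S\<close> meet at the same \<open>n\<close>; the annihilator argument of the strong case
    depends on the result.\<close>
  have ns: "nonsing A" using nonsing_lin_closed[OF lA A S(1) gA S(3,2)] .
  have le: "udim_le A {0} A n" using udim_le_lin_closed[OF lA A S(3)] .
  have ann: "a * e * b = 0" if "st" "a \<in> A" "b \<in> A" "\<forall>z\<in>A. a * z * b = 0" "e \<in> B" for a b e
  proof -
    have "nicely_ess True A B" using ne that(1) by simp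
    then show ?thesis using strongly_nicely_ess_annihilates[OF _ sB ns le that(2-5)] by blast
  qed
  have "elt_prime A" if st "elt_prime B"
    unfolding elt_prime_def
  proof (intro ballI impI)
    fix a b assume ab: "a \<in> A" "b \<in> A" "\<forall>z\<in>A. a * z * b = 0"
    then have "\<forall>e\<in>B. a * e * b = 0" using ann[OF that(1)] by blast
    then show "a = 0 \<or> b = 0" using that(2) ab(1,2) AB unfolding elt_prime_def by blast
  qed
  moreover have "elt_semiprime A" if st "elt_semiprime B"
    unfolding elt_semiprime_def
  proof (intro ballI impI)
    fix a assume ab: "a \<in> A" "\<forall>z\<in>A. a * z * a = 0"
    then have "\<forall>e\<in>B. a * e * a = 0" using ann[OF that(1)] by blast
    then show "a = 0" using that(2) ab(1) AB unfolding elt_semiprime_def by blast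
  qed
  ultimately show ?thesis using A lA gA B unfolding good_def by blast
qed

text \<open>The ring of constants of \<open>At\<close> is the attached ring for
  \<open>m = 0\<close>, so the hypothesis covers it. Linear closedness and the \<open>n\<close>
  independent elements are lifted from there, while primeness draws on the attached rings of all
  degrees.\<close>

lemma good_special:
  assumes k: "k \<in> I" and sp: "special R (Sk (seg I k)) (x k) (Sk (insert k (seg I k))) At B"
    and B: "\<And>m. m \<in> Deg (Sk (seg I k)) (x k) At \<Longrightarrow> good st (Sk (seg I k)) (B m)"
  shows "good st (Sk (insert k (seg I k))) At"
proof -
  let ?S = "Sk (seg I k)" and ?T = "Sk (insert k (seg I k))"
  have S: "is_subring ?S" "nonsing ?S" "udim_le ?S {0} ?S n"
    using Sk_subring Sk_props is_cut_seg by blast+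
  interpret o: ore ?S ?T "x k" "\<alpha> k" "\<delta> k" by (rule Sk_ore[OF k])
  interpret sx: special_ext ?S ?T "x k" "\<alpha> k" "\<delta> k" R At B n
    by unfold_locales (use sp S in auto)
  have Bm: "good st ?S (B m)" if "sx.D dvd m" for m
    using B[of m] that unfolding sx.Deg_eq by (auto elim: dvdE)
  have B0: "good st ?S (At \<inter> ?S)" using Bm[of 0] sx.B0 by simp
  then have B0D: "is_subring (At \<inter> ?S)" "lin_closed (At \<inter> ?S) ?S" "udim_ge (At \<inter> ?S) n"
    unfolding good_def by auto
  have lA: "lin_closed At ?T" using sx.lin_closed_special[OF B0D(2)] .
  have gA: "udim_ge At n"
    using udim_ge_trans[OF B0D(3,1) lin_closed_trans[OF B0D(2) o.lin_closed_ore] _ sx.AT o.T] by blast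
  have le: "udim_le (B m) {0} (B m) n" if "sx.D dvd m" for m
    using Bm[OF that] udim_le_lin_closed[OF _ _ S(3)] unfolding good_def by blast
  have "elt_prime At" if st "elt_prime R"
    using sx.prime_special Bm that unfolding good_def by blast
  moreover have "elt_semiprime At" if st "elt_semiprime R"
    using sx.semiprime_special[OF _ le] Bm that unfolding good_def by blast
  ultimately show ?thesis unfolding good_def using sx.A lA gA by blast
qed

lemma good_ess:
  assumes "ess st R I x Sk J A"
  shows "is_cut I J \<and> good st (Sk J) A"
  using assms
proof (induction rule: ess.induct)
  case (base A)
  have "good st R R" unfolding good_def using R lin_closed_refl geR by blast
  then have "good st R A" using good_nicely_ess[OF R nsR leR _ base] by blast
  then show ?case using Sk_empty unfolding is_cut_def by simp
next
  case (limit J \<Lambda> Af A)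
  \<comment> \<open>\<open>\<Lambda>\<close> may fail to be cofinal in \<open>J\<close>, so
    \<open>Sk J\<close> need not be the union of the stages over \<open>\<Lambda>\<close>; each
    \<open>Af k\<close> is therefore compared with \<open>Sk J\<close> itself.\<close>
  have Af: "is_subring (Af k)" "lin_closed (Af k) (Sk J)" "udim_ge (Af k) n"
    "st \<longrightarrow> (elt_prime R \<longrightarrow> elt_prime (Af k)) \<and> (elt_semiprime R \<longrightarrow> elt_semiprime (Af k))" if k: "k \<in> \<Lambda>" for k
  proof -
    have g: "good st (Sk (seg I k)) (Af k)" using limit.IH k by blast
    have "seg I k \<subseteq> J" using limit(1,4) k unfolding is_cut_def seg_def by force
    then have "lin_closed (Sk (seg I k)) (Sk J)" using Sk_props[OF limit(1)] is_cut_seg by blast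
    then show "lin_closed (Af k) (Sk J)" using g lin_closed_trans unfolding good_def by blast
    show "is_subring (Af k)" "udim_ge (Af k) n"
      "st \<longrightarrow> (elt_prime R \<longrightarrow> elt_prime (Af k)) \<and> (elt_semiprime R \<longrightarrow> elt_semiprime (Af k))"
      using g unfolding good_def by auto
  qed
  obtain k0 where k0: "k0 \<in> \<Lambda>" using limit(5) by blast
  have dir: "\<exists>k\<in>\<Lambda>. F \<subseteq> Af k" if F: "finite F" "F \<subseteq> A" for F
  proof -
    have "Af k \<subseteq> Af k'" if "k \<in> \<Lambda>" "k' \<in> \<Lambda>" "k \<le> k'" for k k' using limit.hyps(6) that by blast
    from finite_subset_directed_union[OF F(1) F(2)[unfolded limit.hyps(7)] k0 this] show ?thesis by blast
  qed
  have AJ: "A \<subseteq> Sk J" using lin_closed_subset[OF Af(2)] limit.hyps(7) by blast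
  have A: "is_subring A"
    unfolding is_subring_def
  proof (intro conjI ballI)
    show "0 \<in> A" "1 \<in> A" using subringD(1,2)[OF Af(1)[OF k0]] k0 limit.hyps(7) by auto
    fix p q assume "p \<in> A" "q \<in> A"
    then obtain k where k: "k \<in> \<Lambda>" "p \<in> Af k" "q \<in> Af k" using dir[of "{p, q}"] by auto
    show "p + q \<in> A" "p - q \<in> A" "p * q \<in> A"
      using subringD(3-5)[OF Af(1)[OF k(1)] k(2,3)] k(1) limit.hyps(7) by auto
  qed
  have "lin_closed A (Sk J)"
  proof (rule lin_closedI[OF AJ])
    fix X :: "nat set" and C v b
    assume h: "finite X" "finite C" "\<forall>f\<in>C. \<forall>i\<in>X. f i \<in> A" "\<forall>i\<in>X. v i \<in> A"
      "\<forall>i\<in>X. b i \<in> Sk J" "\<forall>f\<in>C. (\<Sum>i\<in>X. b i * f i) = 0" "(\<Sum>i\<in>X. b i * v i) \<noteq> 0"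
    define F where "F = (\<Union>f\<in>insert v C. f ` X)"
    have "finite F" "F \<subseteq> A" unfolding F_def using h(1-4) by auto
    \<comment> \<open>A system has finitely many entries, so it already lives over one member of the
      chain.\<close>
    then obtain k where k: "k \<in> \<Lambda>" "F \<subseteq> Af k" using dir by blast
    then have hk: "\<forall>f\<in>C. \<forall>i\<in>X. f i \<in> Af k" "\<forall>i\<in>X. v i \<in> Af k" unfolding F_def by auto
    obtain a where "\<forall>i\<in>X. a i \<in> Af k" "\<forall>f\<in>C. (\<Sum>i\<in>X. a i * f i) = 0" "(\<Sum>i\<in>X. a i * v i) \<noteq> 0"
      using lin_closedE[OF Af(2)[OF k(1)] h(1,2) hk h(5-7)] .
    then show "\<exists>a. (\<forall>i\<in>X. a i \<in> A) \<and> (\<forall>f\<in>C. (\<Sum>i\<in>X. a i * f i) = 0) \<and> (\<Sum>i\<in>X. a i * v i) \<noteq> 0"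
      using k(1) limit.hyps(7) by blast
  qed
  moreover have "udim_ge A n"
    using udim_ge_trans[OF Af(3,1,2)[OF k0] _ AJ Sk_subring[OF limit(1)]] k0 limit.hyps(7) by blast
  moreover have "elt_prime A" if st "elt_prime R"
    unfolding elt_prime_def
  proof (intro ballI impI)
    fix a b assume ab: "a \<in> A" "b \<in> A" "\<forall>z\<in>A. a * z * b = 0"
    then obtain k where k: "k \<in> \<Lambda>" "a \<in> Af k" "b \<in> Af k" using dir[of "{a, b}"] by auto
    then have "\<forall>z\<in>Af k. a * z * b = 0" using ab(3) limit.hyps(7) by blast
    then show "a = 0 \<or> b = 0" using Af(4)[OF k(1)] k(2,3) that unfolding elt_prime_def by blast
  qed
  moreover have "elt_semiprime A" if st "elt_semiprime R"
    unfolding elt_semiprime_def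
  proof (intro ballI impI)
    fix a assume ab: "a \<in> A" "\<forall>z\<in>A. a * z * a = 0"
    then obtain k where k: "k \<in> \<Lambda>" "a \<in> Af k" using dir[of "{a}"] by auto
    then have "\<forall>z\<in>Af k. a * z * a = 0" using ab(2) limit.hyps(7) by blast
    then show "a = 0" using Af(4)[OF k(1)] k(2) that unfolding elt_semiprime_def by blast
  qed
  ultimately show ?case unfolding good_def using A limit(1) by blast
next
  case (succ k At B A)
  have cut: "is_cut I (insert k (seg I k))" using is_cut_insert_seg[OF succ(1)] .
  have "good st (Sk (insert k (seg I k))) At"
    using good_special[OF succ(1,2)] succ.IH by blast
  then have "good st (Sk (insert k (seg I k))) A"
    using good_nicely_ess[OF Sk_subring[OF cut] _ _ _ succ.hyps(3)] Sk_props[OF cut] by blast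
  then show ?case using cut by blast
qed

lemma ess_goldie:
  assumes "ess st R I x Sk J A"
  shows "left_goldie A \<and> udim A = udim R"
proof -
  have J: "is_cut I J" and g: "good st (Sk J) A" using good_ess[OF assms] by auto
  have A: "is_subring A" and lA: "lin_closed A (Sk J)" and ge: "udim_ge A n" using g unfolding good_def by auto
  have S: "nonsing (Sk J)" "udim_le (Sk J) {0} (Sk J) n" using Sk_props[OF J] by auto
  have le: "udim_le A {0} A n" using udim_le_lin_closed[OF lA A S(2)] .
  have "acc_lann A" using acc_lann_if_nonsing[OF Sk_subring[OF J] S lin_closed_subset[OF lA]] .
  then show ?thesis unfolding left_goldie_def
    using finite_udim_if_udim_le[OF A le] udim_eq[OF A ge le] udim_eq[OF R geR leR] by simp
qed

end

theorem mainTheorem18: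
  fixes R :: "'a::ring_1 set" and I :: "'i::wellorder set" and x :: "'i \<Rightarrow> 'a"
    and Sk :: "'i set \<Rightarrow> 'a set" and \<alpha> \<delta> :: "'i \<Rightarrow> 'a \<Rightarrow> 'a" and A :: "'a set"
  assumes setting: "skew_setting R I x Sk \<alpha> \<delta>"
    and goldie: "left_goldie R"
  shows "(prime_ring R \<longrightarrow>
            (ess False R I x Sk I A \<longrightarrow> left_goldie A \<and> udim A = udim R) \<and>
            (ess True R I x Sk I A \<longrightarrow> prime_ring A)) \<and>
         (semiprime_ring R \<longrightarrow>
            (ess False R I x Sk I A \<longrightarrow> left_goldie A \<and> udim A = udim R) \<and>
            (ess True R I x Sk I A \<longrightarrow> semiprime_ring A))"
proof -
  have "is_cut I {} \<longrightarrow> is_subring (Sk {}) \<and> free_std R x {} (Sk {})" and "Sk {} = R"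
    using setting unfolding skew_setting_def by blast+
  then have R: "is_subring R" unfolding is_cut_def by simp
  obtain n where n: "udim_ge R n" "udim_le R {0} R n"
    using udim_attained[OF R] goldie unfolding left_goldie_def by blast
  \<comment> \<open>The prime case enters here as well, through \<open>sp\<close>.\<close>
  have skew: "skew R I x Sk \<alpha> \<delta> n" if "elt_semiprime R"
    using that nonsing_if_semiprime[OF R] goldie n setting unfolding left_goldie_def skew_def by blast
  have sp: "elt_prime R \<Longrightarrow> elt_semiprime R" unfolding elt_prime_def elt_semiprime_def by blast
  have gold: "left_goldie A \<and> udim A = udim R" if "elt_semiprime R" "ess False R I x Sk I A"
    using skew.ess_goldie[OF skew[OF that(1)] that(2)] .
  have good: "is_subring A \<and> (elt_prime R \<longrightarrow> elt_prime A) \<and> (elt_semiprime R \<longrightarrow> elt_semiprime A)"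
    if "elt_semiprime R" "ess True R I x Sk I A"
    using skew.good_ess[OF skew[OF that(1)] that(2)] unfolding skew.good_def[OF skew[OF that(1)]] by blast
  show ?thesis
    using gold good sp elt_prime_iff[OF R] elt_semiprime_iff[OF R] elt_prime_iff[of A] elt_semiprime_iff[of A]
    by blast
qed

end
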